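(* Let $\mathcal P\in\{\mathcal G,\mathcal M\}$. For every q-cofibrant $\mathcal P$-multipointed $d$-space $A$, the directed space $\overrightarrow{\mathrm{Sp}}(A)$ is itself a saturated clock. In particular, its identity map makes it a timed space over itself.
   Context: $\mathbb I=[0,1]$. $\mathbf{Top}$ denotes one of the following two categories (the statement is asserted for each choice): the category of $\Delta$-generated spaces (topology final with respect to continuous maps from standard simplices), or its full subcategory of $\Delta$-Hausdorff spaces (images of continuous maps from $\mathbb I$ are closed). Directed spaces. A directed space $X=(|X|,dX)$ is a space $|X|\in\mathbf{Top}$ with a set $dX$ of continuous maps $\mathbb I\to|X|$ (directed paths) containing constant paths and closed under precomposition with continuous nondecreasing maps $\mathbb I\to\mathbb I$ and under normalized composition $(x*_Ny)(t)=x(2t)$ for $t\le\frac12$, $y(2t-1)$ for $t\ge\frac12$, when $x(1)=y(0)$. Directed maps are continuous maps preserving directed paths. $\mathsf{Rep}_+$ is the monoid of continuous nondecreasing surjections $\mathbb I\to\mathbb I$. $X$ is saturated if $x\circ\phi\in dX$ with $x$ continuous and $\phi\in\mathsf{Rep}_+$ implies $x\in dX$. A directed map $p$ is regular if $p\circ x$ constant implies $x$ constant for every directed path $x$. A clock is a directed space whose underlying space is submetrizable (admits a continuous injective map into a metric space). A timed space over a clock $C$ is a regular directed map $p:X\to C$ with $X$ saturated. Multipointed $d$-spaces. Put $\mathcal M(1,1)=\mathsf{Rep}_+$ and let $\mathcal G(1,1)$ be the group of increasing homeomorphisms of $\mathbb I$. For $\mathcal P\in\{\mathcal G,\mathcal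 M\}$, a $\mathcal P$-multipointed $d$-space $A=(|A|,A^0,\mathbb P^{\mathrm{top}}A)$ is a space $|A|\in\mathbf{Top}$, a set of states $A^0\subset|A|$, and a set $\mathbb P^{\mathrm{top}}A$ of continuous maps $\mathbb I\to|A|$ (execution paths) with endpoints in $A^0$, closed under precomposition with elements of $\mathcal P(1,1)$ and under normalized composition; constant paths need not be execution paths. Morphisms are continuous maps preserving states and execution paths. The globe $\mathrm{Glob}^{\mathrm{top}}_{\mathcal P}(Z)$ of a space $Z$ has underlying space $(\{0,1\}\sqcup(Z\times\mathbb I))/((z,0)\sim0,(z,1)\sim1)$, states $0,1$, and execution paths $t\mapsto[z,\phi(t)]$, $z\in Z$, $\phi\in\mathcal P(1,1)$. A cellular object is the colimit of a transfinite tower starting from a discrete set of states (no execution paths), whose successor steps are pushouts along $\mathrm{Glob}^{\mathrm{top}}_{\mathcal P}(\mathsf S^{n-1})\subset\mathrm{Glob}^{\mathrm{top}}_{\mathcal P}(\mathsf D^n)$, $n\ge0$, and with colimits at limit stages. $A$ is q-cofibrant if it is a retract of a cellular object (this is cofibrancy in the q-model structure, whose generating cofibrations are these globe inclusions together with $\varnothing\to\{0\}$ and $\{0,1\}\to\{0\}$ between discrete state spaces). $\overrightarrow{\mathrm{Sp}}(A)$ is the directed space with underlying space $|A|$ and with the smallest directed structure containing the execution paths of $A$ (generated from them by adding constant paths, precomposing with continuous nondecreasing maps $\mathbb I\to\mathbb I$, and concatenating). *)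

theory Defs
  imports "HOL-Analysis.Analysis" "HOL-Homology.Simplices"
begin

section \<open>The two convenient categories of spaces\<close>

abbreviation unit_interval :: "real topology" where
  "unit_interval \<equiv> top_of_set {0..1}"

abbreviation simplex_space :: "nat \<Rightarrow> (nat \<Rightarrow> real) topology" where
  "simplex_space p \<equiv> subtopology (powertop_real UNIV) (standard_simplex p)"

definition delta_generated :: "'a topology \<Rightarrow> bool" where
  "delta_generated X \<longleftrightarrow>
    (\<forall>U. U \<subseteq> topspace X \<and>
      (\<forall>p f. continuous_map (simplex_space p) X f \<longrightarrow>
         openin (simplex_space p) {s \<in> topspace (simplex_space p). f s \<in> U})
      \<longrightarrow> openin X U)"

definition delta_Hausdorff :: "'a topology \<Rightarrow> bool" where
  "delta_Hausdorff X \<longleftrightarrow> (\<forall>f. continuous_map unit_interval X f \<longrightarrow> closedin X (f ` {0..1}))"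

datatype space_category = Delta_Generated | Delta_Hausdorff

fun space_in :: "space_category \<Rightarrow> 'a topology \<Rightarrow> bool" where
  "space_in Delta_Generated X \<longleftrightarrow> delta_generated X"
| "space_in Delta_Hausdorff X \<longleftrightarrow> delta_generated X \<and> delta_Hausdorff X"


section \<open>Paths and reparametrizations\<close>

text \<open>Paths are normalized to be \<^const>\<open>undefined\<close> outside the unit interval, so that equality
  of functions is equality of maps out of the unit interval.  Reparametrizations, in contrast, are
  arbitrary real functions whose values outside the unit interval are irrelevant.\<close>

definition paths_in :: "'a topology \<Rightarrow> (real \<Rightarrow> 'a) set" where
  "paths_in X = {x. continuous_map unit_interval X x \<and> x \<in> extensional {0..1}}"

definition const_path :: "'a \<Rightarrow> real \<Rightarrow> 'a" where
  "const_path a = restrict (\<lambda>t. a) {0..1}"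

definition reparam :: "(real \<Rightarrow> 'a) \<Rightarrow> (real \<Rightarrow> real) \<Rightarrow> real \<Rightarrow> 'a" where
  "reparam x \<phi> = restrict (x \<circ> \<phi>) {0..1}"

definition path_image_under :: "('a \<Rightarrow> 'b) \<Rightarrow> (real \<Rightarrow> 'a) \<Rightarrow> real \<Rightarrow> 'b" where
  "path_image_under f x = restrict (f \<circ> x) {0..1}"

definition normalized_comp :: "(real \<Rightarrow> 'a) \<Rightarrow> (real \<Rightarrow> 'a) \<Rightarrow> real \<Rightarrow> 'a" where
  "normalized_comp x y = restrict (\<lambda>t. if t \<le> 1/2 then x (2 * t) else y (2 * t - 1)) {0..1}"

definition nondecreasing_maps :: "(real \<Rightarrow> real) set" where
  "nondecreasing_maps = {\<phi>. continuous_map unit_interval unit_interval \<phi> \<and> mono_on {0..1} \<phi>}"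

definition Rep_plus :: "(real \<Rightarrow> real) set" where
  "Rep_plus = {\<phi> \<in> nondecreasing_maps. \<phi> ` {0..1} = {0..1}}"

definition increasing_homeos :: "(real \<Rightarrow> real) set" where
  "increasing_homeos =
    {\<phi>. homeomorphic_map unit_interval unit_interval \<phi> \<and> strict_mono_on {0..1} \<phi>}"


section \<open>Directed spaces, clocks and timed spaces\<close>

record 'a dspace =
  dtop :: "'a topology"
  dpaths :: "(real \<Rightarrow> 'a) set"

definition directed_space :: "space_category \<Rightarrow> 'a dspace \<Rightarrow> bool" where
  "directed_space c X \<longleftrightarrow>
     space_in c (dtop X) \<and>
     dpaths X \<subseteq> paths_in (dtop X) \<and>
     (\<forall>a \<in> topspace (dtop X). const_path a \<in> dpaths X) \<and>
     (\<forall>x \<in> dpaths X. \<forall>\<phi> \<in> nondecreasing_maps. reparam x \<phi> \<in> dpaths X) \<and>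
     (\<forall>x \<in> dpaths X. \<forall>y \<in> dpaths X. x 1 = y 0 \<longrightarrow> normalized_comp x y \<in> dpaths X)"

definition directed_map :: "'a dspace \<Rightarrow> 'b dspace \<Rightarrow> ('a \<Rightarrow> 'b) \<Rightarrow> bool" where
  "directed_map X Y f \<longleftrightarrow>
     continuous_map (dtop X) (dtop Y) f \<and>
     (\<forall>x \<in> dpaths X. path_image_under f x \<in> dpaths Y)"

definition saturated :: "'a dspace \<Rightarrow> bool" where
  "saturated X \<longleftrightarrow>
     (\<forall>x \<in> paths_in (dtop X). \<forall>\<phi> \<in> Rep_plus. reparam x \<phi> \<in> dpaths X \<longrightarrow> x \<in> dpaths X)"

definition constant_path :: "(real \<Rightarrow> 'a) \<Rightarrow> bool" where
  "constant_path x \<longleftrightarrow> x constant_on {0..1}"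

definition regular_map :: "'a dspace \<Rightarrow> 'b dspace \<Rightarrow> ('a \<Rightarrow> 'b) \<Rightarrow> bool" where
  "regular_map X Y p \<longleftrightarrow>
     directed_map X Y p \<and>
     (\<forall>x \<in> dpaths X. constant_path (path_image_under p x) \<longrightarrow> constant_path x)"

text \<open>The metric space may be taken on the point type of the space itself: only the image of the
  injective map matters, and it is in bijection with the space.\<close>

definition submetrizable :: "'a topology \<Rightarrow> bool" where
  "submetrizable X \<longleftrightarrow>
     (\<exists>(m :: 'a metric) f. continuous_map X (mtopology_of m) f \<and> inj_on f (topspace X))"

definition clock :: "space_category \<Rightarrow> 'a dspace \<Rightarrow> bool" where
  "clock c C \<longleftrightarrow> directed_space c C \<and> submetrizable (dtop C)"

definition timed_space ::
  "space_category \<Rightarrow> 'b dspace \<Rightarrow> 'a dspace \<Rightarrow> ('a \<Rightarrow> 'b) \<Rightarrow> bool" where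
  "timed_space c C X p \<longleftrightarrow>
     clock c C \<and> directed_space c X \<and> saturated X \<and> regular_map X C p"


section \<open>Multipointed $d$-spaces\<close>

datatype reparam_kind = G_kind | M_kind

fun kind_maps :: "reparam_kind \<Rightarrow> (real \<Rightarrow> real) set" where
  "kind_maps G_kind = increasing_homeos"
| "kind_maps M_kind = Rep_plus"

record 'a mdspace =
  mtop :: "'a topology"
  mstates :: "'a set"
  mpaths :: "(real \<Rightarrow> 'a) set"

definition multipointed :: "space_category \<Rightarrow> reparam_kind \<Rightarrow> 'a mdspace \<Rightarrow> bool" where
  "multipointed c P A \<longleftrightarrow>
     space_in c (mtop A) \<and>
     mstates A \<subseteq> topspace (mtop A) \<and>
     mpaths A \<subseteq> paths_in (mtop A) \<and>
     (\<forall>x \<in> mpaths A. x 0 \<in> mstates A \<and> x 1 \<in> mstates A) \<and>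
     (\<forall>x \<in> mpaths A. \<forall>\<phi> \<in> kind_maps P. reparam x \<phi> \<in> mpaths A) \<and>
     (\<forall>x \<in> mpaths A. \<forall>y \<in> mpaths A. x 1 = y 0 \<longrightarrow> normalized_comp x y \<in> mpaths A)"

definition md_map :: "'a mdspace \<Rightarrow> 'b mdspace \<Rightarrow> ('a \<Rightarrow> 'b) \<Rightarrow> bool" where
  "md_map A B f \<longleftrightarrow>
     continuous_map (mtop A) (mtop B) f \<and>
     f ` mstates A \<subseteq> mstates B \<and>
     (\<forall>x \<in> mpaths A. path_image_under f x \<in> mpaths B)"

definition md_discrete :: "'a set \<Rightarrow> 'a mdspace" where
  "md_discrete S = \<lparr>mtop = discrete_topology S, mstates = S, mpaths = {}\<rparr>"

definition md_retract :: "'a mdspace \<Rightarrow> 'b mdspace \<Rightarrow> bool" where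
  "md_retract A B \<longleftrightarrow>
     (\<exists>s r. md_map A B s \<and> md_map B A r \<and> (\<forall>a \<in> topspace (mtop A). r (s a) = a))"


section \<open>Globes\<close>

text \<open>Points of the quotient of the disjoint union of $\{0,1\}$ and $Z \times [0,1]$ are represented
  by normal forms: \<open>Source\<close> and \<open>Target\<close> are the classes of 0 and 1, and the interior points
  \<open>Inner z t\<close> with $0 < t < 1$ are not identified with anything.\<close>

datatype 'z globe_point = Source | Target | Inner 'z real

definition globe_class :: "'z \<Rightarrow> real \<Rightarrow> 'z globe_point" where
  "globe_class z t = (if t = 0 then Source else if t = 1 then Target else Inner z t)"

definition globe_carrier :: "'z topology \<Rightarrow> 'z globe_point set" where
  "globe_carrier Z = {Source, Target} \<union> {globe_class z t |z t. z \<in> topspace Z \<and> t \<in> {0..1}}"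

text \<open>Quotient topology; the discrete summand $\{0,1\}$ imposes no condition on open sets.
  For the disks and spheres used below, the ordinary product with the interval is already the
  product in either category of spaces.\<close>

definition globe_openin :: "'z topology \<Rightarrow> 'z globe_point set \<Rightarrow> bool" where
  "globe_openin Z U \<longleftrightarrow>
     U \<subseteq> globe_carrier Z \<and>
     openin (prod_topology Z unit_interval)
       {(z, t). z \<in> topspace Z \<and> t \<in> {0..1} \<and> globe_class z t \<in> U}"

definition globe_topology :: "'z topology \<Rightarrow> 'z globe_point topology" where
  "globe_topology Z = topology (globe_openin Z)"

lemma istopology_globe_openin: "istopology (globe_openin Z)"
proof -
  let ?V = "\<lambda>U. {(z, t). z \<in> topspace Z \<and> t \<in> {0..1} \<and> globe_class z t \<in> U}"
  have "?V (S \<inter> T) = ?V S \<inter> ?V T" for S T by auto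
  moreover have "?V (\<Union>\<K>) = (\<Union>K\<in>\<K>. ?V K)" for \<K> by auto
  ultimately show ?thesis
    unfolding istopology_def globe_openin_def by (smt (verit) Sup_least imageE le_infI1 openin_Int openin_Union)
qed

lemma openin_globe_topology: "openin (globe_topology Z) = globe_openin Z"
  by (simp add: globe_topology_def istopology_globe_openin)

definition globe :: "reparam_kind \<Rightarrow> 'z topology \<Rightarrow> 'z globe_point mdspace" where
  "globe P Z =
     \<lparr>mtop = globe_topology Z,
      mstates = {Source, Target},
      mpaths = {restrict (\<lambda>t. globe_class z (\<phi> t)) {0..1} |z \<phi>. z \<in> topspace Z \<and> \<phi> \<in> kind_maps P}\<rparr>"

text \<open>The sphere of dimension $n - 1$ is indexed by \<open>n\<close>, so that \<open>n = 0\<close> gives the empty space.\<close>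

definition disk :: "nat \<Rightarrow> (nat \<Rightarrow> real) topology" where
  "disk n = subtopology (Euclidean_space n) {v. (\<Sum>i<n. (v i)\<^sup>2) \<le> 1}"

definition boundary_sphere :: "nat \<Rightarrow> (nat \<Rightarrow> real) topology" where
  "boundary_sphere n = subtopology (Euclidean_space n) {v. (\<Sum>i<n. (v i)\<^sup>2) = 1}"


section \<open>Cellular and q-cofibrant objects\<close>

text \<open>Colimits are taken in the category of multipointed $d$-spaces and are characterized by their
  universal property.  HOL cannot quantify over the point types of the test objects, so these are
  drawn from \<open>'b + real\<close>, where \<open>'b\<close> is the point type of the colimit.  This is no restriction in
  the colimits used for cellular objects.  The type contains copies of the two-point indiscrete
  space and of the unit interval, with all points as states and all paths as execution paths, and
  these detect equality of points in the actual colimit (the former in the $\Delta$-generated case;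
  the latter in the $\Delta$-Hausdorff case, since points of a cell complex are separated by
  real-valued maps).  Hence the actual colimit injects into the candidate, so it has
  a copy in the test type, and the two are isomorphic.

  Maps are only relevant on the underlying spaces, hence the pointwise form of commutation and
  uniqueness.\<close>

definition md_pushout ::
  "space_category \<Rightarrow> reparam_kind \<Rightarrow> 'k mdspace \<Rightarrow> 'l mdspace \<Rightarrow> 'b mdspace \<Rightarrow> 'b mdspace \<Rightarrow>
     ('k \<Rightarrow> 'l) \<Rightarrow> ('k \<Rightarrow> 'b) \<Rightarrow> ('l \<Rightarrow> 'b) \<Rightarrow> ('b \<Rightarrow> 'b) \<Rightarrow> bool" where
  "md_pushout c P K L X Y i g h j \<longleftrightarrow>
     md_map K L i \<and> md_map K X g \<and> md_map L Y h \<and> md_map X Y j \<and>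
     (\<forall>a \<in> topspace (mtop K). h (i a) = j (g a)) \<and>
     (\<forall>(Z :: ('b + real) mdspace) u v.
        multipointed c P Z \<and> md_map L Z u \<and> md_map X Z v \<and>
        (\<forall>a \<in> topspace (mtop K). u (i a) = v (g a)) \<longrightarrow>
        (\<exists>w. (md_map Y Z w \<and>
              (\<forall>b \<in> topspace (mtop L). w (h b) = u b) \<and>
              (\<forall>b \<in> topspace (mtop X). w (j b) = v b)) \<and>
             (\<forall>w'. md_map Y Z w' \<and>
              (\<forall>b \<in> topspace (mtop L). w' (h b) = u b) \<and>
              (\<forall>b \<in> topspace (mtop X). w' (j b) = v b) \<longrightarrow>
              (\<forall>b \<in> topspace (mtop Y). w' b = w b))))"

definition md_cocone ::
  "'i rel \<Rightarrow> 'i set \<Rightarrow> ('i \<Rightarrow> 'b mdspace) \<Rightarrow> ('i \<Rightarrow> 'i \<Rightarrow> 'b \<Rightarrow> 'b) \<Rightarrow>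
     'd mdspace \<Rightarrow> ('i \<Rightarrow> 'b \<Rightarrow> 'd) \<Rightarrow> bool" where
  "md_cocone r I X f D k \<longleftrightarrow>
     (\<forall>i \<in> I. md_map (X i) D (k i)) \<and>
     (\<forall>i \<in> I. \<forall>j \<in> I. (i, j) \<in> r \<longrightarrow> (\<forall>a \<in> topspace (mtop (X i)). k j (f i j a) = k i a))"

definition md_colimit ::
  "space_category \<Rightarrow> reparam_kind \<Rightarrow> 'i rel \<Rightarrow> 'i set \<Rightarrow> ('i \<Rightarrow> 'b mdspace) \<Rightarrow>
     ('i \<Rightarrow> 'i \<Rightarrow> 'b \<Rightarrow> 'b) \<Rightarrow> 'b mdspace \<Rightarrow> ('i \<Rightarrow> 'b \<Rightarrow> 'b) \<Rightarrow> bool" where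
  "md_colimit c P r I X f D k \<longleftrightarrow>
     md_cocone r I X f D k \<and>
     (\<forall>(Z :: ('b + real) mdspace) u.
        multipointed c P Z \<and> md_cocone r I X f Z u \<longrightarrow>
        (\<exists>w. (md_map D Z w \<and> (\<forall>i \<in> I. \<forall>a \<in> topspace (mtop (X i)). w (k i a) = u i a)) \<and>
             (\<forall>w'. md_map D Z w' \<and> (\<forall>i \<in> I. \<forall>a \<in> topspace (mtop (X i)). w' (k i a) = u i a) \<longrightarrow>
              (\<forall>b \<in> topspace (mtop D). w' b = w b))))"

definition cell_attachment ::
  "space_category \<Rightarrow> reparam_kind \<Rightarrow> 'b mdspace \<Rightarrow> 'b mdspace \<Rightarrow> ('b \<Rightarrow> 'b) \<Rightarrow> bool" where
  "cell_attachment c P X Y j \<longleftrightarrow>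
     (\<exists>n g h. md_pushout c P (globe P (boundary_sphere n)) (globe P (disk n)) X Y id g h j)"

definition immediate_succ :: "'i rel \<Rightarrow> 'i \<Rightarrow> 'i \<Rightarrow> bool" where
  "immediate_succ r i j \<longleftrightarrow> j \<in> Field r \<and> i \<in> underS r j \<and> (\<forall>k \<in> underS r j. (k, i) \<in> r)"

text \<open>The stages are indexed by the field of a well-order \<open>r\<close>, i.e. by an arbitrary nonzero ordinal.\<close>

definition cell_tower ::
  "space_category \<Rightarrow> reparam_kind \<Rightarrow> 'i rel \<Rightarrow> ('i \<Rightarrow> 'b mdspace) \<Rightarrow>
     ('i \<Rightarrow> 'i \<Rightarrow> 'b \<Rightarrow> 'b) \<Rightarrow> bool" where
  "cell_tower c P r X f \<longleftrightarrow>
     Well_order r \<and> Field r \<noteq> {} \<and>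
     (\<forall>i \<in> Field r. multipointed c P (X i)) \<and>
     (\<forall>i j. (i, j) \<in> r \<longrightarrow> md_map (X i) (X j) (f i j)) \<and>
     (\<forall>i \<in> Field r. \<forall>a \<in> topspace (mtop (X i)). f i i a = a) \<and>
     (\<forall>i j k. (i, j) \<in> r \<and> (j, k) \<in> r \<longrightarrow>
        (\<forall>a \<in> topspace (mtop (X i)). f j k (f i j a) = f i k a)) \<and>
     (\<forall>i \<in> Field r. underS r i = {} \<longrightarrow> (\<exists>S. X i = md_discrete S)) \<and>
     (\<forall>i j. immediate_succ r i j \<longrightarrow> cell_attachment c P (X i) (X j) (f i j)) \<and>
     (\<forall>j \<in> Field r. underS r j \<noteq> {} \<and> (\<nexists>i. immediate_succ r i j) \<longrightarrow>
        md_colimit c P r (underS r j) X f (X j) (\<lambda>i. f i j))"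

definition cellular ::
  "'i itself \<Rightarrow> space_category \<Rightarrow> reparam_kind \<Rightarrow> 'b mdspace \<Rightarrow> bool" where
  "cellular (_ :: 'i itself) c P B \<longleftrightarrow>
     multipointed c P B \<and>
     (\<exists>(r :: 'i rel) X f k. cell_tower c P r X f \<and> md_colimit c P r (Field r) X f B k)"

text \<open>The type arguments provide the points of the cellular object and the indices of its tower;
  a statement with both left as type variables covers all q-cofibrant objects.\<close>

definition q_cofibrant ::
  "'b itself \<Rightarrow> 'i itself \<Rightarrow> space_category \<Rightarrow> reparam_kind \<Rightarrow> 'a mdspace \<Rightarrow> bool" where
  "q_cofibrant (_ :: 'b itself) (_ :: 'i itself) c P A \<longleftrightarrow>
     multipointed c P A \<and> (\<exists>B :: 'b mdspace. cellular TYPE('i) c P B \<and> md_retract A B)"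


section \<open>The directed space of a multipointed $d$-space\<close>

inductive_set Sp_paths :: "'a mdspace \<Rightarrow> (real \<Rightarrow> 'a) set" for A :: "'a mdspace" where
  execution: "x \<in> mpaths A \<Longrightarrow> x \<in> Sp_paths A"
| const: "a \<in> topspace (mtop A) \<Longrightarrow> const_path a \<in> Sp_paths A"
| reparam: "x \<in> Sp_paths A \<Longrightarrow> \<phi> \<in> nondecreasing_maps \<Longrightarrow> reparam x \<phi> \<in> Sp_paths A"
| comp: "x \<in> Sp_paths A \<Longrightarrow> y \<in> Sp_paths A \<Longrightarrow> x 1 = y 0 \<Longrightarrow> normalized_comp x y \<in> Sp_paths A"

definition Sp :: "'a mdspace \<Rightarrow> 'a dspace" where
  "Sp A = \<lparr>dtop = mtop A, dpaths = Sp_paths A\<rparr>"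

end

theory Submission
  imports Defs
begin

text \<open>Call a path light if it is constant on no nondegenerate interval.  By transfinite induction
  along the tower of a cellular object, every execution path is a reparametrization of a light
  execution path, and the underlying space admits a continuous injection into a Banach space of
  bounded functions.  The injection extends over each new cell by coning off its boundary values
  and adding fresh coordinates that vanish exactly on the boundary; using new coordinates for every
  cell makes all extensions strictly compatible, so that they pass to colimits.

  The universal properties are exploited twice.  Testing against the unit interval (all paths being
  execution paths) yields the coordinates of the injection.  Testing against the subobject made of
  the points, simplices and suitable paths coming from the earlier stages shows that a colimit has
  no further points and execution paths, and that it carries the final topology.

  Saturation follows since a light path never stops: if \<open>x \<circ> \<phi>\<close> is piecewise a
  reparametrization of light paths, then each reparametrization stops wherever \<open>\<phi>\<close> does and
  so factors through \<open>\<phi>\<close>.  Both properties are inherited by retracts.\<close>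

section \<open>Calculus of paths\<close>

text \<open>The point type \<open>'b + real\<close> of the test objects has room for exactly the two
  tests used: the interval enters through \<open>Inr\<close>, subobjects of the colimit through
  \<open>Inl\<close>. The tests depend on each other. The interval yields coordinates that are
  continuous one by one, which for infinitely many of them does not give continuity in the sup norm;
  norm continuity is checked on simplices of the earlier stages, and this is legitimate only once
  the second test has identified the topology. Conversely, the second test needs injective legs,
  since otherwise light paths could acquire stops, and this injectivity is read off from the
  coordinates. Choosing a metric for each stage separately would not survive limit stages: the maps
  have to agree on the nose there. Hence one index set of coordinates, and one Banach space, is
  fixed in advance for the whole tower.\<close>

lemma nondecreasing_maps_iff:
  "\<phi> \<in> nondecreasing_maps \<longleftrightarrow>
     continuous_on {0..1} \<phi> \<and> \<phi> ` {0..1} \<subseteq> {0..1} \<and> mono_on {0..1} \<phi>"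
  by (auto simp: nondecreasing_maps_def continuous_map_in_subtopology)

lemma Rep_plus_iff:
  "\<phi> \<in> Rep_plus \<longleftrightarrow> continuous_on {0..1} \<phi> \<and> \<phi> ` {0..1} = {0..1} \<and> mono_on {0..1} \<phi>"
  by (auto simp: Rep_plus_def nondecreasing_maps_iff)

lemma Rep_plus_endpoints:
  assumes "\<phi> \<in> Rep_plus"
  shows "\<phi> 0 = 0" "\<phi> 1 = 1"
proof -
  have im: "\<phi> ` {0..1} = {0..1}" and mono: "mono_on {0..1} \<phi>"
    using assms by (auto simp: Rep_plus_iff)
  have "0 \<in> \<phi> ` {0..1}" "1 \<in> \<phi> ` {0..1}" using im by auto
  then obtain s t where st: "s \<in> {0..1}" "t \<in> {0..1}" "\<phi> s = 0" "\<phi> t = 1" by (metis imageE)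
  have "\<phi> 0 \<in> {0..1}" "\<phi> 1 \<in> {0..1}" using im by auto
  moreover have "\<phi> 0 \<le> \<phi> s" by (rule mono_onD[OF mono]) (use st in auto)
  moreover have "\<phi> t \<le> \<phi> 1" by (rule mono_onD[OF mono]) (use st in auto)
  ultimately show "\<phi> 0 = 0" "\<phi> 1 = 1" using st by auto
qed

lemma Rep_plusI:
  assumes "continuous_on {0..1} \<phi>" "mono_on {0..1} \<phi>" "\<phi> 0 = 0" "\<phi> 1 = 1"
  shows "\<phi> \<in> Rep_plus"
proof -
  have "\<phi> ` {0..1} \<subseteq> {0..1}"
  proof clarsimp
    fix t :: real assume "0 \<le> t" "t \<le> 1"
    then show "0 \<le> \<phi> t \<and> \<phi> t \<le> 1"
      using mono_onD[OF assms(2), of 0 t] mono_onD[OF assms(2), of t 1] assms by auto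
  qed
  moreover have "{0..1} \<subseteq> \<phi> ` {0..1}"
    using IVT'[of \<phi> 0 _ 1] assms by (force simp: image_iff)
  ultimately show ?thesis using assms by (auto simp: Rep_plus_iff)
qed

lemma increasing_homeos_subset_Rep_plus: "increasing_homeos \<subseteq> Rep_plus"
proof
  fix \<phi> assume "\<phi> \<in> increasing_homeos"
  then have h: "homeomorphic_map unit_interval unit_interval \<phi>" and "strict_mono_on {0..1} \<phi>"
    by (auto simp: increasing_homeos_def)
  then have "mono_on {0..1} \<phi>" by (simp add: strict_mono_on_imp_mono_on)
  moreover have "\<phi> ` {0..1} = {0..1}" using homeomorphic_imp_surjective_map[OF h] by simp
  moreover have "continuous_on {0..1} \<phi>"
    using homeomorphic_imp_continuous_map[OF h] by (simp add: continuous_map_in_subtopology)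
  ultimately show "\<phi> \<in> Rep_plus" by (simp add: Rep_plus_iff)
qed

lemma kind_maps_subset_Rep_plus: "kind_maps P \<subseteq> Rep_plus"
  using increasing_homeos_subset_Rep_plus by (cases P) auto

lemma ident_in_kind_maps: "(\<lambda>t. t) \<in> kind_maps P"
proof (cases P)
  case G_kind
  have "homeomorphic_map unit_interval unit_interval (\<lambda>t. t)"
    using homeomorphic_map_id[of unit_interval] by (simp add: id_def)
  then show ?thesis using G_kind by (auto simp: increasing_homeos_def strict_mono_on_def)
next
  case M_kind
  then show ?thesis by (auto simp: Rep_plus_iff mono_on_def)
qed

lemma kind_maps_range: "\<phi> \<in> kind_maps P \<Longrightarrow> t \<in> {0..1} \<Longrightarrow> \<phi> t \<in> {0..1}"
  using kind_maps_subset_Rep_plus by (fastforce simp: Rep_plus_iff)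

lemma Rep_plus_comp:
  assumes "\<phi> \<in> Rep_plus" "\<psi> \<in> Rep_plus"
  shows "\<phi> \<circ> \<psi> \<in> Rep_plus"
proof -
  have "continuous_on {0..1} (\<phi> \<circ> \<psi>)"
    using assms by (intro continuous_on_compose) (auto simp: Rep_plus_iff)
  moreover have "mono_on {0..1} (\<phi> \<circ> \<psi>)"
  proof (rule mono_onI)
    fix s t :: real assume st: "s \<in> {0..1}" "t \<in> {0..1}" "s \<le> t"
    then have "\<psi> s \<le> \<psi> t" "\<psi> s \<in> {0..1}" "\<psi> t \<in> {0..1}"
      using assms(2) by (auto simp: Rep_plus_iff mono_on_def)
    then show "(\<phi> \<circ> \<psi>) s \<le> (\<phi> \<circ> \<psi>) t"
      using assms(1) by (auto simp: Rep_plus_iff mono_on_def)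
  qed
  moreover have "(\<phi> \<circ> \<psi>) ` {0..1} = {0..1}"
    using assms by (simp only: image_comp[symmetric] Rep_plus_iff)
  ultimately show ?thesis by (simp add: Rep_plus_iff)
qed

lemma reparam_reparam:
  assumes "\<And>t. t \<in> {0..1} \<Longrightarrow> \<phi> t \<in> {0..1}"
  shows "reparam (reparam x \<psi>) \<phi> = reparam x (\<psi> \<circ> \<phi>)"
  using assms by (auto simp: reparam_def restrict_def fun_eq_iff)

lemma path_image_under_reparam:
  assumes "\<And>t. t \<in> {0..1} \<Longrightarrow> \<phi> t \<in> {0..1}"
  shows "path_image_under f (reparam x \<phi>) = reparam (path_image_under f x) \<phi>"
  using assms by (auto simp: path_image_under_def reparam_def restrict_def fun_eq_iff)

lemma path_image_under_comp:
  "path_image_under f (path_image_under g x) = path_image_under (f \<circ> g) x"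
  by (auto simp: path_image_under_def restrict_def fun_eq_iff)

lemma path_image_under_const: "path_image_under f (const_path a) = const_path (f a)"
  by (auto simp: path_image_under_def const_path_def restrict_def fun_eq_iff)

lemma path_image_under_normalized_comp:
  "path_image_under f (normalized_comp x y) =
     normalized_comp (path_image_under f x) (path_image_under f y)"
  by (auto simp: path_image_under_def normalized_comp_def restrict_def fun_eq_iff)

lemma path_image_under_cong:
  assumes "\<And>t. t \<in> {0..1} \<Longrightarrow> f (x t) = g (x t)"
  shows "path_image_under f x = path_image_under g x"
  using assms by (auto simp: path_image_under_def restrict_def fun_eq_iff)

lemma path_image_under_id:
  assumes "x \<in> paths_in X" "\<And>a. a \<in> topspace X \<Longrightarrow> f a = a"
  shows "path_image_under f x = x"
proof
  fix t
  have "x t \<in> topspace X" if "t \<in> {0..1}"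
    using assms(1) that by (auto simp: paths_in_def continuous_map_def Pi_iff)
  then show "path_image_under f x t = x t"
    using assms by (cases "t \<in> {0..1}") (auto simp: path_image_under_def paths_in_def extensional_def)
qed

lemma paths_in_topspace: "x \<in> paths_in X \<Longrightarrow> t \<in> {0..1} \<Longrightarrow> x t \<in> topspace X"
  by (auto simp: paths_in_def continuous_map_def Pi_iff)

lemma const_path_in_paths_in: "a \<in> topspace X \<Longrightarrow> const_path a \<in> paths_in X"
  by (auto simp: paths_in_def const_path_def intro: continuous_map_eq[of _ _ "\<lambda>t. a"])

lemma reparam_in_paths_in:
  assumes "x \<in> paths_in X" "\<phi> \<in> nondecreasing_maps"
  shows "reparam x \<phi> \<in> paths_in X"
proof -
  have "continuous_map unit_interval X (x \<circ> \<phi>)"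
    using assms unfolding paths_in_def nondecreasing_maps_def by (blast intro: continuous_map_compose)
  then show ?thesis
    by (auto simp: paths_in_def reparam_def intro: continuous_map_eq)
qed

lemma path_image_under_in_paths_in:
  assumes "x \<in> paths_in X" "continuous_map X Y f"
  shows "path_image_under f x \<in> paths_in Y"
proof -
  have "continuous_map unit_interval Y (f \<circ> x)"
    using assms by (auto simp: paths_in_def intro: continuous_map_compose)
  then show ?thesis
    by (auto simp: paths_in_def path_image_under_def intro: continuous_map_eq)
qed

lemma normalized_comp_in_paths_in:
  assumes "x \<in> paths_in X" "y \<in> paths_in X" "x 1 = y 0"
  shows "normalized_comp x y \<in> paths_in X"
proof -
  let ?I = "subtopology unit_interval"
  have "continuous_map unit_interval X
          (\<lambda>t. if t \<le> 1/2 then (x \<circ> (\<lambda>t. 2 * t)) t else (y \<circ> (\<lambda>t. 2 * t - 1)) t)"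
  proof (rule continuous_map_cases_le)
    show "continuous_map (?I {t \<in> topspace unit_interval. t \<le> 1/2}) X (x \<circ> (\<lambda>t. 2 * t))"
    proof (rule continuous_map_compose)
      show "continuous_map unit_interval X x" using assms by (auto simp: paths_in_def)
      show "continuous_map (?I {t \<in> topspace unit_interval. t \<le> 1/2}) unit_interval (\<lambda>t. 2 * t)"
        by (auto simp: continuous_map_in_subtopology subtopology_subtopology intro!: continuous_intros)
    qed
    show "continuous_map (?I {t \<in> topspace unit_interval. 1/2 \<le> t}) X (y \<circ> (\<lambda>t. 2 * t - 1))"
    proof (rule continuous_map_compose)
      show "continuous_map unit_interval X y" using assms by (auto simp: paths_in_def)
      show "continuous_map (?I {t \<in> topspace unit_interval. 1/2 \<le> t}) unit_interval (\<lambda>t. 2 * t - 1)"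
        by (auto simp: continuous_map_in_subtopology subtopology_subtopology intro!: continuous_intros)
    qed
    show "(x \<circ> (\<lambda>t. 2 * t)) t = (y \<circ> (\<lambda>t. 2 * t - 1)) t" if "t = 1/2" for t
      unfolding that using assms(3) by simp
  qed auto
  then show ?thesis
    by (auto simp: paths_in_def normalized_comp_def intro: continuous_map_eq)
qed

section \<open>Light paths\<close>

definition light :: "(real \<Rightarrow> 'a) \<Rightarrow> bool" where
  "light e \<longleftrightarrow> (\<forall>s t. 0 \<le> s \<and> s < t \<and> t \<le> 1 \<longrightarrow> \<not> e constant_on {s..t})"

text \<open>The factor ranges over \<open>Rep_plus\<close> for both kinds of reparametrization.
  Along a globe, a homeomorphism produces no stops, while a general element of
  \<open>Rep_plus\<close> may, and its path is then only a reparametrization of a light one.\<close>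

definition lightly_generated :: "'a mdspace \<Rightarrow> bool" where
  "lightly_generated A \<longleftrightarrow>
     (\<forall>x \<in> mpaths A. \<exists>e \<in> mpaths A. light e \<and> (\<exists>\<psi> \<in> Rep_plus. x = reparam e \<psi>))"

text \<open>A nondegenerate interval contains two distinct interior points, here the ones at its
  thirds. The open interval is used because both poles of a globe may be sent to the same
  state.\<close>

lemma light_inj_on:
  assumes "inj_on e {0<..<1}"
  shows "light e"
  unfolding light_def
proof clarify
  fix s t :: real assume st: "0 \<le> s" "s < t" "t \<le> 1" and c: "e constant_on {s..t}"
  let ?a = "(2 * s + t) / 3" and ?b = "(s + 2*t) / 3"
  have "e ?a = e ?b" using c st by (auto simp: constant_on_def)
  then have "?a = ?b" using st by (intro inj_onD[OF assms]) auto
  then show False using st by simp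
qed

lemma light_path_image_under:
  assumes "light x" "inj_on f (topspace X)" "x \<in> paths_in X"
  shows "light (path_image_under f x)"
  unfolding light_def
proof clarify
  fix s t :: real
  assume st: "0 \<le> s" "s < t" "t \<le> 1" and "path_image_under f x constant_on {s..t}"
  then obtain c where c: "\<And>u. u \<in> {s..t} \<Longrightarrow> f (x u) = c"
    by (force simp: constant_on_def path_image_under_def)
  have "x u = x s" if "u \<in> {s..t}" for u
  proof (rule inj_onD[OF assms(2)])
    show "f (x u) = f (x s)" using c[of u] c[of s] that st by simp
  qed (use that st in \<open>auto intro!: paths_in_topspace[OF assms(3)]\<close>)
  then have "x constant_on {s..t}" unfolding constant_on_def by blast
  then show False using assms(1) st by (auto simp: light_def)
qed

lemma light_normalized_comp:
  assumes "light x" "light y"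
  shows "light (normalized_comp x y)"
  unfolding light_def
proof clarify
  fix s t :: real
  assume st: "0 \<le> s" "s < t" "t \<le> 1" and "normalized_comp x y constant_on {s..t}"
  then obtain c where c: "\<And>u. u \<in> {s..t} \<Longrightarrow> normalized_comp x y u = c"
    by (auto simp: constant_on_def)
  show False
  proof (cases "s < 1/2")
    case True
    have "x u = c" if "u \<in> {2 * s..min (2*t) 1}" for u
      using c[of "u/2"] that st by (auto simp: normalized_comp_def)
    then have "x constant_on {2 * s..min (2*t) 1}" by (auto simp: constant_on_def)
    then show False using assms(1) st True by (auto simp: light_def)
  next
    case False
    \<comment> \<open>The left end comes from the midpoint of s and t. It lies strictly beyond 1/2,
      where the composite is given by y, even when s = 1/2.\<close>
    have "y u = c" if "u \<in> {s+t-1..2*t-1}" for u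
    proof -
      have "(u+1)/2 \<in> {s..t}" "(u+1)/2 > 1/2" using that st False by auto
      moreover have "2 * ((u+1)/2) - 1 = u" by (simp add: field_simps)
      ultimately show ?thesis using c[of "(u+1)/2"] st by (simp only: normalized_comp_def) auto
    qed
    then have "y constant_on {s+t-1..2*t-1}" by (auto simp: constant_on_def)
    then show False using assms(2) st False by (auto simp: light_def)
  qed
qed

text \<open>The two factors are run at half scale and glued at 1/2. With
  \<open>light_normalized_comp\<close> this makes the reparametrizations of light paths closed under
  composition.\<close>

lemma normalized_comp_reparam:
  assumes "\<phi> \<in> Rep_plus" "\<psi> \<in> Rep_plus" "x 1 = y 0"
  shows "\<exists>\<theta> \<in> Rep_plus. normalized_comp (reparam x \<phi>) (reparam y \<psi>) = reparam (normalized_comp x y) \<theta>"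
proof
  define \<theta> where "\<theta> t = (if t \<le> 1/2 then \<phi> (2*t) / 2 else (1 + \<psi> (2*t - 1)) / 2)" for t
  have \<phi>: "continuous_on {0..1} \<phi>" "\<phi> ` {0..1} = {0..1}" "mono_on {0..1} \<phi>"
    and \<psi>: "continuous_on {0..1} \<psi>" "\<psi> ` {0..1} = {0..1}" "mono_on {0..1} \<psi>"
    using assms by (auto simp: Rep_plus_iff)
  note e = Rep_plus_endpoints[OF assms(1)] Rep_plus_endpoints[OF assms(2)]
  have rng: "0 \<le> \<phi> t" "\<phi> t \<le> 1" "0 \<le> \<psi> t" "\<psi> t \<le> 1" if "0 \<le> t" "t \<le> 1" for t
    using \<phi>(2) \<psi>(2) that by (metis atLeastAtMost_iff imageI)+
  have "{0..1/2} \<union> {1/2..1} = {0..1::real}" by auto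
  moreover have "continuous_on ({0..1/2} \<union> {1/2..1}) \<theta>"
    unfolding \<theta>_def
  proof (rule continuous_on_If)
    fix t :: real assume "t \<in> {0..1/2}" "\<not> t \<le> 1/2"
    then show "\<phi> (2*t) / 2 = (1 + \<psi> (2*t - 1)) / 2" by simp
  next
    fix t :: real assume "t \<in> {1/2..1}" "t \<le> 1/2"
    then have "t = 1/2" by simp
    show "\<phi> (2*t) / 2 = (1 + \<psi> (2*t - 1)) / 2" unfolding \<open>t = 1/2\<close> by (simp add: e)
  qed (auto intro!: continuous_intros continuous_on_compose2[OF \<phi>(1)] continuous_on_compose2[OF \<psi>(1)])
  ultimately have cont: "continuous_on {0..1} \<theta>" by simp
  have mono: "mono_on {0..1} \<theta>"
  proof (rule mono_onI)
    fix s t :: real assume st: "s \<in> {0..1}" "t \<in> {0..1}" "s \<le> t"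
    consider "t \<le> 1/2" | "s \<le> 1/2" "t > 1/2" | "s > 1/2" using st by linarith
    then show "\<theta> s \<le> \<theta> t"
    proof cases
      case 1 then show ?thesis using st by (auto simp: \<theta>_def intro!: mono_onD[OF \<phi>(3)])
    next
      case 2 then show ?thesis using st rng(2)[of "2 * s"] rng(3)[of "2*t-1"] by (auto simp: \<theta>_def)
    next
      case 3 then show ?thesis using st by (auto simp: \<theta>_def intro!: mono_onD[OF \<psi>(3)])
    qed
  qed
  show "\<theta> \<in> Rep_plus" using cont mono by (intro Rep_plusI) (auto simp: \<theta>_def e)
  show "normalized_comp (reparam x \<phi>) (reparam y \<psi>) = reparam (normalized_comp x y) \<theta>"
  proof
    fix t :: real
    consider "t \<notin> {0..1}" | "0 \<le> t" "t \<le> 1/2" | "1/2 < t" "t \<le> 1" by fastforce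
    then show "normalized_comp (reparam x \<phi>) (reparam y \<psi>) t = reparam (normalized_comp x y) \<theta> t"
    proof cases
      case 1
      then show ?thesis by (auto simp: normalized_comp_def reparam_def)
    next
      case 2
      then show ?thesis using rng(1,2)[of "2*t"]
        by (auto simp: normalized_comp_def reparam_def \<theta>_def)
    next
      case 3
      \<comment> \<open>While \<psi> still rests at 0, \<open>\<theta> t\<close> is 1/2, and the
        right side evaluates x at 1 where the left side evaluates y at 0.\<close>
      then show ?thesis using rng(3,4)[of "2*t-1"] assms(3)
        by (cases "\<psi> (2*t-1) = 0") (auto simp: normalized_comp_def reparam_def \<theta>_def add_divide_distrib)
    qed
  qed
qed

section \<open>Saturation\<close>

text \<open>Pieces live on arbitrary, possibly degenerate intervals and constrain y only there.
  Undoing \<phi> turns [a,b] into [\<phi> a, \<phi> b], which may shrink to a point and moves break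
  points away from the dyadic ones of normalized composition.\<close>

inductive piecewise_light :: "'a mdspace \<Rightarrow> real \<Rightarrow> real \<Rightarrow> (real \<Rightarrow> 'a) \<Rightarrow> bool"
  for A :: "'a mdspace" where
  piece_const: "a \<le> b \<Longrightarrow> p \<in> topspace (mtop A) \<Longrightarrow> (\<And>t. t \<in> {a..b} \<Longrightarrow> y t = p) \<Longrightarrow>
     piecewise_light A a b y"
| piece_light: "a \<le> b \<Longrightarrow> e \<in> mpaths A \<Longrightarrow> light e \<Longrightarrow> continuous_on {a..b} \<psi> \<Longrightarrow>
     mono_on {a..b} \<psi> \<Longrightarrow> \<psi> ` {a..b} \<subseteq> {0..1} \<Longrightarrow> (\<And>t. t \<in> {a..b} \<Longrightarrow> y t = e (\<psi> t)) \<Longrightarrow>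
     piecewise_light A a b y"
| piece_join: "piecewise_light A a b y \<Longrightarrow> piecewise_light A b c y \<Longrightarrow> piecewise_light A a c y"

lemma piecewise_light_le: "piecewise_light A a b y \<Longrightarrow> a \<le> b"
  by (induction rule: piecewise_light.induct) auto

text \<open>For a join, the new break point is a parameter that \<phi> sends to b, unless the image
  of \<phi> stays on one side of b.\<close>

lemma piecewise_light_reparam:
  assumes "piecewise_light A a b y" "c \<le> d" "continuous_on {c..d} \<phi>" "mono_on {c..d} \<phi>"
    "\<phi> ` {c..d} \<subseteq> {a..b}" "\<And>t. t \<in> {c..d} \<Longrightarrow> x t = y (\<phi> t)"
  shows "piecewise_light A c d x"
  using assms
proof (induction arbitrary: c d rule: piecewise_light.induct)
  case (piece_const a b p y)
  then show ?case by (intro piecewise_light.piece_const[of c d p]) (auto simp: image_subset_iff)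
next
  case (piece_light a b e \<psi> y)
  show ?case
  proof (rule piecewise_light.piece_light[of c d e _ "\<psi> \<circ> \<phi>"])
    show "continuous_on {c..d} (\<psi> \<circ> \<phi>)"
      using piece_light by (meson continuous_on_compose continuous_on_subset)
    show "mono_on {c..d} (\<psi> \<circ> \<phi>)"
      using piece_light by (auto simp: mono_on_def image_subset_iff)
    show "(\<psi> \<circ> \<phi>) ` {c..d} \<subseteq> {0..1}"
      using piece_light by (fastforce simp: image_subset_iff)
  qed (use piece_light in \<open>auto simp: image_subset_iff\<close>)
next
  case (piece_join a b y b')
  have rng: "\<phi> t \<in> {a..b'}" if "t \<in> {c..d}" for t using piece_join.prems(4) that by blast
  have mono: "\<phi> s \<le> \<phi> t" if "c \<le> s" "s \<le> t" "t \<le> d" for s t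
    using that by (intro mono_onD[OF piece_join.prems(3)]) auto
  consider "\<phi> d \<le> b" | "b \<le> \<phi> c" | "\<phi> c \<le> b" "b \<le> \<phi> d" by linarith
  then show ?case
  proof cases
    case 1
    show ?thesis
    proof (rule piece_join.IH(1))
      show "\<phi> ` {c..d} \<subseteq> {a..b}"
        using rng mono[of _ d] 1 by (force simp: image_subset_iff)
    qed (use piece_join.prems in auto)
  next
    case 2
    show ?thesis
    proof (rule piece_join.IH(2))
      show "\<phi> ` {c..d} \<subseteq> {b..b'}"
        using rng mono[of c] 2 by (force simp: image_subset_iff)
    qed (use piece_join.prems in auto)
  next
    case 3
    then obtain m where m: "c \<le> m" "m \<le> d" "\<phi> m = b"
      using IVT'[of \<phi> c b d] piece_join.prems by auto
    have "piecewise_light A c m x"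
    proof (rule piece_join.IH(1))
      show "continuous_on {c..m} \<phi>" "mono_on {c..m} \<phi>"
        using piece_join.prems m by (auto intro: continuous_on_subset mono_on_subset)
      show "\<phi> ` {c..m} \<subseteq> {a..b}"
        using rng mono[of _ m] m by (force simp: image_subset_iff)
    qed (use piece_join.prems m in auto)
    moreover have "piecewise_light A m d x"
    proof (rule piece_join.IH(2))
      show "continuous_on {m..d} \<phi>" "mono_on {m..d} \<phi>"
        using piece_join.prems m by (auto intro: continuous_on_subset mono_on_subset)
      show "\<phi> ` {m..d} \<subseteq> {b..b'}"
        using rng mono[of m] m by (force simp: image_subset_iff)
    qed (use piece_join.prems m in auto)
    ultimately show ?thesis by (rule piecewise_light.piece_join)
  qed
qed

text \<open>A continuous surjection between compact intervals is a quotient map, so \<psi>, being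
  constant on the fibres of \<phi>, descends to a continuous \<theta>. The choice of a preimage does
  not affect its value.\<close>

lemma mono_factorization:
  fixes \<phi> \<psi> :: "real \<Rightarrow> real"
  assumes "a \<le> b" "continuous_on {a..b} \<phi>" "mono_on {a..b} \<phi>"
    "continuous_on {a..b} \<psi>" "mono_on {a..b} \<psi>"
    and const: "\<And>s t. a \<le> s \<Longrightarrow> s < t \<Longrightarrow> t \<le> b \<Longrightarrow> \<phi> s = \<phi> t \<Longrightarrow> \<psi> s = \<psi> t"
  obtains \<theta> where "continuous_on {\<phi> a..\<phi> b} \<theta>" "mono_on {\<phi> a..\<phi> b} \<theta>"
    "\<And>t. t \<in> {a..b} \<Longrightarrow> \<theta> (\<phi> t) = \<psi> t" "\<phi> ` {a..b} = {\<phi> a..\<phi> b}"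
proof -
  have im: "\<phi> ` {a..b} = {\<phi> a..\<phi> b}"
  proof
    show "\<phi> ` {a..b} \<subseteq> {\<phi> a..\<phi> b}"
      using assms(1,3) by (auto simp: mono_on_def)
    show "{\<phi> a..\<phi> b} \<subseteq> \<phi> ` {a..b}"
      using IVT'[of \<phi> a _ b] assms by (force simp: image_iff)
  qed
  define \<theta> where "\<theta> u = \<psi> (SOME t. t \<in> {a..b} \<and> \<phi> t = u)" for u
  have \<theta>: "\<theta> (\<phi> t) = \<psi> t" if "t \<in> {a..b}" for t
  proof -
    define s where "s = (SOME s. s \<in> {a..b} \<and> \<phi> s = \<phi> t)"
    have "s \<in> {a..b} \<and> \<phi> s = \<phi> t"
      unfolding s_def by (rule someI[of _ t]) (use that in auto)
    then have "\<psi> s = \<psi> t"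
      using const[of s t] const[of t s] that by (metis atLeastAtMost_iff linorder_neq_iff)
    then show ?thesis by (simp add: \<theta>_def s_def)
  qed
  have "continuous_on {\<phi> a..\<phi> b} \<theta>"
  proof -
    have "quotient_map (top_of_set {a..b}) (top_of_set {\<phi> a..\<phi> b}) \<phi>"
    proof (rule continuous_imp_quotient_map)
      show "continuous_map (top_of_set {a..b}) (top_of_set {\<phi> a..\<phi> b}) \<phi>"
        using assms(2) im by (auto simp: continuous_map_in_subtopology)
    qed (use im in \<open>auto simp: compact_space_subtopology Hausdorff_space_subtopology\<close>)
    moreover have "continuous_map (top_of_set {a..b}) euclideanreal (\<theta> \<circ> \<phi>)"
    proof -
      have "continuous_on {a..b} (\<theta> \<circ> \<phi>) = continuous_on {a..b} \<psi>"
        by (rule continuous_on_cong) (simp_all add: \<theta>)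
      then show ?thesis using assms(4) by simp
    qed
    ultimately have "continuous_map (top_of_set {\<phi> a..\<phi> b}) euclideanreal \<theta>"
      by (rule continuous_compose_quotient_map)
    then show ?thesis by simp
  qed
  moreover have "mono_on {\<phi> a..\<phi> b} \<theta>"
  proof (rule mono_onI)
    fix u v assume uv: "u \<in> {\<phi> a..\<phi> b}" "v \<in> {\<phi> a..\<phi> b}" "u \<le> v"
    then obtain s t where st: "s \<in> {a..b}" "t \<in> {a..b}" "u = \<phi> s" "v = \<phi> t"
      using im by (metis imageE)
    show "\<theta> u \<le> \<theta> v"
    proof (cases "s \<le> t")
      case True
      then show ?thesis using st mono_onD[OF assms(5)] by (simp add: \<theta>)
    next
      case False
      then have "\<phi> t \<le> \<phi> s" using st by (intro mono_onD[OF assms(3)]) auto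
      then show ?thesis using uv st by (simp add: \<theta>)
    qed
  qed
  ultimately show thesis using that \<theta> im by blast
qed

text \<open>The key to saturation: a light path never stops, so wherever \<open>\<phi>\<close> stops, the
  reparametrization of the light piece has to stop as well and hence factors through \<open>\<phi>\<close>.\<close>

lemma piecewise_light_unreparam:
  assumes "piecewise_light A a b y" "continuous_on {a..b} \<phi>" "mono_on {a..b} \<phi>"
    "\<And>t. t \<in> {a..b} \<Longrightarrow> y t = x (\<phi> t)"
  shows "piecewise_light A (\<phi> a) (\<phi> b) x"
  using assms
proof (induction rule: piecewise_light.induct)
  case (piece_const a b p y)
  \<comment> \<open>Factoring \<phi> through itself supplies the fact that its image is an
    interval.\<close>
  obtain \<theta> where "\<phi> ` {a..b} = {\<phi> a..\<phi> b}"
    using mono_factorization[OF piece_const.hyps(1) piece_const.prems(1,2) piece_const.prems(1,2)] by metis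
  then have "x u = p" if "u \<in> {\<phi> a..\<phi> b}" for u
    using that piece_const.hyps(3) piece_const.prems(3) by (metis imageE)
  moreover have "\<phi> a \<le> \<phi> b"
    using piece_const by (auto simp: mono_on_def)
  ultimately show ?case using piece_const.hyps(2) by (intro piecewise_light.piece_const[of _ _ p])
next
  case (piece_light a b e \<psi> y)
  have "\<psi> s = \<psi> t" if st: "a \<le> s" "s < t" "t \<le> b" "\<phi> s = \<phi> t" for s t
  proof (rule ccontr)
    assume "\<psi> s \<noteq> \<psi> t"
    then have lt: "\<psi> s < \<psi> t"
      using st mono_onD[OF piece_light.hyps(5), of s t] by auto
    have "e constant_on {\<psi> s..\<psi> t}"
      unfolding constant_on_def
    proof (intro exI ballI)
      fix v assume "v \<in> {\<psi> s..\<psi> t}"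
      then obtain u where u: "s \<le> u" "u \<le> t" "\<psi> u = v"
        using IVT'[of \<psi> s v t] continuous_on_subset[OF piece_light.hyps(4), of "{s..t}"] st by auto
      have "\<phi> s \<le> \<phi> u"
        by (rule mono_onD[OF piece_light.prems(2)]) (use u st in auto)
      moreover have "\<phi> u \<le> \<phi> t"
        by (rule mono_onD[OF piece_light.prems(2)]) (use u st in auto)
      ultimately have "\<phi> u = \<phi> s" using st by simp
      then show "e v = x (\<phi> s)"
        using u st piece_light.hyps(7)[of u] piece_light.prems(3)[of u] by auto
    qed
    moreover have "0 \<le> \<psi> s" "\<psi> t \<le> 1"
      using piece_light.hyps(6) st by (auto simp: image_subset_iff)
    ultimately show False using piece_light.hyps(3) lt by (auto simp: light_def)
  qed
  then obtain \<theta> where \<theta>: "continuous_on {\<phi> a..\<phi> b} \<theta>" "mono_on {\<phi> a..\<phi> b} \<theta>"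
    "\<And>t. t \<in> {a..b} \<Longrightarrow> \<theta> (\<phi> t) = \<psi> t" "\<phi> ` {a..b} = {\<phi> a..\<phi> b}"
    using mono_factorization[OF piece_light.hyps(1) piece_light.prems(1,2) piece_light.hyps(4,5)]
    by metis
  show ?case
  proof (rule piecewise_light.piece_light[of _ _ e _ \<theta>])
    show "\<phi> a \<le> \<phi> b" using piece_light by (auto simp: mono_on_def)
    show "\<theta> ` {\<phi> a..\<phi> b} \<subseteq> {0..1}"
      using \<theta>(3) piece_light.hyps(6) unfolding \<theta>(4)[symmetric] by fastforce
    fix u assume "u \<in> {\<phi> a..\<phi> b}"
    then obtain t where t: "t \<in> {a..b}" "u = \<phi> t" using \<theta>(4) by (metis imageE)
    then show "x u = e (\<theta> u)"
      using piece_light.hyps(7) piece_light.prems(3) \<theta>(3) by simp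
  qed (use piece_light \<theta> in auto)
next
  case (piece_join a b y c)
  have le: "a \<le> b" "b \<le> c" using piece_join.hyps by (auto dest: piecewise_light_le)
  have "piecewise_light A (\<phi> a) (\<phi> b) x"
    using piece_join.prems le
    by (intro piece_join.IH(1)) (auto intro: continuous_on_subset mono_on_subset)
  moreover have "piecewise_light A (\<phi> b) (\<phi> c) x"
    using piece_join.prems le
    by (intro piece_join.IH(2)) (auto intro: continuous_on_subset mono_on_subset)
  ultimately show ?case by (rule piecewise_light.piece_join)
qed

section \<open>Generated directed paths as piecewise light paths\<close>

lemma Sp_paths_in_paths_in:
  assumes "multipointed c P A" "x \<in> Sp_paths A"
  shows "x \<in> paths_in (mtop A)"
  using assms(2)
proof induction
  case (execution x)
  then show ?case using assms(1) by (auto simp: multipointed_def)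
qed (auto intro: const_path_in_paths_in reparam_in_paths_in normalized_comp_in_paths_in)

lemma Sp_paths_piecewise_light:
  assumes "lightly_generated A" "x \<in> Sp_paths A"
  shows "piecewise_light A 0 1 x"
  using assms(2)
proof induction
  case (execution x)
  then obtain e \<psi> where e: "e \<in> mpaths A" "light e" "\<psi> \<in> Rep_plus" "x = reparam e \<psi>"
    using assms(1) by (auto simp: lightly_generated_def)
  then show ?case
    by (intro piecewise_light.piece_light[of _ _ e _ \<psi>]) (auto simp: Rep_plus_iff reparam_def)
next
  case (const a)
  then show ?case by (intro piecewise_light.piece_const[of _ _ a]) (auto simp: const_path_def)
next
  case (reparam x \<phi>)
  show ?case
    by (rule piecewise_light_reparam[OF reparam.IH, of _ _ \<phi>])
      (use reparam.hyps in \<open>auto simp: nondecreasing_maps_iff reparam_def\<close>)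
next
  case (comp x y)
  have "piecewise_light A 0 (1/2) (normalized_comp x y)"
    by (rule piecewise_light_reparam[OF comp.IH(1), of _ _ "\<lambda>t. 2 * t"])
      (auto simp: normalized_comp_def mono_on_def intro!: continuous_intros)
  moreover have "piecewise_light A (1/2) 1 (normalized_comp x y)"
  proof (rule piecewise_light_reparam[OF comp.IH(2), of _ _ "\<lambda>t. 2 * t - 1"])
    fix t :: real assume t: "t \<in> {1/2..1}"
    \<comment> \<open>At 1/2 the composite is defined through x, so this end point relies on x 1 = y
      0.\<close>
    show "normalized_comp x y t = y (2 * t - 1)"
    proof (cases "t = 1/2")
      case True
      show ?thesis unfolding True using comp.hyps by (simp add: normalized_comp_def)
    qed (use t in \<open>auto simp: normalized_comp_def\<close>)
  qed (auto simp: mono_on_def intro!: continuous_intros)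
  ultimately show ?case by (rule piecewise_light.piece_join)
qed

text \<open>\<open>Sp_paths\<close> concatenates only at 1/2. Quantifying over all monotone \<rho>
  into [a,b] lets the induction rescale each piece to the unit interval, and the true break point is
  restored by one final nondecreasing reparametrization.\<close>

lemma piecewise_light_imp_Sp_paths:
  assumes "multipointed c P A" "piecewise_light A a b y"
    "continuous_on {0..1} \<rho>" "mono_on {0..1} \<rho>" "\<rho> ` {0..1} \<subseteq> {a..b}"
  shows "restrict (y \<circ> \<rho>) {0..1} \<in> Sp_paths A"
  using assms(2-)
proof (induction arbitrary: \<rho> rule: piecewise_light.induct)
  case (piece_const a b p y)
  then have "restrict (y \<circ> \<rho>) {0..1} = const_path p"
    by (auto simp: const_path_def restrict_def fun_eq_iff image_subset_iff)
  then show ?case using Sp_paths.const[OF piece_const.hyps(2)] by (simp only:)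
next
  case (piece_light a b e \<psi> y)
  have "restrict (y \<circ> \<rho>) {0..1} = reparam e (\<psi> \<circ> \<rho>)"
    using piece_light by (auto simp: reparam_def restrict_def fun_eq_iff image_subset_iff)
  moreover have "\<psi> \<circ> \<rho> \<in> nondecreasing_maps"
    unfolding nondecreasing_maps_iff
  proof (intro conjI)
    show "continuous_on {0..1} (\<psi> \<circ> \<rho>)"
      using piece_light by (meson continuous_on_compose continuous_on_subset)
    show "mono_on {0..1} (\<psi> \<circ> \<rho>)"
      using piece_light by (auto simp: mono_on_def image_subset_iff)
    show "(\<psi> \<circ> \<rho>) ` {0..1} \<subseteq> {0..1}"
      using piece_light by (fastforce simp: image_subset_iff)
  qed
  ultimately show ?case
    using Sp_paths.reparam[OF Sp_paths.execution[OF piece_light.hyps(2)]] by (simp only:)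
next
  case (piece_join a b y c)
  have le: "a \<le> b" "b \<le> c" using piece_join.hyps by (auto dest: piecewise_light_le)
  have rng: "a \<le> \<rho> t" "\<rho> t \<le> c" if "0 \<le> t" "t \<le> 1" for t
    using piece_join.prems(3) that by (auto simp: image_subset_iff)
  \<comment> \<open>Degenerate pieces are split off because \<theta> below divides by b - a and by c
    - b.\<close>
  consider "a = b" | "b = c" | "a < b" "b < c" using le by linarith
  then show ?case
  proof cases
    case 1 then show ?thesis using piece_join.prems by (intro piece_join.IH(2)) auto
  next
    case 2 then show ?thesis using piece_join.prems by (intro piece_join.IH(1)) auto
  next
    case 3
    define z where "z = normalized_comp (restrict (y \<circ> (\<lambda>t. a + t * (b - a))) {0..1})
                                       (restrict (y \<circ> (\<lambda>t. b + t * (c - b))) {0..1})"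
    have ab: "a + t * (b - a) \<in> {a..b}" "b + t * (c - b) \<in> {b..c}" if "0 \<le> t" "t \<le> 1" for t
    proof -
      have "t * (b - a) \<le> b - a" "t * (c - b) \<le> c - b"
        using 3 that by (auto intro!: mult_left_le_one_le)
      moreover have "0 \<le> t * (b - a)" "0 \<le> t * (c - b)" using 3 that by auto
      ultimately show "a + t * (b - a) \<in> {a..b}" "b + t * (c - b) \<in> {b..c}"
        unfolding atLeastAtMost_iff by linarith+
    qed
    have z: "z \<in> Sp_paths A"
      unfolding z_def
    proof (rule Sp_paths.comp)
      show "restrict (y \<circ> (\<lambda>t. a + t * (b - a))) {0..1} \<in> Sp_paths A"
        using 3 ab by (intro piece_join.IH(1))
          (auto intro!: continuous_intros mono_onI mult_right_mono)
      show "restrict (y \<circ> (\<lambda>t. b + t * (c - b))) {0..1} \<in> Sp_paths A"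
        using 3 ab by (intro piece_join.IH(2))
          (auto intro!: continuous_intros mono_onI mult_right_mono)
    qed simp
    \<comment> \<open>This is \<rho> followed by the piecewise affine map taking a, b, c to 0, 1/2,
      1. As a sum of a \<open>min\<close> term and a \<open>max\<close> term it is continuous and
      monotone summand by summand.\<close>
    define \<theta> where
      "\<theta> t = (min (\<rho> t) b - a) / (2 * (b - a)) + (max (\<rho> t) b - b) / (2 * (c - b))" for t
    have r1: "\<theta> t \<in> {0..1}" "y (\<rho> t) = z (\<theta> t)" if t: "0 \<le> t" "t \<le> 1" for t
    proof -
      show "y (\<rho> t) = z (\<theta> t)"
      proof (cases "\<rho> t \<le> b")
        case True
        define q where "q = (\<rho> t - a) / (b - a)"
        have q: "q \<in> {0..1}" "a + q * (b - a) = \<rho> t" "\<theta> t = q / 2"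
          using 3 True rng[OF t] by (auto simp: q_def \<theta>_def)
        show ?thesis unfolding q(3) using q(1,2) by (simp add: z_def normalized_comp_def)
      next
        case False
        define q where "q = (\<rho> t - b) / (c - b)"
        have q: "0 < q" "q \<le> 1" "b + q * (c - b) = \<rho> t"
          using 3 False rng[OF t] by (auto simp: q_def)
        have "min (\<rho> t) b = b" "max (\<rho> t) b = \<rho> t" using False by auto
        moreover have "(b - a) / (2 * (b - a)) = 1 / 2" using 3 by (simp add: divide_simps)
        moreover have "(\<rho> t - b) / (2 * (c - b)) = q / 2" by (simp add: q_def divide_simps)
        ultimately have q4: "\<theta> t = (1 + q) / 2"
          by (simp only: \<theta>_def add_divide_distrib)
        have "2 * ((1 + q) / 2) - 1 = q" by (simp add: field_simps)
        then show ?thesis unfolding q4 using q by (simp add: z_def normalized_comp_def)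
      qed
      have "(min (\<rho> t) b - a) / (2 * (b - a)) \<in> {0..1/2}" "(max (\<rho> t) b - b) / (2 * (c - b)) \<in> {0..1/2}"
        using 3 rng[OF t] by (auto simp: field_simps)
      then show "\<theta> t \<in> {0..1}" unfolding \<theta>_def atLeastAtMost_iff by linarith
    qed
    have "\<theta> \<in> nondecreasing_maps"
      unfolding nondecreasing_maps_iff
    proof (intro conjI)
      show "continuous_on {0..1} \<theta>"
        unfolding \<theta>_def using 3 piece_join.prems(1) by (intro continuous_intros) auto
      show "\<theta> ` {0..1} \<subseteq> {0..1}" using r1(1) by auto
      show "mono_on {0..1} \<theta>"
      proof (rule mono_onI)
        fix s t :: real assume st: "s \<in> {0..1}" "t \<in> {0..1}" "s \<le> t"
        then have "\<rho> s \<le> \<rho> t" by (intro mono_onD[OF piece_join.prems(2)])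
        then show "\<theta> s \<le> \<theta> t"
          unfolding \<theta>_def using 3 by (intro add_mono divide_right_mono) auto
      qed
    qed
    moreover have "restrict (y \<circ> \<rho>) {0..1} = reparam z \<theta>"
      using r1(2) by (auto simp: reparam_def restrict_def fun_eq_iff)
    ultimately show ?thesis using Sp_paths.reparam[OF z] by (simp only:)
  qed
qed

proposition saturated_Sp:
  assumes "multipointed c P A" "lightly_generated A"
  shows "saturated (Sp A)"
  unfolding saturated_def
proof (intro ballI impI)
  fix x \<phi>
  assume x: "x \<in> paths_in (dtop (Sp A))" and \<phi>: "\<phi> \<in> Rep_plus"
    and "reparam x \<phi> \<in> dpaths (Sp A)"
  then have "piecewise_light A 0 1 (reparam x \<phi>)"
    using assms by (auto simp: Sp_def intro: Sp_paths_piecewise_light)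
  then have "piecewise_light A (\<phi> 0) (\<phi> 1) x"
    by (rule piecewise_light_unreparam) (use \<phi> in \<open>auto simp: Rep_plus_iff reparam_def\<close>)
  then have "piecewise_light A 0 1 x" using Rep_plus_endpoints[OF \<phi>] by simp
  then have "restrict (x \<circ> (\<lambda>t. t)) {0..1} \<in> Sp_paths A"
    by (rule piecewise_light_imp_Sp_paths[OF assms(1)]) (auto simp: mono_on_def)
  moreover have "restrict (x \<circ> (\<lambda>t. t)) {0..1} = x"
    using x by (auto simp: paths_in_def extensional_def restrict_def fun_eq_iff)
  ultimately show "x \<in> dpaths (Sp A)" by (simp add: Sp_def)
qed

section \<open>Spaces generated by simplices\<close>

lemma delta_generated_simplex: "delta_generated (simplex_space p)"
  unfolding delta_generated_def
proof (intro allI impI, elim conjE)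
  fix U assume U: "U \<subseteq> topspace (simplex_space p)"
    and *: "\<forall>q f. continuous_map (simplex_space q) (simplex_space p) f \<longrightarrow>
          openin (simplex_space q) {s \<in> topspace (simplex_space q). f s \<in> U}"
  have "openin (simplex_space p) {s \<in> topspace (simplex_space p). id s \<in> U}"
    using * continuous_map_id by blast
  moreover have "{s \<in> topspace (simplex_space p). id s \<in> U} = U" using U by auto
  ultimately show "openin (simplex_space p) U" by simp
qed

lemma delta_generated_quotient:
  assumes "delta_generated X" "quotient_map X Y q"
  shows "delta_generated Y"
  unfolding delta_generated_def
proof (intro allI impI, elim conjE)
  fix U assume U: "U \<subseteq> topspace Y"
    and *: "\<forall>p f. continuous_map (simplex_space p) Y f \<longrightarrow>
          openin (simplex_space p) {s \<in> topspace (simplex_space p). f s \<in> U}"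
  have q: "continuous_map X Y q" using assms(2) by (rule quotient_imp_continuous_map)
  have "openin X {x \<in> topspace X. q x \<in> U}"
  proof (rule assms(1)[unfolded delta_generated_def, rule_format], intro conjI allI impI)
    fix p f assume f: "continuous_map (simplex_space p) X f"
    then have "openin (simplex_space p) {s \<in> topspace (simplex_space p). (q \<circ> f) s \<in> U}"
      using * continuous_map_compose[OF f q] by blast
    moreover have "{s \<in> topspace (simplex_space p). (q \<circ> f) s \<in> U} =
        {s \<in> topspace (simplex_space p). f s \<in> {x \<in> topspace X. q x \<in> U}}"
      using f by (auto simp: continuous_map_def Pi_iff)
    ultimately show "openin (simplex_space p)
        {s \<in> topspace (simplex_space p). f s \<in> {x \<in> topspace X. q x \<in> U}}" by simp
  qed auto
  then show "openin Y U" using assms(2) U by (simp add: quotient_map_def)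
qed

text \<open>A simplex is compact, so a continuous map from it onto a Hausdorff space is a quotient
  map.\<close>

lemma delta_generated_simplex_image:
  assumes "continuous_map (simplex_space p) X f" "topspace X \<subseteq> f ` standard_simplex p"
    "Hausdorff_space X"
  shows "delta_generated X"
proof (rule delta_generated_quotient[OF delta_generated_simplex])
  show "quotient_map (simplex_space p) X f"
  proof (rule continuous_imp_quotient_map)
    show "compact_space (simplex_space p)"
      using compactin_standard_simplex by (simp add: compact_space_subtopology)
    show "f ` topspace (simplex_space p) = topspace X"
      using assms(2) continuous_map_image_subset_topspace[OF assms(1)] by auto
  qed (use assms in auto)
qed

lemma continuous_map_simplex_coordinate: "continuous_map (simplex_space p) euclideanreal (\<lambda>s. s i)"
  by (intro continuous_map_from_subtopology continuous_map_product_projection) auto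

lemma delta_generated_unit_interval: "delta_generated unit_interval"
proof (rule delta_generated_simplex_image)
  show "continuous_map (simplex_space 1) unit_interval (\<lambda>s. s 0)"
    unfolding continuous_map_in_subtopology
    by (rule conjI[OF continuous_map_simplex_coordinate]) (auto simp: standard_simplex_def)
  show "topspace unit_interval \<subseteq> (\<lambda>s. s 0) ` standard_simplex 1"
  proof
    fix t :: real assume "t \<in> topspace unit_interval"
    then have "(\<lambda>i. if i = 0 then t else if i = 1 then 1 - t else 0) \<in> standard_simplex 1"
      by (auto simp: standard_simplex_def)
    then show "t \<in> (\<lambda>s. s 0) ` standard_simplex 1" by (rule image_eqI[rotated]) simp
  qed
qed (simp add: Hausdorff_space_subtopology)

lemma space_in_unit_interval: "space_in c unit_interval"
proof (cases c)
  case Delta_Hausdorff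
  have "delta_Hausdorff unit_interval"
    unfolding delta_Hausdorff_def
  proof (intro allI impI)
    fix f assume f: "continuous_map unit_interval unit_interval f"
    have "compactin unit_interval (f ` {0..1})"
      by (rule image_compactin[OF _ f]) (simp add: compactin_subtopology)
    then show "closedin unit_interval (f ` {0..1})"
      by (intro compactin_imp_closedin) (simp_all add: Hausdorff_space_subtopology)
  qed
  then show ?thesis using Delta_Hausdorff delta_generated_unit_interval by simp
qed (simp add: delta_generated_unit_interval)

lemma space_in_imp_delta_generated: "space_in c X \<Longrightarrow> delta_generated X"
  by (cases c) auto

text \<open>Using simplices as probes puts legs with different point types, such as a stage and a
  globe, into one family F. A topology final for simplices is also \<Delta>-generated by
  construction.\<close>

definition simplex_final :: "'a set \<Rightarrow> (nat \<times> ((nat \<Rightarrow> real) \<Rightarrow> 'a)) set \<Rightarrow> 'a topology" where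
  "simplex_final S F = topology (\<lambda>U. U \<subseteq> S \<and>
     (\<forall>(p, \<sigma>) \<in> F. openin (simplex_space p) {s \<in> topspace (simplex_space p). \<sigma> s \<in> U}))"

lemma openin_simplex_final:
  "openin (simplex_final S F) U \<longleftrightarrow> U \<subseteq> S \<and>
     (\<forall>(p, \<sigma>) \<in> F. openin (simplex_space p) {s \<in> topspace (simplex_space p). \<sigma> s \<in> U})"
proof -
  define pre where "pre = (\<lambda>(p, \<sigma>) U. {s \<in> topspace (simplex_space p). (\<sigma> :: _ \<Rightarrow> 'a) s \<in> U})"
  have "istopology (\<lambda>U. U \<subseteq> S \<and> (\<forall>q \<in> F. openin (simplex_space (fst q)) (pre q U)))"
  proof -
    have "pre q (U \<inter> V) = pre q U \<inter> pre q V" for q U V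
      by (auto simp: pre_def split: prod.split)
    moreover have "pre q (\<Union>\<K>) = (\<Union>K\<in>\<K>. pre q K)" for q \<K>
      by (auto simp: pre_def split: prod.split)
    moreover have "openin (simplex_space (fst q)) (\<Union>K\<in>\<K>. pre q K)"
      if "\<forall>K\<in>\<K>. K \<subseteq> S \<and> (\<forall>q\<in>F. openin (simplex_space (fst q)) (pre q K))" "q \<in> F" for q \<K>
      using that by (intro openin_Union) auto
    ultimately show ?thesis unfolding istopology_def by (simp add: Sup_least openin_Int le_infI1)
  qed
  then show ?thesis
    by (simp add: simplex_final_def pre_def case_prod_unfold)
qed

lemma topspace_simplex_final:
  assumes "\<And>p \<sigma> s. (p, \<sigma>) \<in> F \<Longrightarrow> s \<in> topspace (simplex_space p) \<Longrightarrow> \<sigma> s \<in> S"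
  shows "topspace (simplex_final S F) = S"
proof
  show "topspace (simplex_final S F) \<subseteq> S"
    using openin_topspace[of "simplex_final S F"] unfolding openin_simplex_final by blast
  have eq: "{s \<in> topspace (simplex_space p). \<sigma> s \<in> S} = topspace (simplex_space p)"
    if "(p, \<sigma>) \<in> F" for p \<sigma>
    using assms[OF that] by auto
  have "openin (simplex_final S F) S"
    unfolding openin_simplex_final
  proof (intro conjI ballI, simp, clarify)
    fix p \<sigma> assume "(p, \<sigma>) \<in> F"
    then show "openin (simplex_space p) {s \<in> topspace (simplex_space p). \<sigma> s \<in> S}"
      by (simp only: eq openin_topspace)
  qed
  then show "S \<subseteq> topspace (simplex_final S F)" by (rule openin_subset)
qed

lemma continuous_map_into_simplex_final:
  assumes "\<And>p \<sigma> s. (p, \<sigma>) \<in> F \<Longrightarrow> s \<in> topspace (simplex_space p) \<Longrightarrow> \<sigma> s \<in> S" "(p, \<sigma>) \<in> F"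
  shows "continuous_map (simplex_space p) (simplex_final S F) \<sigma>"
proof -
  have T: "topspace (simplex_final S F) = S" by (rule topspace_simplex_final) (use assms in blast)
  show ?thesis
    unfolding continuous_map_def T
    using assms by (auto simp: openin_simplex_final)
qed

lemma continuous_map_from_simplex_final:
  assumes "\<And>p \<sigma> s. (p, \<sigma>) \<in> F \<Longrightarrow> s \<in> topspace (simplex_space p) \<Longrightarrow> \<sigma> s \<in> S"
    "\<And>p \<sigma>. (p, \<sigma>) \<in> F \<Longrightarrow> continuous_map (simplex_space p) Y (f \<circ> \<sigma>)"
    "f ` S \<subseteq> topspace Y"
  shows "continuous_map (simplex_final S F) Y f"
proof -
  have T: "topspace (simplex_final S F) = S" by (rule topspace_simplex_final) (use assms in blast)
  show ?thesis
    unfolding continuous_map_def T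
  proof (intro conjI allI impI)
    fix U assume U: "openin Y U"
    show "openin (simplex_final S F) {x \<in> S. f x \<in> U}"
      unfolding openin_simplex_final
    proof (intro conjI ballI, simp, clarify)
      fix p \<sigma> assume p: "(p, \<sigma>) \<in> F"
      have "{s \<in> topspace (simplex_space p). \<sigma> s \<in> {x \<in> S. f x \<in> U}} =
          {s \<in> topspace (simplex_space p). (f \<circ> \<sigma>) s \<in> U}"
        using assms(1)[OF p] by auto
      then show "openin (simplex_space p) {s \<in> topspace (simplex_space p). \<sigma> s \<in> {x \<in> S. f x \<in> U}}"
        using openin_continuous_map_preimage[OF assms(2)[OF p] U] by simp
    qed
  qed (use assms in auto)
qed

lemma delta_generated_simplex_final:
  assumes "\<And>p \<sigma> s. (p, \<sigma>) \<in> F \<Longrightarrow> s \<in> topspace (simplex_space p) \<Longrightarrow> \<sigma> s \<in> S"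
  shows "delta_generated (simplex_final S F)"
  unfolding delta_generated_def
proof (intro allI impI, elim conjE)
  have T: "topspace (simplex_final S F) = S" by (rule topspace_simplex_final) (use assms in blast)
  fix U assume U: "U \<subseteq> topspace (simplex_final S F)"
    and *: "\<forall>p f. continuous_map (simplex_space p) (simplex_final S F) f \<longrightarrow>
          openin (simplex_space p) {s \<in> topspace (simplex_space p). f s \<in> U}"
  show "openin (simplex_final S F) U"
    unfolding openin_simplex_final
  proof (intro conjI ballI, use U T in simp, clarify)
    fix p \<sigma> assume "(p, \<sigma>) \<in> F"
    then have "continuous_map (simplex_space p) (simplex_final S F) \<sigma>"
      using assms by (intro continuous_map_into_simplex_final) auto
    then show "openin (simplex_space p) {s \<in> topspace (simplex_space p). \<sigma> s \<in> U}" using * by blast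
  qed
qed

lemma continuous_map_delta_generated:
  assumes "delta_generated X" "k ` topspace X \<subseteq> topspace Y"
    "\<And>p f. continuous_map (simplex_space p) X f \<Longrightarrow> continuous_map (simplex_space p) Y (k \<circ> f)"
  shows "continuous_map X Y k"
  unfolding continuous_map_def
proof (intro conjI allI impI)
  fix U assume U: "openin Y U"
  show "openin X {x \<in> topspace X. k x \<in> U}"
  proof (rule assms(1)[unfolded delta_generated_def, rule_format], intro conjI allI impI)
    fix p f assume f: "continuous_map (simplex_space p) X f"
    have "{s \<in> topspace (simplex_space p). f s \<in> {x \<in> topspace X. k x \<in> U}} =
        {s \<in> topspace (simplex_space p). (k \<circ> f) s \<in> U}"
      using f by (auto simp: continuous_map_def Pi_iff)
    then show "openin (simplex_space p) {s \<in> topspace (simplex_space p). f s \<in> {x \<in> topspace X. k x \<in> U}}"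
      using openin_continuous_map_preimage[OF assms(3)[OF f] U] by simp
  qed auto
qed (use assms in auto)

text \<open>For injective f, the image of a path is the preimage of its image in Y and hence closed.
  So the \<Delta>-Hausdorff property descends to copies and to finer topologies on subsets.\<close>

lemma space_in_finer:
  assumes "space_in c Y" "delta_generated X" "continuous_map X Y f" "inj_on f (topspace X)"
  shows "space_in c X"
proof (cases c)
  case Delta_Hausdorff
  have "delta_Hausdorff X"
    unfolding delta_Hausdorff_def
  proof (intro allI impI)
    fix x assume x: "continuous_map unit_interval X x"
    then have "closedin Y ((f \<circ> x) ` {0..1})"
      using assms(1) continuous_map_compose[OF x assms(3)]
      by (simp only: Delta_Hausdorff space_in.simps delta_Hausdorff_def)
    then have "closedin X {a \<in> topspace X. f a \<in> (f \<circ> x) ` {0..1}}"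
      by (rule closedin_continuous_map_preimage[OF assms(3)])
    moreover have "{a \<in> topspace X. f a \<in> (f \<circ> x) ` {0..1}} = x ` {0..1}"
    proof -
      have "x t \<in> topspace X" if "t \<in> {0..1}" for t
        using x that by (auto simp: continuous_map_def Pi_iff)
      then have "x ` {0..1} \<subseteq> topspace X" by blast
      then show ?thesis unfolding image_comp[symmetric] using inj_on_image_mem_iff[OF assms(4)] by blast
    qed
    ultimately show "closedin X (x ` {0..1})" by simp
  qed
  then show ?thesis using Delta_Hausdorff assms(2) by simp
qed (use assms in simp)

section \<open>Universal properties with arbitrary test types\<close>

lemma multipointed_space_in: "multipointed c P A \<Longrightarrow> space_in c (mtop A)"
  and multipointed_delta_generated: "multipointed c P A \<Longrightarrow> delta_generated (mtop A)"
  and multipointed_mstates: "multipointed c P A \<Longrightarrow> a \<in> mstates A \<Longrightarrow> a \<in> topspace (mtop A)"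
  and multipointed_paths_in: "multipointed c P A \<Longrightarrow> x \<in> mpaths A \<Longrightarrow> x \<in> paths_in (mtop A)"
  and multipointed_endpoints: "multipointed c P A \<Longrightarrow> x \<in> mpaths A \<Longrightarrow> x 0 \<in> mstates A \<and> x 1 \<in> mstates A"
  and multipointed_reparam: "multipointed c P A \<Longrightarrow> x \<in> mpaths A \<Longrightarrow> \<phi> \<in> kind_maps P \<Longrightarrow> reparam x \<phi> \<in> mpaths A"
  and multipointed_normalized_comp: "multipointed c P A \<Longrightarrow> x \<in> mpaths A \<Longrightarrow> y \<in> mpaths A \<Longrightarrow>
     x 1 = y 0 \<Longrightarrow> normalized_comp x y \<in> mpaths A"
  unfolding multipointed_def by (blast intro: space_in_imp_delta_generated)+

lemma md_map_continuous: "md_map A B f \<Longrightarrow> continuous_map (mtop A) (mtop B) f"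
  and md_map_states: "md_map A B f \<Longrightarrow> a \<in> mstates A \<Longrightarrow> f a \<in> mstates B"
  and md_map_paths: "md_map A B f \<Longrightarrow> x \<in> mpaths A \<Longrightarrow> path_image_under f x \<in> mpaths B"
  by (auto simp: md_map_def)

lemma md_map_topspace: "md_map A B f \<Longrightarrow> a \<in> topspace (mtop A) \<Longrightarrow> f a \<in> topspace (mtop B)"
  by (auto simp: md_map_def continuous_map_def Pi_iff)

lemma md_map_compose: "md_map A B f \<Longrightarrow> md_map B C g \<Longrightarrow> md_map A C (g \<circ> f)"
  by (auto simp: md_map_def path_image_under_comp[symmetric] intro: continuous_map_compose)

lemma kind_maps_nondecreasing: "\<phi> \<in> kind_maps P \<Longrightarrow> \<phi> \<in> nondecreasing_maps"
  using kind_maps_subset_Rep_plus by (auto simp: Rep_plus_def)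

lemma reparam_endpoints:
  assumes "\<phi> \<in> Rep_plus"
  shows "reparam x \<phi> 0 = x 0" "reparam x \<phi> 1 = x 1"
  using Rep_plus_endpoints[OF assms] by (auto simp: reparam_def)

section \<open>Test objects and their transport into the test type\<close>

definition md_full :: "'a topology \<Rightarrow> 'a mdspace" where
  "md_full T = \<lparr>mtop = T, mstates = topspace T, mpaths = paths_in T\<rparr>"

lemma multipointed_md_full: "space_in c T \<Longrightarrow> multipointed c P (md_full T)"
  by (auto simp: multipointed_def md_full_def paths_in_topspace kind_maps_nondecreasing
      intro: reparam_in_paths_in normalized_comp_in_paths_in)

lemma md_map_into_md_full:
  assumes "mstates A \<subseteq> topspace (mtop A)" "mpaths A \<subseteq> paths_in (mtop A)" "continuous_map (mtop A) T f"
  shows "md_map A (md_full T) f"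
  using assms by (auto simp: md_map_def md_full_def continuous_map_def Pi_iff intro!: path_image_under_in_paths_in)

text \<open>An isomorphic copy on the points \<open>emb a\<close>. It makes the universal
  properties, stated for points in \<open>'b + real\<close>, available to any test object whose type
  embeds there.\<close>

definition md_copy :: "('a \<Rightarrow> 'z) \<Rightarrow> 'a mdspace \<Rightarrow> 'z mdspace" where
  "md_copy emb A = \<lparr>mtop = pullback_topology (range emb) (the_inv emb) (mtop A),
     mstates = emb ` mstates A, mpaths = path_image_under emb ` mpaths A\<rparr>"

lemma
  assumes "inj emb" "multipointed c P A"
  shows multipointed_md_copy: "multipointed c P (md_copy emb A)"
    and md_map_into_md_copy: "md_map A (md_copy emb A) emb"
    and md_map_from_md_copy: "md_map (md_copy emb A) A (the_inv emb)"
proof -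
  let ?T = "pullback_topology (range emb) (the_inv emb) (mtop A)"
  have [simp]: "the_inv emb \<circ> emb = id" using assms(1) by (auto simp: fun_eq_iff the_inv_f_f)
  have [simp]: "the_inv emb (emb a) = a" for a using assms(1) by (rule the_inv_f_f)
  have into: "continuous_map (mtop A) ?T emb"
    by (rule continuous_map_pullback') (use assms(1) in auto)
  have from': "continuous_map ?T (mtop A) (the_inv emb)"
    using continuous_map_pullback[OF continuous_map_id, of "range emb" "the_inv emb" "mtop A"] by simp
  have top: "topspace ?T = emb ` topspace (mtop A)"
    using assms(1) by (auto simp: topspace_pullback_topology)
  have inj: "inj_on (the_inv emb) (topspace ?T)"
    unfolding top by (auto intro!: inj_onI)
  have "quotient_map (mtop A) ?T emb"
    unfolding quotient_map_def
  proof (intro conjI allI impI)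
    show "emb ` topspace (mtop A) = topspace ?T" by (simp add: top)
    fix U assume U: "U \<subseteq> topspace ?T"
    show "openin (mtop A) {x \<in> topspace (mtop A). emb x \<in> U} = openin ?T U"
    proof
      assume o: "openin (mtop A) {x \<in> topspace (mtop A). emb x \<in> U}"
      have "U = the_inv emb -` {x \<in> topspace (mtop A). emb x \<in> U} \<inter> range emb"
        using U unfolding top by auto
      then show "openin ?T U" unfolding openin_pullback_topology using o by blast
    qed (use openin_continuous_map_preimage[OF into] in blast)
  qed
  then have "delta_generated ?T"
    using delta_generated_quotient multipointed_delta_generated[OF assms(2)] by blast
  then have T: "space_in c ?T"
    using space_in_finer[OF multipointed_space_in[OF assms(2)] _ from' inj] by blast
  show "md_map A (md_copy emb A) emb"
    using into by (auto simp: md_map_def md_copy_def)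
  have inv: "path_image_under (the_inv emb) (path_image_under emb x) = x" if "x \<in> mpaths A" for x
    unfolding path_image_under_comp
    using path_image_under_id[OF multipointed_paths_in[OF assms(2) that]] by simp
  then show "md_map (md_copy emb A) A (the_inv emb)"
    using from' by (auto simp: md_map_def md_copy_def)
  show "multipointed c P (md_copy emb A)"
    unfolding multipointed_def
  proof (intro conjI)
    show "space_in c (mtop (md_copy emb A))" using T by (simp add: md_copy_def)
    show "mstates (md_copy emb A) \<subseteq> topspace (mtop (md_copy emb A))"
      using multipointed_mstates[OF assms(2)] by (auto simp: md_copy_def top)
    show "mpaths (md_copy emb A) \<subseteq> paths_in (mtop (md_copy emb A))"
      using path_image_under_in_paths_in[OF multipointed_paths_in[OF assms(2)] into]
      by (auto simp: md_copy_def)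
    show "\<forall>x\<in>mpaths (md_copy emb A). x 0 \<in> mstates (md_copy emb A) \<and> x 1 \<in> mstates (md_copy emb A)"
      using multipointed_endpoints[OF assms(2)] by (auto simp: md_copy_def path_image_under_def)
    show "\<forall>x\<in>mpaths (md_copy emb A). \<forall>\<phi>\<in>kind_maps P. reparam x \<phi> \<in> mpaths (md_copy emb A)"
      using multipointed_reparam[OF assms(2)]
      by (auto simp: md_copy_def path_image_under_reparam[symmetric] kind_maps_range simp del: atLeastAtMost_iff)
    show "\<forall>x\<in>mpaths (md_copy emb A). \<forall>y\<in>mpaths (md_copy emb A). x 1 = y 0 \<longrightarrow>
        normalized_comp x y \<in> mpaths (md_copy emb A)"
    proof (intro ballI impI)
      fix x y assume "x \<in> mpaths (md_copy emb A)" "y \<in> mpaths (md_copy emb A)" and xy: "x 1 = y 0"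
      then obtain x' y' where *: "x' \<in> mpaths A" "y' \<in> mpaths A"
        "x = path_image_under emb x'" "y = path_image_under emb y'"
        by (auto simp: md_copy_def)
      then have "x' 1 = y' 0" using xy assms(1) by (auto simp: path_image_under_def inj_eq)
      then have "normalized_comp x' y' \<in> mpaths A"
        using * multipointed_normalized_comp[OF assms(2)] by blast
      then show "normalized_comp x y \<in> mpaths (md_copy emb A)"
        using * by (simp add: md_copy_def path_image_under_normalized_comp[symmetric])
    qed
  qed
qed

lemma md_pushout_exists:
  fixes emb :: "'z \<Rightarrow> 'b + real" and Z :: "'z mdspace" and Y :: "'b mdspace"
  assumes "md_pushout c P K L X Y i g h j" "inj emb" "multipointed c P Z" "md_map L Z u" "md_map X Z v"
    "\<And>a. a \<in> topspace (mtop K) \<Longrightarrow> u (i a) = v (g a)"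
  shows "\<exists>w. md_map Y Z w \<and> (\<forall>b \<in> topspace (mtop L). w (h b) = u b) \<and>
     (\<forall>b \<in> topspace (mtop X). w (j b) = v b)"
proof -
  let ?Z = "md_copy emb Z"
  note c = multipointed_md_copy[OF assms(2,3)] md_map_into_md_copy[OF assms(2,3)]
    md_map_from_md_copy[OF assms(2,3)]
  have "\<exists>w. md_map Y ?Z w \<and> (\<forall>b \<in> topspace (mtop L). w (h b) = (emb \<circ> u) b) \<and>
     (\<forall>b \<in> topspace (mtop X). w (j b) = (emb \<circ> v) b)"
    using assms(1)[unfolded md_pushout_def, THEN conjunct2, THEN conjunct2, THEN conjunct2,
        THEN conjunct2, THEN conjunct2, rule_format, of ?Z "emb \<circ> u" "emb \<circ> v"]
      c(1) md_map_compose[OF assms(4) c(2)] md_map_compose[OF assms(5) c(2)] assms(6)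
    by auto
  then obtain w where w: "md_map Y ?Z w" "\<forall>b \<in> topspace (mtop L). w (h b) = (emb \<circ> u) b"
    "\<forall>b \<in> topspace (mtop X). w (j b) = (emb \<circ> v) b" by blast
  show ?thesis
    using md_map_compose[OF w(1) c(3)] w(2,3) assms(2)
    by (intro exI[of _ "the_inv emb \<circ> w"]) (auto simp: the_inv_f_f)
qed

text \<open>After composition with \<open>emb\<close>, both w and w' solve the extension problem
  posed by the legs of w, so both agree with its universal solution v.\<close>

lemma md_pushout_unique:
  fixes emb :: "'z \<Rightarrow> 'b + real" and Z :: "'z mdspace" and Y :: "'b mdspace"
  assumes "md_pushout c P K L X Y i g h j" "inj emb" "multipointed c P Z" "md_map Y Z w" "md_map Y Z w'"
    "\<And>b. b \<in> topspace (mtop L) \<Longrightarrow> w (h b) = w' (h b)"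
    "\<And>b. b \<in> topspace (mtop X) \<Longrightarrow> w (j b) = w' (j b)"
    "b \<in> topspace (mtop Y)"
  shows "w b = w' b"
proof -
  let ?Z = "md_copy emb Z"
  note c = multipointed_md_copy[OF assms(2,3)] md_map_into_md_copy[OF assms(2,3)]
    md_map_from_md_copy[OF assms(2,3)]
  have m: "md_map Y ?Z (emb \<circ> w)" "md_map Y ?Z (emb \<circ> w')"
    using md_map_compose[OF assms(4) c(2)] md_map_compose[OF assms(5) c(2)] by auto
  have legs: "md_map L Y h" "md_map X Y j" "\<forall>a \<in> topspace (mtop K). h (i a) = j (g a)"
    using assms(1) by (auto simp: md_pushout_def)
  have "\<exists>v. \<forall>w'. md_map Y ?Z w' \<and> (\<forall>b \<in> topspace (mtop L). w' (h b) = (emb \<circ> w \<circ> h) b) \<and>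
     (\<forall>b \<in> topspace (mtop X). w' (j b) = (emb \<circ> w \<circ> j) b) \<longrightarrow> (\<forall>b \<in> topspace (mtop Y). w' b = v b)"
    using assms(1)[unfolded md_pushout_def, THEN conjunct2, THEN conjunct2, THEN conjunct2,
        THEN conjunct2, THEN conjunct2, rule_format, of ?Z "emb \<circ> w \<circ> h" "emb \<circ> w \<circ> j"]
      c(1) md_map_compose[OF legs(1) m(1)] md_map_compose[OF legs(2) m(1)] legs(3)
    by auto
  then obtain v where v: "\<And>w'. md_map Y ?Z w' \<Longrightarrow>
      (\<forall>b \<in> topspace (mtop L). w' (h b) = (emb \<circ> w \<circ> h) b) \<Longrightarrow>
      (\<forall>b \<in> topspace (mtop X). w' (j b) = (emb \<circ> w \<circ> j) b) \<Longrightarrow> \<forall>b \<in> topspace (mtop Y). w' b = v b"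
    by blast
  have "\<forall>b \<in> topspace (mtop Y). (emb \<circ> w) b = v b" by (rule v[OF m(1)]) auto
  moreover have "\<forall>b \<in> topspace (mtop Y). (emb \<circ> w') b = v b"
    by (rule v[OF m(2)]) (use assms(6,7) in auto)
  ultimately have "emb (w b) = emb (w' b)" using assms(8) by auto
  then show ?thesis using assms(2) by (simp add: inj_eq)
qed

lemma md_colimit_exists:
  fixes emb :: "'z \<Rightarrow> 'b + real" and Z :: "'z mdspace" and D :: "'b mdspace"
  assumes "md_colimit c P r I X f D k" "inj emb" "multipointed c P Z" "md_cocone r I X f Z u"
  shows "\<exists>w. md_map D Z w \<and> (\<forall>i \<in> I. \<forall>a \<in> topspace (mtop (X i)). w (k i a) = u i a)"
proof -
  let ?Z = "md_copy emb Z"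
  note c = multipointed_md_copy[OF assms(2,3)] md_map_into_md_copy[OF assms(2,3)]
    md_map_from_md_copy[OF assms(2,3)]
  note colim = assms(1)[unfolded md_colimit_def, THEN conjunct2, THEN spec, THEN spec, THEN mp, OF conjI]
  have cocone: "md_cocone r I X f ?Z (\<lambda>i. emb \<circ> u i)"
    unfolding md_cocone_def
  proof (intro conjI ballI impI)
    show "md_map (X i) ?Z (emb \<circ> u i)" if "i \<in> I" for i
      using assms(4) that by (intro md_map_compose[OF _ c(2)]) (simp add: md_cocone_def)
  qed (use assms(4) in \<open>simp add: md_cocone_def\<close>)
  obtain w where w: "md_map D ?Z w"
    "\<forall>i \<in> I. \<forall>a \<in> topspace (mtop (X i)). w (k i a) = (emb \<circ> u i) a"
    using colim[OF c(1) cocone] by auto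
  show ?thesis
    using md_map_compose[OF w(1) c(3)] w(2) assms(2)
    by (intro exI[of _ "the_inv emb \<circ> w"]) (auto simp: the_inv_f_f)
qed

lemma md_colimit_unique:
  fixes emb :: "'z \<Rightarrow> 'b + real" and Z :: "'z mdspace" and D :: "'b mdspace"
  assumes "md_colimit c P r I X f D k" "inj emb" "multipointed c P Z" "md_map D Z w" "md_map D Z w'"
    "\<And>i a. i \<in> I \<Longrightarrow> a \<in> topspace (mtop (X i)) \<Longrightarrow> w (k i a) = w' (k i a)"
    "b \<in> topspace (mtop D)"
  shows "w b = w' b"
proof -
  let ?Z = "md_copy emb Z"
  note c = multipointed_md_copy[OF assms(2,3)] md_map_into_md_copy[OF assms(2,3)]
    md_map_from_md_copy[OF assms(2,3)]
  have m: "md_map D ?Z (emb \<circ> w)" "md_map D ?Z (emb \<circ> w')"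
    using md_map_compose[OF assms(4) c(2)] md_map_compose[OF assms(5) c(2)] by auto
  have k: "md_cocone r I X f D k" using assms(1) by (auto simp: md_colimit_def)
  note colim = assms(1)[unfolded md_colimit_def, THEN conjunct2, THEN spec, THEN spec, THEN mp, OF conjI]
  have cocone: "md_cocone r I X f ?Z (\<lambda>i. emb \<circ> w \<circ> k i)"
    unfolding md_cocone_def
  proof (intro conjI ballI impI)
    show "md_map (X i) ?Z (emb \<circ> w \<circ> k i)" if "i \<in> I" for i
      using k that by (intro md_map_compose[OF _ m(1)]) (simp add: md_cocone_def)
  qed (use k in \<open>simp add: md_cocone_def\<close>)
  obtain v where v: "\<And>w'. md_map D ?Z w' \<Longrightarrow>
      (\<forall>i \<in> I. \<forall>a \<in> topspace (mtop (X i)). w' (k i a) = (emb \<circ> w \<circ> k i) a) \<Longrightarrow>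
      \<forall>b \<in> topspace (mtop D). w' b = v b"
    using colim[OF c(1) cocone] by blast
  have "\<forall>b \<in> topspace (mtop D). (emb \<circ> w) b = v b" by (rule v[OF m(1)]) auto
  moreover have "\<forall>b \<in> topspace (mtop D). (emb \<circ> w') b = v b"
    by (rule v[OF m(2)]) (use assms(6) in auto)
  ultimately have "emb (w b) = emb (w' b)" using assms(7) by auto
  then show ?thesis using assms(2) by (simp add: inj_eq)
qed

section \<open>Light hulls\<close>

text \<open>The part of Y accounted for by the probes F and by light paths. Continuity in the finer
  topology is demanded of x and not of its witness e, so that closure properties of the witnesses
  come directly from Y. Once the hull is shown to be all of Y, the distinction disappears.\<close>

definition light_hull :: "'a mdspace \<Rightarrow> 'a set \<Rightarrow> (nat \<times> ((nat \<Rightarrow> real) \<Rightarrow> 'a)) set \<Rightarrow> 'a mdspace" where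
  "light_hull Y S F = \<lparr>mtop = simplex_final S F, mstates = mstates Y \<inter> S,
     mpaths = {x \<in> mpaths Y \<inter> paths_in (simplex_final S F).
       \<exists>e \<in> mpaths Y. light e \<and> (\<exists>\<psi> \<in> Rep_plus. x = reparam e \<psi>)}\<rparr>"

text \<open>Reparametrizing x composes factors in \<open>Rep_plus\<close>; composing two paths
  composes their light witnesses and glues the factors. The inclusion into Y is injective, which
  carries the \<Delta>-Hausdorff property down from Y.\<close>

lemma
  assumes Y: "multipointed c P Y" and S: "S \<subseteq> topspace (mtop Y)"
    and F: "\<And>p \<sigma> s. (p, \<sigma>) \<in> F \<Longrightarrow> s \<in> topspace (simplex_space p) \<Longrightarrow> \<sigma> s \<in> S"
      "\<And>p \<sigma>. (p, \<sigma>) \<in> F \<Longrightarrow> continuous_map (simplex_space p) (mtop Y) \<sigma>"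
  shows multipointed_light_hull: "multipointed c P (light_hull Y S F)"
    and md_map_light_hull: "md_map (light_hull Y S F) Y (\<lambda>b. b)"
proof -
  let ?T = "simplex_final S F"
  have top: "topspace ?T = S" by (rule topspace_simplex_final) (use F in blast)
  have id: "continuous_map ?T (mtop Y) (\<lambda>b. b)"
    by (rule continuous_map_from_simplex_final) (use F S in \<open>auto simp: comp_def\<close>)
  have T: "space_in c ?T"
  proof (rule space_in_finer[OF multipointed_space_in[OF Y] _ id])
    show "delta_generated ?T" by (rule delta_generated_simplex_final) (use F in blast)
  qed auto
  show "multipointed c P (light_hull Y S F)"
    unfolding multipointed_def
  proof (intro conjI)
    show "\<forall>x\<in>mpaths (light_hull Y S F). x 0 \<in> mstates (light_hull Y S F) \<and> x 1 \<in> mstates (light_hull Y S F)"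
      using multipointed_endpoints[OF Y] paths_in_topspace[of _ ?T]
      by (auto simp: light_hull_def top)
    show "\<forall>x\<in>mpaths (light_hull Y S F). \<forall>\<phi>\<in>kind_maps P. reparam x \<phi> \<in> mpaths (light_hull Y S F)"
    proof (intro ballI)
      fix x \<phi> assume x: "x \<in> mpaths (light_hull Y S F)" and \<phi>: "\<phi> \<in> kind_maps P"
      then obtain e \<psi> where e: "e \<in> mpaths Y" "light e" "\<psi> \<in> Rep_plus" "x = reparam e \<psi>"
        by (auto simp: light_hull_def)
      have r: "reparam x \<phi> \<in> mpaths Y" "reparam x \<phi> \<in> paths_in ?T"
        using x multipointed_reparam[OF Y _ \<phi>] reparam_in_paths_in[of x ?T, OF _ kind_maps_nondecreasing[OF \<phi>]]
        by (simp_all add: light_hull_def)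
      have "reparam x \<phi> = reparam e (\<psi> \<circ> \<phi>)"
        unfolding e(4) by (rule reparam_reparam) (use \<phi> kind_maps_range in blast)
      moreover have "\<psi> \<circ> \<phi> \<in> Rep_plus"
        using e(3) \<phi> kind_maps_subset_Rep_plus by (blast intro: Rep_plus_comp)
      ultimately show "reparam x \<phi> \<in> mpaths (light_hull Y S F)"
        using e(1,2) r unfolding light_hull_def by simp blast
    qed
    show "\<forall>x\<in>mpaths (light_hull Y S F). \<forall>y\<in>mpaths (light_hull Y S F). x 1 = y 0 \<longrightarrow>
        normalized_comp x y \<in> mpaths (light_hull Y S F)"
    proof (intro ballI impI)
      fix x y assume x: "x \<in> mpaths (light_hull Y S F)" and y: "y \<in> mpaths (light_hull Y S F)"
        and xy: "x 1 = y 0"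
      obtain e \<psi> where e: "e \<in> mpaths Y" "light e" "\<psi> \<in> Rep_plus" "x = reparam e \<psi>"
        using x by (auto simp: light_hull_def)
      obtain e' \<psi>' where e': "e' \<in> mpaths Y" "light e'" "\<psi>' \<in> Rep_plus" "y = reparam e' \<psi>'"
        using y by (auto simp: light_hull_def)
      have "e 1 = e' 0" using xy e e' by (simp add: reparam_endpoints)
      then have "normalized_comp e e' \<in> mpaths Y" "light (normalized_comp e e')"
        using e e' multipointed_normalized_comp[OF Y] light_normalized_comp by auto
      moreover obtain \<theta> where "\<theta> \<in> Rep_plus" "normalized_comp x y = reparam (normalized_comp e e') \<theta>"
        using normalized_comp_reparam[of \<psi> \<psi>' e e'] e e' \<open>e 1 = e' 0\<close> by auto
      moreover have "normalized_comp x y \<in> mpaths Y" "normalized_comp x y \<in> paths_in ?T"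
        using x y xy multipointed_normalized_comp[OF Y, of x y] normalized_comp_in_paths_in[of x ?T y]
        by (simp_all add: light_hull_def)
      ultimately show "normalized_comp x y \<in> mpaths (light_hull Y S F)"
        unfolding light_hull_def by simp blast
    qed
  qed (use T in \<open>auto simp: light_hull_def top\<close>)
  show "md_map (light_hull Y S F) Y (\<lambda>b. b)"
    unfolding md_map_def
  proof (intro conjI ballI)
    fix x assume "x \<in> mpaths (light_hull Y S F)"
    then show "path_image_under (\<lambda>b. b) x \<in> mpaths Y"
      using path_image_under_id[OF multipointed_paths_in[OF Y], of x "\<lambda>b. b"]
      by (auto simp: light_hull_def)
  qed (use id in \<open>auto simp: light_hull_def\<close>)
qed

text \<open>When the identity is a map into the hull, every restriction built into the hull becomes
  a property of Y. In particular the topology of Y is at least as fine as the final one, so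
  continuity out of Y may be tested on F.\<close>

lemma
  assumes Y: "multipointed c P Y" and id: "md_map Y (light_hull Y S F) (\<lambda>b. b)"
    and F: "\<And>p \<sigma> s. (p, \<sigma>) \<in> F \<Longrightarrow> s \<in> topspace (simplex_space p) \<Longrightarrow> \<sigma> s \<in> S"
  shows light_hull_imp_lightly_generated: "lightly_generated Y"
    and light_hull_imp_topspace: "topspace (mtop Y) \<subseteq> S"
    and light_hull_imp_continuous_map: "(\<And>p \<sigma>. (p, \<sigma>) \<in> F \<Longrightarrow> continuous_map (simplex_space p) T (G \<circ> \<sigma>)) \<Longrightarrow>
       G ` S \<subseteq> topspace T \<Longrightarrow> continuous_map (mtop Y) T G"
proof -
  have "x \<in> mpaths (light_hull Y S F)" if "x \<in> mpaths Y" for x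
    using md_map_paths[OF id that] path_image_under_id[OF multipointed_paths_in[OF Y that], of "\<lambda>b. b"]
    by simp
  then show "lightly_generated Y" by (auto simp: lightly_generated_def light_hull_def)
  have top: "topspace (simplex_final S F) = S" by (rule topspace_simplex_final) (use F in blast)
  show "topspace (mtop Y) \<subseteq> S"
    using md_map_topspace[OF id] by (auto simp: light_hull_def top)
  assume "\<And>p \<sigma>. (p, \<sigma>) \<in> F \<Longrightarrow> continuous_map (simplex_space p) T (G \<circ> \<sigma>)" "G ` S \<subseteq> topspace T"
  then have "continuous_map (simplex_final S F) T G"
    using F by (intro continuous_map_from_simplex_final) auto
  then have "continuous_map (mtop Y) T (G \<circ> (\<lambda>b. b))"
    using md_map_continuous[OF id] by (intro continuous_map_compose) (auto simp: light_hull_def)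
  then show "continuous_map (mtop Y) T G" by (simp add: comp_def)
qed

section \<open>Globes of disks\<close>

definition radius :: "nat \<Rightarrow> (nat \<Rightarrow> real) \<Rightarrow> real" where
  "radius n z = sqrt (\<Sum>i<n. (z i)\<^sup>2)"

lemma radius_nonneg: "0 \<le> radius n z"
  by (simp add: radius_def sum_nonneg)

lemma topspace_disk: "topspace (disk n) = {z. (\<forall>i\<ge>n. z i = 0) \<and> radius n z \<le> 1}"
  by (auto simp: disk_def topspace_Euclidean_space radius_def)

lemma topspace_boundary_sphere:
  "topspace (boundary_sphere n) = {z. (\<forall>i\<ge>n. z i = 0) \<and> radius n z = 1}"
  by (auto simp: boundary_sphere_def topspace_Euclidean_space radius_def)

lemma zero_in_disk: "(\<lambda>i. 0) \<in> topspace (disk n)"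
  by (simp add: topspace_disk radius_def)

lemma disk_eq: "disk n = subtopology (powertop_real UNIV) {z. (\<forall>i\<ge>n. z i = 0) \<and> radius n z \<le> 1}"
  by (auto simp: disk_def Euclidean_space_def subtopology_subtopology radius_def intro!: arg_cong[where f = "subtopology _"])

lemma boundary_sphere_eq:
  "boundary_sphere n = subtopology (powertop_real UNIV) {z. (\<forall>i\<ge>n. z i = 0) \<and> radius n z = 1}"
  by (auto simp: boundary_sphere_def Euclidean_space_def subtopology_subtopology radius_def
      intro!: arg_cong[where f = "subtopology _"])

lemma continuous_map_disk_coordinate: "continuous_map (disk n) euclideanreal (\<lambda>z. z i)"
  unfolding disk_eq by (intro continuous_map_from_subtopology continuous_map_product_projection) auto

lemma continuous_map_radius:
  assumes "\<And>i. continuous_map X euclideanreal (\<lambda>x. f x i)"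
  shows "continuous_map X euclideanreal (\<lambda>x. radius n (f x))"
  unfolding radius_def using assms by (intro continuous_intros) auto

lemma radius_scale: "radius n (\<lambda>i. z i / a) = radius n z / \<bar>a\<bar>"
  by (simp add: radius_def power_divide real_sqrt_divide flip: sum_divide_distrib)

lemma abs_coordinate_le_radius: "i < n \<Longrightarrow> \<bar>z i\<bar> \<le> radius n z"
proof -
  assume "i < n"
  then have "(z i)\<^sup>2 \<le> (\<Sum>i<n. (z i)\<^sup>2)" by (intro member_le_sum) auto
  then show ?thesis unfolding radius_def using real_le_rsqrt by fastforce
qed

text \<open>The cylinder is Hausdorff, so it suffices to cover it by a single simplex: n coordinates
  give the point, one gives the time, and one more absorbs the slack in the sum.\<close>

lemma delta_generated_disk_times_interval:
  "delta_generated (prod_topology (disk n) unit_interval)"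
proof (rule delta_generated_simplex_image)
  \<comment> \<open>With this factor, n + 1 numbers from [0,1] have sum at most 1 after division by
    R and fit into a simplex.\<close>
  define R where "R = real (n + 1)"
  define w where "w s i = 2 * (R * s i) - 1" for s :: "nat \<Rightarrow> real" and i
  \<comment> \<open>Since \<open>R * s i\<close> may exceed 1, the radial retraction and the
    \<open>min\<close> bring all other points of the simplex back into the disk and the
    interval.\<close>
  define q where "q s = ((\<lambda>i. if i < n then w s i / max 1 (radius n (w s)) else 0), min 1 (R * s n))" for s
  let ?\<Delta> = "simplex_space (n + 1)"
  have R: "R \<ge> 1" by (simp add: R_def)
  have w: "continuous_map ?\<Delta> euclideanreal (\<lambda>s. w s i)" for i
    unfolding w_def by (intro continuous_intros continuous_map_simplex_coordinate)
  have rad: "radius n (\<lambda>i. if i < n then w s i / max 1 (radius n (w s)) else 0) \<le> 1" for s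
  proof -
    have "radius n (\<lambda>i. if i < n then w s i / max 1 (radius n (w s)) else 0)
        = radius n (\<lambda>i. w s i / max 1 (radius n (w s)))"
      by (simp add: radius_def)
    also have "\<dots> \<le> 1"
      unfolding radius_scale by (subst divide_le_eq_1_pos) (simp_all add: less_max_iff_disj)
    finally show ?thesis .
  qed
  have c1: "continuous_map ?\<Delta> (disk n) (\<lambda>s. fst (q s))"
    unfolding disk_eq continuous_map_in_subtopology continuous_map_componentwise_UNIV
  proof (intro conjI allI)
    fix i
    show "continuous_map ?\<Delta> euclideanreal (\<lambda>s. fst (q s) i)"
    proof (cases "i < n")
      case True
      have "continuous_map ?\<Delta> euclideanreal (\<lambda>s. w s i / max 1 (radius n (w s)))"
        using w by (intro continuous_intros continuous_map_radius) auto
      then show ?thesis using True by (simp add: q_def)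
    qed (simp add: q_def)
  qed (use rad in \<open>auto simp: q_def\<close>)
  have c2: "continuous_map ?\<Delta> unit_interval (\<lambda>s. snd (q s))"
    unfolding continuous_map_in_subtopology
  proof (intro conjI)
    show "continuous_map ?\<Delta> euclidean (\<lambda>s. snd (q s))"
      unfolding q_def snd_conv by (intro continuous_intros continuous_map_simplex_coordinate)
  qed (use R in \<open>auto simp: q_def standard_simplex_def\<close>)
  show "continuous_map ?\<Delta> (prod_topology (disk n) unit_interval) q"
    using c1 c2 by (simp add: continuous_map_pairwise comp_def)
  show "topspace (prod_topology (disk n) unit_interval) \<subseteq> q ` standard_simplex (n + 1)"
  proof clarify
    fix z t assume "(z, t) \<in> topspace (prod_topology (disk n) unit_interval)"
    then have z: "\<And>i. i \<ge> n \<Longrightarrow> z i = 0" "radius n z \<le> 1" and t: "0 \<le> t" "t \<le> 1"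
      by (auto simp: topspace_disk)
    define a where "a i = (if i < n then (1 + z i) / 2 else if i = n then t else 0)" for i
    define s where "s i = (if i = n + 1 then 1 - (\<Sum>i\<le>n. a i / R) else a i / R)" for i
    have a: "0 \<le> a i" "a i \<le> 1" for i
      using abs_coordinate_le_radius[of i n z] z t by (auto simp: a_def)
    have "(\<Sum>i\<le>n. a i / R) \<le> (\<Sum>i\<le>n. 1 / R)"
      using a R by (intro sum_mono divide_right_mono) auto
    also have "\<dots> = 1" by (simp add: R_def)
    finally have le: "(\<Sum>i\<le>n. a i / R) \<le> 1" .
    have ge: "0 \<le> (\<Sum>i\<le>n. a i / R)" using a R by (intro sum_nonneg) auto
    have "(\<Sum>i\<le>n + 1. s i) = 1"
      by (simp add: s_def)
    moreover have "a i / R \<le> 1" for i using a R by (simp add: divide_le_eq order_trans[of _ 1])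
    ultimately have "s \<in> standard_simplex (n + 1)"
      using a R le ge by (auto simp: standard_simplex_def s_def a_def)
    moreover have ws: "w s i = z i" if "i < n" for i
      using R that by (simp add: w_def s_def a_def field_simps)
    then have "radius n (w s) = radius n z" by (simp add: radius_def)
    then have "fst (q s) = z" using z ws by (auto simp: q_def fun_eq_iff max_def)
    moreover have "snd (q s) = t" using t R by (simp add: q_def s_def a_def)
    ultimately show "(z, t) \<in> q ` standard_simplex (n + 1)"
      by (intro image_eqI[of _ _ s]) (auto simp: prod_eq_iff)
  qed
  show "Hausdorff_space (prod_topology (disk n) unit_interval)"
    unfolding disk_eq
    by (simp add: Hausdorff_space_prod_topology Hausdorff_space_subtopology Hausdorff_space_product_topology)
qed

section \<open>The globe as a quotient of the cylinder\<close>

lemma topspace_globe_topology: "topspace (globe_topology Z) = globe_carrier Z"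
proof
  show "topspace (globe_topology Z) \<subseteq> globe_carrier Z"
    using openin_topspace[of "globe_topology Z"] unfolding openin_globe_topology globe_openin_def by blast
  have "{(z, t). z \<in> topspace Z \<and> t \<in> {0..1} \<and> globe_class z t \<in> globe_carrier Z} =
      topspace (prod_topology Z unit_interval)"
    by (auto simp: globe_carrier_def)
  then have "openin (globe_topology Z) (globe_carrier Z)"
    unfolding openin_globe_topology globe_openin_def by (metis openin_topspace order_refl)
  then show "globe_carrier Z \<subseteq> topspace (globe_topology Z)" by (rule openin_subset)
qed

lemma globe_class_in_carrier: "z \<in> topspace Z \<Longrightarrow> t \<in> {0..1} \<Longrightarrow> globe_class z t \<in> globe_carrier Z"
  unfolding globe_carrier_def by blast

text \<open>For empty Z the cylinder is empty while the globe keeps its two poles, so surjectivity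
  needs a point of Z.\<close>

lemma quotient_map_globe_class:
  assumes "topspace Z \<noteq> {}"
  shows "quotient_map (prod_topology Z unit_interval) (globe_topology Z) (\<lambda>(z, t). globe_class z t)"
  unfolding quotient_map_def topspace_globe_topology
proof (intro conjI allI impI)
  obtain z where z: "z \<in> topspace Z" using assms by blast
  have "Source = globe_class z 0" "Target = globe_class z 1" by (simp_all add: globe_class_def)
  then show "(\<lambda>(z, t). globe_class z t) ` topspace (prod_topology Z unit_interval) = globe_carrier Z"
    using z unfolding globe_carrier_def by (fastforce simp: image_iff)
  fix U assume "U \<subseteq> globe_carrier Z"
  moreover have "{p \<in> topspace (prod_topology Z unit_interval). (case p of (z, t) \<Rightarrow> globe_class z t) \<in> U} =
      {(z, t). z \<in> topspace Z \<and> t \<in> {0..1} \<and> globe_class z t \<in> U}"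
    by auto
  ultimately show "openin (prod_topology Z unit_interval)
      {p \<in> topspace (prod_topology Z unit_interval). (case p of (z, t) \<Rightarrow> globe_class z t) \<in> U} =
      openin (globe_topology Z) U"
    by (simp add: openin_globe_topology globe_openin_def)
qed

lemma continuous_map_globe_class:
  "continuous_map (prod_topology Z unit_interval) (globe_topology Z) (\<lambda>(z, t). globe_class z t)"
proof (cases "topspace Z = {}")
  case True
  then have "topspace (prod_topology Z unit_interval) = {}" by simp
  then show ?thesis unfolding continuous_map_def by (simp add: True)
next
  case False
  then show ?thesis by (intro quotient_imp_continuous_map quotient_map_globe_class)
qed

lemma disk_nonempty: "topspace (disk n) \<noteq> {}"
  using zero_in_disk by blast

lemma delta_generated_globe_disk: "delta_generated (globe_topology (disk n))"
  using delta_generated_quotient[OF delta_generated_disk_times_interval quotient_map_globe_class[OF disk_nonempty]] .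

section \<open>Coordinates\<close>

text \<open>The \<open>Point\<close> coordinates separate the discrete initial stage; the family
  \<open>Cell i\<close> is reserved for the cell attached on reaching stage i.\<close>

datatype ('b, 'i) coord = Point 'b | Cell 'i nat

text \<open>With the discrete topology on coordinates, the bounded continuous functions are all
  bounded functions, so \<open>\<Rightarrow>\<^sub>C\<close> is an l-infinity space.\<close>

instantiation coord :: (type, type) topological_space
begin

definition open_coord :: "('a, 'b) coord set \<Rightarrow> bool" where
  "open_coord U \<longleftrightarrow> True"

instance by standard (auto simp: open_coord_def)

end

lemma continuous_on_coord: "continuous_on S (f :: ('b, 'i) coord \<Rightarrow> 'c :: topological_space)"
  unfolding continuous_on_open_invariant open_coord_def by auto

lemma apply_Bcontfun_coord:
  fixes f :: "('b, 'i) coord \<Rightarrow> real"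
  assumes "\<And>k. f k \<in> {0..1}"
  shows "apply_bcontfun (Bcontfun f) = f"
proof (rule Bcontfun_inverse)
  have "bounded (range f)"
    by (rule bounded_subset[of "{0..1}"]) (use assms in auto)
  then show "f \<in> bcontfun" by (simp add: bcontfun_def continuous_on_coord)
qed

definition basis_vector :: "('b, 'i) coord \<Rightarrow> ('b, 'i) coord \<Rightarrow>\<^sub>C real" where
  "basis_vector k = Bcontfun (\<lambda>l. if l = k then 1 else 0)"

lemma apply_basis_vector: "apply_bcontfun (basis_vector k) l = (if l = k then 1 else 0)"
  unfolding basis_vector_def by (subst apply_Bcontfun_coord) auto

lemma apply_bcontfun_sum: "apply_bcontfun (\<Sum>i\<in>I. f i) k = (\<Sum>i\<in>I. apply_bcontfun (f i) k)"
  for f :: "'d \<Rightarrow> ('b, 'i) coord \<Rightarrow>\<^sub>C real"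
  by (induction I rule: infinite_finite_induct) auto

section \<open>Extending cube-valued boundary data over a cell\<close>

definition bump :: "nat \<Rightarrow> (nat \<Rightarrow> real) \<Rightarrow> real \<Rightarrow> real" where
  "bump n z t = (1 - radius n z) * (t * (1 - t))"

text \<open>On the cylinder the bump is positive exactly in the open cell. Coordinate 0 records the
  bump, coordinate 1 its product with t, and the others its products with (1 + z i) / 2. Dividing by
  coordinate 0 recovers t and z; the affine change of z i keeps all values in [0,1].\<close>

definition cell_vector :: "nat \<Rightarrow> 'i \<Rightarrow> (nat \<Rightarrow> real) \<Rightarrow> real \<Rightarrow> ('b, 'i) coord \<Rightarrow>\<^sub>C real" where
  "cell_vector n l z t = bump n z t *\<^sub>R (basis_vector (Cell l 0) + t *\<^sub>R basis_vector (Cell l 1) +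
     (\<Sum>i<n. ((1 + z i) / 2) *\<^sub>R basis_vector (Cell l (i + 2))))"

lemma apply_cell_vector:
  "apply_bcontfun (cell_vector n l z t) (Point b) = 0"
  "apply_bcontfun (cell_vector n l z t) (Cell m k) = (if m \<noteq> l then 0
     else bump n z t * (if k = 0 then 1 else if k = 1 then t
       else if k - 2 < n then (1 + z (k - 2)) / 2 else 0))"
proof -
  show "apply_bcontfun (cell_vector n l z t) (Point b) = 0"
    by (simp add: cell_vector_def apply_bcontfun_sum apply_basis_vector)
  have "(\<Sum>i<n. (1 + z i) / 2 * (if k = i + 2 then 1 else 0)) =
      (if k \<ge> 2 \<and> k - 2 < n then (1 + z (k - 2)) / 2 else 0)"
  proof (cases "k \<ge> 2")
    case True
    have "(\<Sum>i<n. (1 + z i) / 2 * (if k = i + 2 then 1 else 0)) =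
        (\<Sum>i<n. if i = k - 2 then (1 + z i) / 2 else 0)"
      using True by (intro sum.cong) auto
    then show ?thesis using True by simp
  next
    case False
    then have "(if k = i + 2 then 1 else (0::real)) = 0" for i by auto
    then show ?thesis using False by simp
  qed
  then show "apply_bcontfun (cell_vector n l z t) (Cell m k) = (if m \<noteq> l then 0
     else bump n z t * (if k = 0 then 1 else if k = 1 then t
       else if k - 2 < n then (1 + z (k - 2)) / 2 else 0))"
    by (auto simp: cell_vector_def apply_bcontfun_sum apply_basis_vector)
qed

text \<open>The cube matches the test object: coordinates are tested against the unit interval and
  must take values in it. It also bounds norms by 1, which controls the extension near the centre of
  a disk.\<close>

definition valued_in_cube :: "'a set \<Rightarrow> ('a \<Rightarrow> ('b, 'i) coord \<Rightarrow>\<^sub>C real) \<Rightarrow> bool" where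
  "valued_in_cube S F \<longleftrightarrow> (\<forall>x \<in> S. \<forall>k. apply_bcontfun (F x) k \<in> {0..1})"

text \<open>The extension over a cell of a map given on its boundary: it interpolates between the
  boundary sphere and the segment joining the images of the two poles, and the last summand, which
  vanishes exactly on the boundary, makes it injective on the interior.  At the centre the term
  with \<open>z / 0 = 0\<close> is annihilated by the zero radius.\<close>

definition cell_extension ::
  "nat \<Rightarrow> 'i \<Rightarrow> ((nat \<Rightarrow> real) globe_point \<Rightarrow> ('b, 'i) coord \<Rightarrow>\<^sub>C real) \<Rightarrow>
     (nat \<Rightarrow> real) \<Rightarrow> real \<Rightarrow> ('b, 'i) coord \<Rightarrow>\<^sub>C real" where
  "cell_extension n l F z t =
     radius n z *\<^sub>R F (globe_class (\<lambda>i. z i / radius n z) t) +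
     ((1 - radius n z) * (1 - t)) *\<^sub>R F Source + ((1 - radius n z) * t) *\<^sub>R F Target +
     cell_vector n l z t"

primrec globe_extension ::
  "nat \<Rightarrow> 'i \<Rightarrow> ((nat \<Rightarrow> real) globe_point \<Rightarrow> ('b, 'i) coord \<Rightarrow>\<^sub>C real) \<Rightarrow>
     (nat \<Rightarrow> real) globe_point \<Rightarrow> ('b, 'i) coord \<Rightarrow>\<^sub>C real" where
  "globe_extension n l F Source = F Source"
| "globe_extension n l F Target = F Target"
| "globe_extension n l F (Inner z t) = cell_extension n l F z t"

lemma cell_vector_eq_0: "bump n z t = 0 \<Longrightarrow> cell_vector n l z t = 0"
  by (simp add: cell_vector_def)

text \<open>At a pole, the boundary term and the segment term are multiples of the same value with
  weights r and 1 - r, where r is the radius, and the bump vanishes. So the formula is independent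
  of z there.\<close>

lemma globe_extension_class:
  "globe_extension n l F (globe_class z t) = cell_extension n l F z t"
proof -
  have "cell_vector n l z 0 = (0 :: ('a, 'b) coord \<Rightarrow>\<^sub>C real)"
    "cell_vector n l z 1 = (0 :: ('a, 'b) coord \<Rightarrow>\<^sub>C real)"
    by (simp_all add: cell_vector_eq_0 bump_def)
  then show ?thesis
    by (auto simp: globe_class_def cell_extension_def simp flip: scaleR_add_left)
qed

lemma continuous_map_scaleR_coord:
  fixes f :: "'a \<Rightarrow> 'b :: real_normed_vector"
  shows "continuous_map X euclideanreal a \<Longrightarrow> continuous_map X euclidean f \<Longrightarrow>
    continuous_map X euclidean (\<lambda>x. a x *\<^sub>R f x)"
  by (simp add: continuous_map_atin tendsto_scaleR)

lemma continuous_map_euclidean_eps: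
  fixes f :: "'a \<Rightarrow> 'b :: real_normed_vector"
  shows "continuous_map X euclidean f \<longleftrightarrow>
    (\<forall>x \<in> topspace X. \<forall>e>0. \<exists>U. openin X U \<and> x \<in> U \<and> (\<forall>y \<in> U. dist (f x) (f y) < e))"
  using Met_TC.continuous_map_to_metric[of X f] by simp

text \<open>Radial projection breaks down only on the axis of radius 0. There the boundary term
  tends to 0, because F has norm at most 1 on the boundary and is weighted by the radius.\<close>

lemma continuous_map_cell_extension:
  fixes F :: "(nat \<Rightarrow> real) globe_point \<Rightarrow> ('b, 'i) coord \<Rightarrow>\<^sub>C real"
  assumes F: "continuous_map (globe_topology (boundary_sphere n)) euclidean F"
    and cube: "valued_in_cube (globe_carrier (boundary_sphere n)) F"
  shows "continuous_map (prod_topology (disk n) unit_interval) euclidean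
    (\<lambda>p. cell_extension n l F (fst p) (snd p))"
proof -
  let ?T = "prod_topology (disk n) unit_interval"
  have coord: "continuous_map ?T euclideanreal (\<lambda>p. fst p i)" for i
    using continuous_map_compose[OF continuous_map_fst continuous_map_disk_coordinate] by (simp add: comp_def)
  have time: "continuous_map ?T euclideanreal snd"
    using continuous_map_snd continuous_map_into_fulltopology by blast
  have rad: "continuous_map ?T euclideanreal (\<lambda>p. radius n (fst p))"
    by (rule continuous_map_radius) (rule coord)
  have vec: "continuous_map ?T euclidean (\<lambda>p. cell_vector n l (fst p) (snd p))"
    unfolding cell_vector_def bump_def
    by (intro continuous_map_scaleR_coord continuous_map_add continuous_map_sum continuous_intros
        rad time coord) auto
  define W where "W p = radius n (fst p) *\<^sub>R F (globe_class (\<lambda>i. fst p i / radius n (fst p)) (snd p))" for p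
  define V where "V = {p \<in> topspace ?T. radius n (fst p) \<in> {0<..}}"
  have V: "openin ?T V"
    unfolding V_def by (rule openin_continuous_map_preimage[OF rad]) simp
  have proj: "((\<lambda>i. fst p i / radius n (fst p)), snd p) \<in> topspace (prod_topology (boundary_sphere n) unit_interval)"
    if "p \<in> V" for p
    using that by (auto simp: V_def topspace_disk topspace_boundary_sphere radius_scale)
  have contV: "continuous_map (subtopology ?T V) euclidean W"
    unfolding W_def
  proof (rule continuous_map_scaleR_coord)
    have "continuous_map (subtopology ?T V) (boundary_sphere n) (\<lambda>p i. fst p i / radius n (fst p))"
      unfolding boundary_sphere_eq continuous_map_in_subtopology continuous_map_componentwise_UNIV
    proof (intro conjI allI)
      show "continuous_map (subtopology ?T V) euclideanreal (\<lambda>p. fst p i / radius n (fst p))" for i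
        by (intro continuous_intros continuous_map_from_subtopology coord rad) (auto simp: V_def)
    qed (use proj in \<open>auto simp: topspace_boundary_sphere\<close>)
    then have "continuous_map (subtopology ?T V) (prod_topology (boundary_sphere n) unit_interval)
        (\<lambda>p. ((\<lambda>i. fst p i / radius n (fst p)), snd p))"
      by (auto simp: continuous_map_pairwise comp_def intro: continuous_map_from_subtopology continuous_map_snd)
    then have "continuous_map (subtopology ?T V) euclidean
       (F \<circ> ((\<lambda>(z, t). globe_class z t) \<circ> (\<lambda>p. ((\<lambda>i. fst p i / radius n (fst p)), snd p))))"
      by (intro continuous_map_compose[OF _ F] continuous_map_compose[OF _ continuous_map_globe_class])
    then show "continuous_map (subtopology ?T V) euclidean
       (\<lambda>p. F (globe_class (\<lambda>i. fst p i / radius n (fst p)) (snd p)))"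
      by (simp add: comp_def)
  qed (intro continuous_map_from_subtopology rad)
  have bound: "norm (W p) \<le> radius n (fst p)" if "p \<in> topspace ?T" for p
  proof (cases "p \<in> V")
    case True
    have "globe_class (\<lambda>i. fst p i / radius n (fst p)) (snd p) \<in> globe_carrier (boundary_sphere n)"
      using proj[OF True] by (intro globe_class_in_carrier) auto
    then have "norm (F (globe_class (\<lambda>i. fst p i / radius n (fst p)) (snd p))) \<le> 1"
      using cube by (intro norm_bound) (auto simp: valued_in_cube_def)
    then show ?thesis
      using radius_nonneg[of n "fst p"] by (auto simp: W_def intro: mult_left_le)
  next
    case False
    then have "radius n (fst p) = 0" using that radius_nonneg[of n "fst p"] by (auto simp: V_def)
    then show ?thesis by (simp add: W_def)
  qed
  have "continuous_map ?T euclidean W"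
    unfolding continuous_map_euclidean_eps
  proof (intro ballI allI impI)
    fix p and e :: real assume p: "p \<in> topspace ?T" and e: "e > 0"
    show "\<exists>U. openin ?T U \<and> p \<in> U \<and> (\<forall>q \<in> U. dist (W p) (W q) < e)"
    proof (cases "p \<in> V")
      case True
      then have "p \<in> topspace (subtopology ?T V)" using p by simp
      then obtain U where U: "openin (subtopology ?T V) U" "p \<in> U" "\<forall>q \<in> U. dist (W p) (W q) < e"
        using contV[unfolded continuous_map_euclidean_eps, rule_format, OF _ e] by blast
      then show ?thesis using openin_trans_full[OF U(1) V] by blast
    next
      case False
      then have "radius n (fst p) = 0" using p radius_nonneg[of n "fst p"] by (auto simp: V_def)
      then have "W p = 0" by (simp add: W_def)
      moreover have "norm (W q) < e" if "q \<in> topspace ?T" "radius n (fst q) < e" for q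
        using bound[OF that(1)] that(2) by simp
      moreover have "openin ?T {p \<in> topspace ?T. radius n (fst p) \<in> {..<e}}"
        by (rule openin_continuous_map_preimage[OF rad]) simp
      ultimately show ?thesis
        using p e \<open>radius n (fst p) = 0\<close>
        by (intro exI[of _ "{p \<in> topspace ?T. radius n (fst p) \<in> {..<e}}"]) simp
    qed
  qed
  moreover have "(\<lambda>p. cell_extension n l F (fst p) (snd p)) = (\<lambda>p. W p +
      ((1 - radius n (fst p)) * (1 - snd p)) *\<^sub>R F Source + ((1 - radius n (fst p)) * snd p) *\<^sub>R F Target +
      cell_vector n l (fst p) (snd p))"
    by (simp add: cell_extension_def W_def fun_eq_iff)
  ultimately show ?thesis
    using rad time vec
    by (simp only:) (intro continuous_map_add continuous_map_scaleR_coord continuous_intros; simp)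
qed

lemma continuous_map_globe_extension:
  fixes F :: "(nat \<Rightarrow> real) globe_point \<Rightarrow> ('b, 'i) coord \<Rightarrow>\<^sub>C real"
  assumes "continuous_map (globe_topology (boundary_sphere n)) euclidean F"
    and "valued_in_cube (globe_carrier (boundary_sphere n)) F"
  shows "continuous_map (globe_topology (disk n)) euclidean (globe_extension n l F)"
proof (rule continuous_compose_quotient_map[OF quotient_map_globe_class[OF disk_nonempty]])
  have "globe_extension n l F \<circ> (\<lambda>(z, t). globe_class z t) =
      (\<lambda>p. cell_extension n l F (fst p) (snd p))"
    by (auto simp: fun_eq_iff globe_extension_class)
  then show "continuous_map (prod_topology (disk n) unit_interval) euclidean
      (globe_extension n l F \<circ> (\<lambda>(z, t). globe_class z t))"
    using continuous_map_cell_extension[OF assms] by simp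
qed

lemma globe_extension_boundary:
  assumes "q \<in> globe_carrier (boundary_sphere n)"
  shows "globe_extension n l F q = F q"
proof -
  have "globe_extension n l F (globe_class z t) = F (globe_class z t)"
    if "z \<in> topspace (boundary_sphere n)" for z t
  proof -
    have "radius n z = 1" using that by (simp add: topspace_boundary_sphere)
    then show ?thesis
      unfolding globe_extension_class by (simp add: cell_extension_def cell_vector_eq_0 bump_def)
  qed
  then show ?thesis using assms by (auto simp: globe_carrier_def)
qed

lemma bump_pos: "radius n z < 1 \<Longrightarrow> 0 < t \<Longrightarrow> t < 1 \<Longrightarrow> bump n z t > 0"
  by (simp add: bump_def)

lemma bump_in_unit: "radius n z \<le> 1 \<Longrightarrow> t \<in> {0..1} \<Longrightarrow> bump n z t \<in> {0..1}"
  using radius_nonneg[of n z] by (auto simp: bump_def intro!: mult_le_one)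

lemma apply_cell_vector_zero: "(\<And>k. l \<noteq> Cell m k) \<Longrightarrow> apply_bcontfun (cell_vector n m z t) l = 0"
  by (cases l) (auto simp: apply_cell_vector)

lemma globe_carrier_cases:
  assumes "q \<in> globe_carrier (disk n)"
  obtains "q \<in> globe_carrier (boundary_sphere n)"
  | z t where "q = Inner z t" "z \<in> topspace (disk n)" "radius n z < 1" "0 < t" "t < 1"
  using assms unfolding globe_carrier_def
proof (elim UnE CollectE exE conjE)
  fix z t assume z: "z \<in> topspace (disk n)" and t: "t \<in> {0..1}" and q: "q = globe_class z t"
  consider "t = 0" | "t = 1" | "0 < t" "t < 1" "radius n z = 1" | "0 < t" "t < 1" "radius n z < 1"
    using z t by (fastforce simp: topspace_disk)
  then show thesis
  proof cases
    case 3
    then have "z \<in> topspace (boundary_sphere n)"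
      using z by (auto simp: topspace_disk topspace_boundary_sphere)
    then show ?thesis using that(1) t q unfolding globe_carrier_def by blast
  qed (use that z q in \<open>auto simp: globe_class_def globe_carrier_def\<close>)
qed (use that in \<open>auto simp: globe_carrier_def\<close>)

lemma apply_cell_extension:
  "apply_bcontfun (cell_extension n l F z t) k =
     radius n z * F (globe_class (\<lambda>i. z i / radius n z) t) k +
     (1 - radius n z) * (1 - t) * F Source k + (1 - radius n z) * t * F Target k +
     cell_vector n l z t k"
  by (simp add: cell_extension_def)

text \<open>The weights r, (1 - r) (1 - t) and (1 - r) t of the boundary values have sum 1. Apart
  from the cell vector, the extension is therefore a convex combination.\<close>

lemma cell_extension_convex:
  assumes cube: "valued_in_cube (globe_carrier (boundary_sphere n)) F"
    and z: "z \<in> topspace (disk n)" and t: "0 \<le> t" "t \<le> 1"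
  shows "apply_bcontfun (cell_extension n l F z t) k - cell_vector n l z t k \<in> {0..1}"
    "(\<And>q. q \<in> globe_carrier (boundary_sphere n) \<Longrightarrow> apply_bcontfun (F q) k = 0) \<Longrightarrow>
       apply_bcontfun (cell_extension n l F z t) k = cell_vector n l z t k"
proof -
  let ?r = "radius n z"
  let ?q = "globe_class (\<lambda>i. z i / ?r) t"
  have r: "0 \<le> ?r" "?r \<le> 1" using z radius_nonneg[of n z] by (auto simp: topspace_disk)
  have poles: "Source \<in> globe_carrier (boundary_sphere n)" "Target \<in> globe_carrier (boundary_sphere n)"
    by (auto simp: globe_carrier_def)
  \<comment> \<open>On the axis the projected point is not on the sphere, which for n = 0 is even
    empty; its weight is then 0.\<close>
  have q: "?q \<in> globe_carrier (boundary_sphere n)" if "?r \<noteq> 0"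
    using that z r t by (intro globe_class_in_carrier) (auto simp: topspace_boundary_sphere topspace_disk radius_scale)
  have F: "0 \<le> F q k" "F q k \<le> 1" if "q \<in> globe_carrier (boundary_sphere n)" for q
    using cube that by (auto simp: valued_in_cube_def)
  have p1: "0 \<le> ?r * F ?q k" "?r * F ?q k \<le> ?r"
    using q F r by (cases "?r = 0"; auto intro: mult_left_le)+
  have p2: "0 \<le> (1 - ?r) * (1 - t) * F Source k" "(1 - ?r) * (1 - t) * F Source k \<le> (1 - ?r) * (1 - t)"
    using F[OF poles(1)] r t by (auto intro: mult_left_le)
  have p3: "0 \<le> (1 - ?r) * t * F Target k" "(1 - ?r) * t * F Target k \<le> (1 - ?r) * t"
    using F[OF poles(2)] r t by (auto intro: mult_left_le)
  have "?r + (1 - ?r) * (1 - t) + (1 - ?r) * t = 1" by (simp add: algebra_simps)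
  then show "apply_bcontfun (cell_extension n l F z t) k - cell_vector n l z t k \<in> {0..1}"
    unfolding apply_cell_extension atLeastAtMost_iff using p1 p2 p3 by linarith
  assume 0: "\<And>q. q \<in> globe_carrier (boundary_sphere n) \<Longrightarrow> apply_bcontfun (F q) k = 0"
  have "?r * F ?q k = 0" using q 0 by (cases "?r = 0") auto
  then show "apply_bcontfun (cell_extension n l F z t) k = cell_vector n l z t k"
    unfolding apply_cell_extension using 0[OF poles(1)] 0[OF poles(2)] by simp
qed

text \<open>The convex part and the cell vector never meet in one coordinate: the former vanishes on
  the fresh family \<open>Cell l\<close>, the latter outside it. If both were nonzero somewhere,
  their sum could exceed 1.\<close>

lemma valued_in_cube_globe_extension:
  fixes F :: "(nat \<Rightarrow> real) globe_point \<Rightarrow> ('b, 'i) coord \<Rightarrow>\<^sub>C real"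
  assumes cube: "valued_in_cube (globe_carrier (boundary_sphere n)) F"
    and fresh: "\<And>q k. q \<in> globe_carrier (boundary_sphere n) \<Longrightarrow> apply_bcontfun (F q) (Cell l k) = 0"
  shows "valued_in_cube (globe_carrier (disk n)) (globe_extension n l F)"
  unfolding valued_in_cube_def
proof (intro ballI allI)
  fix q k assume "q \<in> globe_carrier (disk n)"
  then show "apply_bcontfun (globe_extension n l F q) k \<in> {0..1}"
  proof (cases rule: globe_carrier_cases)
    case 1
    then show ?thesis using cube by (simp add: globe_extension_boundary valued_in_cube_def)
  next
    case (2 z t)
    have z: "z i \<in> {-1..1}" if "i < n" for i
      using abs_coordinate_le_radius[OF that, of z] 2 by auto
    show ?thesis
    proof (cases "\<exists>m. k = Cell l m")
      case True
      then obtain m where m: "k = Cell l m" by blast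
      define a where "a = (if m = 0 then 1 else if m = 1 then t
          else if m - 2 < n then (1 + z (m - 2)) / 2 else 0)"
      have "bump n z t \<in> {0..1}" using 2 by (intro bump_in_unit) auto
      moreover have "a \<in> {0..1}" using 2 z[of "m - 2"] by (auto simp: a_def)
      ultimately have "bump n z t * a \<in> {0..1}" by (auto intro!: mult_le_one)
      then have "cell_vector n l z t (Cell l m :: ('b, 'i) coord) \<in> {0..1}"
        by (simp only: apply_cell_vector a_def if_False simp_thms)
      then show ?thesis
        using cell_extension_convex(2)[OF cube 2(2), of t "Cell l m" l] fresh 2 m by simp
    next
      case False
      then have "cell_vector n l z t k = 0" by (intro apply_cell_vector_zero) auto
      then show ?thesis using cell_extension_convex(1)[OF cube 2(2), of t l k] 2 by simp
    qed
  qed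
qed

text \<open>On the fresh family only the cell vector is seen. Its coordinate 0, the bump, separates
  new points from old ones, and the ratios of the other coordinates to it give back t and z.\<close>

lemma globe_extension_interior:
  fixes F :: "(nat \<Rightarrow> real) globe_point \<Rightarrow> ('b, 'i) coord \<Rightarrow>\<^sub>C real"
  assumes cube: "valued_in_cube (globe_carrier (boundary_sphere n)) F"
    and fresh: "\<And>q k. q \<in> globe_carrier (boundary_sphere n) \<Longrightarrow> apply_bcontfun (F q) (Cell l k) = 0"
    and z: "z \<in> topspace (disk n)" "radius n z < 1" and t: "0 < t" "t < 1"
  shows "globe_extension n l F (Inner z t) (Cell l 0) > 0"
    and "z' \<in> topspace (disk n) \<Longrightarrow> radius n z' < 1 \<Longrightarrow> 0 < t' \<Longrightarrow> t' < 1 \<Longrightarrow>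
      globe_extension n l F (Inner z t) = globe_extension n l F (Inner z' t') \<Longrightarrow> z = z' \<and> t = t'"
proof -
  have ext: "globe_extension n l F (Inner z t) (Cell l k) =
      (cell_vector n l z t :: ('b, 'i) coord \<Rightarrow>\<^sub>C real) (Cell l k)"
    if "z \<in> topspace (disk n)" "0 < t" "t < 1" for z t k
    using cell_extension_convex(2)[OF cube that(1), of t "Cell l k" l] fresh that by simp
  have b: "bump n z t > 0" using z t by (simp add: bump_pos)
  then show "globe_extension n l F (Inner z t) (Cell l 0) > 0"
    using ext[OF z(1) t] by (simp add: apply_cell_vector)
  assume z': "z' \<in> topspace (disk n)" "radius n z' < 1" "0 < t'" "t' < 1"
    and eq: "globe_extension n l F (Inner z t) = globe_extension n l F (Inner z' t')"
  have *: "cell_vector n l z t (Cell l k :: ('b, 'i) coord) = cell_vector n l z' t' (Cell l k :: ('b, 'i) coord)" for k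
    using ext[OF z(1) t, of k] ext[OF z'(1,3,4), of k] eq by simp
  have b': "bump n z t = bump n z' t'" using *[of 0] by (simp add: apply_cell_vector)
  have tt: "t = t'" using *[of 1] b b' by (simp add: apply_cell_vector)
  have "z i = z' i" for i
  proof (cases "i < n")
    case True
    then show ?thesis using *[of "i + 2"] b b' by (simp add: apply_cell_vector)
  next
    case False
    then show ?thesis using z(1) z'(1) by (simp add: topspace_disk)
  qed
  then show "z = z' \<and> t = t'" using tt by auto
qed

section \<open>Attaching a cell\<close>

lemma continuous_map_apply_bcontfun:
  fixes f :: "'a \<Rightarrow> ('b, 'i) coord \<Rightarrow>\<^sub>C real"
  assumes "continuous_map X euclidean f"
  shows "continuous_map X euclideanreal (\<lambda>x. f x k)"
  unfolding continuous_map_euclidean_eps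
proof (intro ballI allI impI)
  fix x and e :: real assume "x \<in> topspace X" "e > 0"
  then obtain U where U: "openin X U" "x \<in> U" "\<forall>y \<in> U. dist (f x) (f y) < e"
    using assms unfolding continuous_map_euclidean_eps by blast
  have "dist (f x k) (f y k) < e" if "y \<in> U" for y
    using U(3) that dist_bounded[of "f x" k "f y"] by (meson le_less_trans)
  then show "\<exists>U. openin X U \<and> x \<in> U \<and> (\<forall>y\<in>U. dist (f x k) (f y k) < e)" using U by blast
qed

lemma continuous_map_unit_interval_coord:
  fixes f :: "'a \<Rightarrow> ('b, 'i) coord \<Rightarrow>\<^sub>C real"
  assumes "continuous_map X euclidean f" "valued_in_cube (topspace X) f"
  shows "continuous_map X unit_interval (\<lambda>x. f x k)"
  unfolding continuous_map_in_subtopology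
proof
  show "continuous_map X euclidean (\<lambda>x. f x k)" by (rule continuous_map_apply_bcontfun[OF assms(1)])
  show "(\<lambda>x. f x k) \<in> topspace X \<rightarrow> {0..1}" using assms(2) unfolding valued_in_cube_def by blast
qed

definition cube_embedding :: "'b mdspace \<Rightarrow> ('b \<Rightarrow> ('b, 'i) coord \<Rightarrow>\<^sub>C real) \<Rightarrow> bool" where
  "cube_embedding X F \<longleftrightarrow> continuous_map (mtop X) euclidean F \<and>
     inj_on F (topspace (mtop X)) \<and> valued_in_cube (topspace (mtop X)) F"

lemma md_map_cong:
  assumes "multipointed c P A" "md_map A B f" "\<And>a. a \<in> topspace (mtop A) \<Longrightarrow> f a = g a"
  shows "md_map A B g"
  unfolding md_map_def
proof (intro conjI ballI)
  show "continuous_map (mtop A) (mtop B) g"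
    using continuous_map_eq[OF md_map_continuous[OF assms(2)]] assms(3) by blast
  show "g ` mstates A \<subseteq> mstates B"
  proof clarify
    fix a assume "a \<in> mstates A"
    then show "g a \<in> mstates B"
      using md_map_states[OF assms(2)] assms(3)[OF multipointed_mstates[OF assms(1)]] by metis
  qed
  fix x assume x: "x \<in> mpaths A"
  then have "path_image_under f x = path_image_under g x"
    using paths_in_topspace[OF multipointed_paths_in[OF assms(1) x]] assms(3)
    by (intro path_image_under_cong) blast
  then show "path_image_under g x \<in> mpaths B" using md_map_paths[OF assms(2) x] by simp
qed

lemma md_map_ident:
  assumes "multipointed c P A"
  shows "md_map A A (\<lambda>a. a)"
proof -
  have "path_image_under (\<lambda>a. a) x = x" if "x \<in> mpaths A" for x
    by (rule path_image_under_id[OF multipointed_paths_in[OF assms that]]) (rule refl)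
  then show ?thesis by (simp add: md_map_def)
qed

lemma lightly_generated_image:
  assumes "multipointed c P X" "lightly_generated X" "md_map X Y j" "inj_on j (topspace (mtop X))"
    "x \<in> mpaths X"
  shows "\<exists>e \<in> mpaths Y. light e \<and> (\<exists>\<psi> \<in> Rep_plus. path_image_under j x = reparam e \<psi>)"
proof -
  obtain e \<psi> where e: "e \<in> mpaths X" "light e" "\<psi> \<in> Rep_plus" "x = reparam e \<psi>"
    using assms(2,5) unfolding lightly_generated_def by blast
  have "path_image_under j x = reparam (path_image_under j e) \<psi>"
    unfolding e(4) by (rule path_image_under_reparam) (use e(3) in \<open>auto simp: Rep_plus_iff\<close>)
  moreover have "light (path_image_under j e)"
    using light_path_image_under[OF e(2) assms(4) multipointed_paths_in[OF assms(1) e(1)]] .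
  ultimately show ?thesis using e md_map_paths[OF assms(3) e(1)] by blast
qed

text \<open>As X is \<Delta>-generated, continuity into the final topology may be checked on
  simplices of X, and their images are among the probes.\<close>

lemma md_map_into_light_hull:
  assumes X: "delta_generated (mtop X)" "mstates X \<subseteq> topspace (mtop X)" "mpaths X \<subseteq> paths_in (mtop X)"
    and j: "md_map X Y j" "j ` topspace (mtop X) \<subseteq> S"
    and F: "\<And>p \<sigma> s. (p, \<sigma>) \<in> F \<Longrightarrow> s \<in> topspace (simplex_space p) \<Longrightarrow> \<sigma> s \<in> S"
      "\<And>p f. continuous_map (simplex_space p) (mtop X) f \<Longrightarrow> (p, j \<circ> f) \<in> F"
    and light: "\<And>x. x \<in> mpaths X \<Longrightarrow>
       \<exists>e \<in> mpaths Y. light e \<and> (\<exists>\<psi> \<in> Rep_plus. path_image_under j x = reparam e \<psi>)"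
  shows "md_map X (light_hull Y S F) j"
proof -
  have top: "topspace (simplex_final S F) = S" by (rule topspace_simplex_final) (use F in blast)
  have cont: "continuous_map (mtop X) (simplex_final S F) j"
  proof (rule continuous_map_delta_generated[OF X(1)])
    show "continuous_map (simplex_space p) (simplex_final S F) (j \<circ> f)"
      if "continuous_map (simplex_space p) (mtop X) f" for p f
      using F that by (intro continuous_map_into_simplex_final) auto
  qed (use top j in auto)
  show ?thesis
    unfolding md_map_def
  proof (intro conjI ballI)
    show "continuous_map (mtop X) (mtop (light_hull Y S F)) j" using cont by (simp add: light_hull_def)
    show "j ` mstates X \<subseteq> mstates (light_hull Y S F)"
      using md_map_states[OF j(1)] j(2) X(2) by (auto simp: light_hull_def)
    fix x assume x: "x \<in> mpaths X"
    then have "path_image_under j x \<in> mpaths Y" "path_image_under j x \<in> paths_in (simplex_final S F)"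
      using md_map_paths[OF j(1)] path_image_under_in_paths_in[OF _ cont] X(3) by blast+
    then show "path_image_under j x \<in> mpaths (light_hull Y S F)"
      using light[OF x] by (simp add: light_hull_def)
  qed
qed

lemma globe_paths_in: "mpaths (globe P Z) \<subseteq> paths_in (globe_topology Z)"
proof
  fix x assume "x \<in> mpaths (globe P Z)"
  then obtain z \<phi> where z: "z \<in> topspace Z" "\<phi> \<in> kind_maps P"
    and x: "x = restrict (\<lambda>t. globe_class z (\<phi> t)) {0..1}"
    by (auto simp: globe_def)
  have \<phi>: "continuous_map unit_interval unit_interval \<phi>"
    using kind_maps_nondecreasing[OF z(2)] by (simp add: nondecreasing_maps_def)
  then have "continuous_map unit_interval (prod_topology Z unit_interval) (\<lambda>t. (z, \<phi> t))"
    using z by (simp add: continuous_map_pairwise comp_def)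
  from continuous_map_compose[OF this continuous_map_globe_class]
  have "continuous_map unit_interval (globe_topology Z) (\<lambda>t. globe_class z (\<phi> t))"
    by (simp add: comp_def)
  then show "x \<in> paths_in (globe_topology Z)"
    unfolding x paths_in_def by (auto intro: continuous_map_eq)
qed

lemma globe_states: "mstates (globe P Z) \<subseteq> topspace (mtop (globe P Z))"
  by (auto simp: globe_def topspace_globe_topology globe_carrier_def)

lemma mtop_globe: "mtop (globe P Z) = globe_topology Z"
  by (simp add: globe_def)

text \<open>The resulting map into bounded functions has continuous coordinates; its continuity in
  norm is a separate matter, settled later on simplices.\<close>

lemma assemble_coordinates:
  fixes w :: "('b, 'i) coord \<Rightarrow> 'b \<Rightarrow> real"
  assumes "\<And>k. md_map Y (md_full unit_interval) (w k)" "b \<in> topspace (mtop Y)"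
  shows "apply_bcontfun (Bcontfun (\<lambda>k. w k b)) k = w k b" "w k b \<in> {0..1}"
proof -
  have "w k b \<in> {0..1}" for k
    using md_map_topspace[OF assms(1) assms(2), of k] by (simp add: md_full_def)
  then show "apply_bcontfun (Bcontfun (\<lambda>k. w k b)) k = w k b" "w k b \<in> {0..1}"
    by (simp_all only: apply_Bcontfun_coord)
qed

lemma continuous_map_in_topspace: "continuous_map X Y f \<Longrightarrow> x \<in> topspace X \<Longrightarrow> f x \<in> topspace Y"
  by (auto simp: continuous_map_def Pi_iff)

text \<open>G arises from the interval test, being F on the old stage and the cell extension u on
  the globe. It shows that j is injective, and this makes j a map into the light hull, which is the
  second test. The clause on m \<noteq> l keeps the coordinates of later cells free.\<close>

lemma cell_attachment_embedding:
  fixes F :: "'b \<Rightarrow> ('b, 'i) coord \<Rightarrow>\<^sub>C real"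
  assumes att: "cell_attachment c P X Y j"
    and X: "multipointed c P X" and Y: "multipointed c P Y"
    and F: "cube_embedding X F" and light: "lightly_generated X"
    and fresh: "\<And>a k. a \<in> topspace (mtop X) \<Longrightarrow> F a (Cell l k) = 0"
  shows "\<exists>G. cube_embedding Y G \<and> (\<forall>a \<in> topspace (mtop X). G (j a) = F a) \<and>
    (\<forall>m k. m \<noteq> l \<longrightarrow> (\<forall>a \<in> topspace (mtop X). F a (Cell m k) = 0) \<longrightarrow>
       (\<forall>b \<in> topspace (mtop Y). G b (Cell m k) = 0)) \<and>
    lightly_generated Y"
proof -
  obtain n g h where
    po: "md_pushout c P (globe P (boundary_sphere n)) (globe P (disk n)) X Y id g h j"
    using att by (auto simp: cell_attachment_def)
  let ?K = "globe P (boundary_sphere n)" and ?L = "globe P (disk n)"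
  have g: "md_map ?K X g" and h: "md_map ?L Y h" and j: "md_map X Y j"
    and hg: "\<And>q. q \<in> globe_carrier (boundary_sphere n) \<Longrightarrow> h q = j (g q)"
    using po by (auto simp: md_pushout_def mtop_globe topspace_globe_topology)
  have gX: "g q \<in> topspace (mtop X)" if "q \<in> globe_carrier (boundary_sphere n)" for q
    using md_map_topspace[OF g] that by (simp add: mtop_globe topspace_globe_topology)
  have F_cont: "continuous_map (mtop X) euclidean F" and F_inj: "inj_on F (topspace (mtop X))"
    and F_cube: "valued_in_cube (topspace (mtop X)) F"
    using F by (auto simp: cube_embedding_def)
  define u where "u = globe_extension n l (F \<circ> g)"
  have Fg_cont: "continuous_map (globe_topology (boundary_sphere n)) euclidean (F \<circ> g)"
    using continuous_map_compose[OF md_map_continuous[OF g] F_cont] by (simp add: mtop_globe)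
  have Fg_cube: "valued_in_cube (globe_carrier (boundary_sphere n)) (F \<circ> g)"
    using F_cube gX by (auto simp: valued_in_cube_def)
  have Fg_fresh: "(F \<circ> g) q (Cell l k) = 0" if "q \<in> globe_carrier (boundary_sphere n)" for q k
    using fresh[OF gX[OF that]] by simp
  have u_cont: "continuous_map (globe_topology (disk n)) euclidean u"
    unfolding u_def by (rule continuous_map_globe_extension[OF Fg_cont Fg_cube])
  have u_cube: "valued_in_cube (globe_carrier (disk n)) u"
    unfolding u_def by (rule valued_in_cube_globe_extension[OF Fg_cube Fg_fresh])
  have u_boundary: "u q = F (g q)" if "q \<in> globe_carrier (boundary_sphere n)" for q
    unfolding u_def using globe_extension_boundary[OF that, of l "F \<circ> g"] by simp

  \<comment> \<open>One test for each coordinate k. Into the full interval, continuity is all that a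
    morphism requires, and u and F agree on the boundary of the globe.\<close>
  have "\<exists>w. md_map Y (md_full unit_interval) w \<and> (\<forall>b \<in> topspace (mtop ?L). w (h b) = u b k) \<and>
      (\<forall>b \<in> topspace (mtop X). w (j b) = F b k)" for k
  proof (rule md_pushout_exists[OF po, where emb = Inr])
    show "multipointed c P (md_full unit_interval)"
      by (rule multipointed_md_full[OF space_in_unit_interval])
    show "md_map ?L (md_full unit_interval) (\<lambda>q. u q k)"
      using globe_states globe_paths_in u_cont u_cube
      by (intro md_map_into_md_full continuous_map_unit_interval_coord)
        (simp_all only: mtop_globe topspace_globe_topology)
    show "md_map X (md_full unit_interval) (\<lambda>a. F a k)"
      using X F_cont F_cube
      by (intro md_map_into_md_full continuous_map_unit_interval_coord) (auto simp: multipointed_def)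
    show "u (id q) k = F (g q) k" if "q \<in> topspace (mtop ?K)" for q
      using that u_boundary by (simp add: mtop_globe topspace_globe_topology)
  qed simp
  then obtain w where w: "\<And>k. md_map Y (md_full unit_interval) (w k)"
    "\<And>k b. b \<in> globe_carrier (disk n) \<Longrightarrow> w k (h b) = u b k"
    "\<And>k b. b \<in> topspace (mtop X) \<Longrightarrow> w k (j b) = F b k"
    unfolding mtop_globe topspace_globe_topology by metis
  define G where "G b = Bcontfun (\<lambda>k. w k b)" for b
  have G_apply: "G b k = w k b" "G b k \<in> {0..1}" if "b \<in> topspace (mtop Y)" for b k
    using assemble_coordinates[of Y w b k, OF w(1) that] by (simp_all add: G_def)
  have hY: "h q \<in> topspace (mtop Y)" if "q \<in> globe_carrier (disk n)" for q
    using md_map_topspace[OF h] that by (simp add: mtop_globe topspace_globe_topology)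
  have jY: "j a \<in> topspace (mtop Y)" if "a \<in> topspace (mtop X)" for a
    using md_map_topspace[OF j that] .
  have Gh: "G (h q) = u q" if "q \<in> globe_carrier (disk n)" for q
    by (rule bcontfun_eqI) (simp add: G_apply(1)[OF hY[OF that]] w(2)[OF that])
  have Gj: "G (j a) = F a" if "a \<in> topspace (mtop X)" for a
    by (rule bcontfun_eqI) (simp add: G_apply(1)[OF jY[OF that]] w(3)[OF that])
  have j_inj: "inj_on j (topspace (mtop X))"
  proof (rule inj_onI)
    fix a b assume "a \<in> topspace (mtop X)" "b \<in> topspace (mtop X)" "j a = j b"
    then show "a = b" using Gj[of a] Gj[of b] inj_onD[OF F_inj] by metis
  qed
  have interior: "u (Inner z t) (Cell l 0) > 0"
    "z' \<in> topspace (disk n) \<Longrightarrow> radius n z' < 1 \<Longrightarrow> 0 < t' \<Longrightarrow> t' < 1 \<Longrightarrow>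
       u (Inner z t) = u (Inner z' t') \<Longrightarrow> z = z' \<and> t = t'"
    if "z \<in> topspace (disk n)" "radius n z < 1" "0 < t" "t < 1" for z z' t t'
    unfolding u_def using globe_extension_interior[OF Fg_cube Fg_fresh that] by blast+

  \<comment> \<open>Over a sphere point, a globe path runs in the old stage, which supplies the
    witness. Over an interior point z the witness is the path along z at unit speed, light because u
    is injective on the open cell.\<close>
  have light_cell: "\<exists>e \<in> mpaths Y. light e \<and> (\<exists>\<psi> \<in> Rep_plus. path_image_under h x = reparam e \<psi>)"
    if "x \<in> mpaths ?L" for x
  proof -
    obtain z \<phi> where z: "z \<in> topspace (disk n)" and \<phi>: "\<phi> \<in> kind_maps P"
      and x: "x = restrict (\<lambda>t. globe_class z (\<phi> t)) {0..1}"
      using \<open>x \<in> mpaths ?L\<close> by (auto simp: globe_def)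
    show ?thesis
    proof (cases "radius n z = 1")
      case True
      then have zb: "z \<in> topspace (boundary_sphere n)"
        using z by (auto simp: topspace_disk topspace_boundary_sphere)
      then have xK: "x \<in> mpaths ?K" using \<phi> x by (auto simp: globe_def)
      have "path_image_under h x = path_image_under (j \<circ> g) x"
      proof (rule path_image_under_cong)
        fix t :: real assume "t \<in> {0..1}"
        then have "x t \<in> globe_carrier (boundary_sphere n)"
          using globe_paths_in xK paths_in_topspace topspace_globe_topology by blast
        then show "h (x t) = (j \<circ> g) (x t)" using hg by simp
      qed
      then have "path_image_under h x = path_image_under j (path_image_under g x)"
        by (simp add: path_image_under_comp)
      then show ?thesis
        using lightly_generated_image[OF X light j j_inj md_map_paths[OF g xK]] by simp
    next
      case False
      then have r: "radius n z < 1" using z by (auto simp: topspace_disk)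
      define e where "e = path_image_under h (restrict (\<lambda>t. globe_class z t) {0..1})"
      have "restrict (\<lambda>t. globe_class z t) {0..1} \<in> mpaths ?L"
        unfolding globe_def using z ident_in_kind_maps[of P]
        by simp (intro exI[of _ z] exI[of _ "\<lambda>t. t"], simp)
      then have "e \<in> mpaths Y" unfolding e_def by (rule md_map_paths[OF h])
      moreover have "light e"
      proof (rule light_inj_on, rule inj_onI)
        fix s t :: real assume st: "s \<in> {0<..<1}" "t \<in> {0<..<1}" "e s = e t"
        have e: "e t = h (Inner z t)" "Inner z t \<in> globe_carrier (disk n)" if "t \<in> {0<..<1}" for t
        proof -
          show "e t = h (Inner z t)"
            using that by (auto simp: e_def path_image_under_def globe_class_def)
          show "Inner z t \<in> globe_carrier (disk n)"
            using globe_class_in_carrier[OF z, of t] that by (auto simp: globe_class_def)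
        qed
        have "u (Inner z s) = u (Inner z t)"
          using st e Gh by metis
        then show "s = t" using interior(2)[OF z r _ _ z r] st by auto
      qed
      moreover have "path_image_under h x = reparam e \<phi>"
        unfolding e_def x using kind_maps_range[OF \<phi>]
        by (auto simp: path_image_under_def reparam_def restrict_def fun_eq_iff)
      ultimately show ?thesis using \<phi> kind_maps_subset_Rep_plus by blast
    qed
  qed

  define S where "S = j ` topspace (mtop X) \<union> h ` globe_carrier (disk n)"
  define \<Sigma> where "\<Sigma> = {(p, j \<circ> f) |p f. continuous_map (simplex_space p) (mtop X) f} \<union>
     {(p, h \<circ> f) |p f. continuous_map (simplex_space p) (globe_topology (disk n)) f}"
  have S: "S \<subseteq> topspace (mtop Y)" using jY hY by (auto simp: S_def)
  have \<Sigma>_cases: "(\<exists>f. continuous_map (simplex_space p) (mtop X) f \<and> \<sigma> = j \<circ> f) \<or>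
      (\<exists>f. continuous_map (simplex_space p) (globe_topology (disk n)) f \<and> \<sigma> = h \<circ> f)"
    if "(p, \<sigma>) \<in> \<Sigma>" for p \<sigma>
    using that unfolding \<Sigma>_def by blast
  have \<Sigma>_S: "\<sigma> s \<in> S" if "(p, \<sigma>) \<in> \<Sigma>" and s: "s \<in> topspace (simplex_space p)" for p \<sigma> s
    using \<Sigma>_cases[OF that(1)]
  proof (elim disjE exE conjE)
    fix f assume f: "continuous_map (simplex_space p) (mtop X) f" "\<sigma> = j \<circ> f"
    then show ?thesis using continuous_map_in_topspace[OF f(1) s] by (simp add: S_def)
  next
    fix f assume f: "continuous_map (simplex_space p) (globe_topology (disk n)) f" "\<sigma> = h \<circ> f"
    then show ?thesis using continuous_map_in_topspace[OF f(1) s] by (simp add: S_def topspace_globe_topology)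
  qed
  have \<Sigma>_cont: "continuous_map (simplex_space p) (mtop Y) \<sigma>" if "(p, \<sigma>) \<in> \<Sigma>" for p \<sigma>
    using \<Sigma>_cases[OF that] continuous_map_compose[OF _ md_map_continuous[OF j]]
      continuous_map_compose[OF _ md_map_continuous[OF h]]
    unfolding mtop_globe by blast
  let ?H = "light_hull Y S \<Sigma>"
  have H: "multipointed c P ?H" "md_map ?H Y (\<lambda>b. b)"
    using multipointed_light_hull[of c P Y S \<Sigma>] md_map_light_hull[of c P Y S \<Sigma>] Y S \<Sigma>_S \<Sigma>_cont
    by blast+
  have jH: "md_map X ?H j"
  proof (rule md_map_into_light_hull[OF multipointed_delta_generated[OF X] _ _ j])
    show "mstates X \<subseteq> topspace (mtop X)" "mpaths X \<subseteq> paths_in (mtop X)"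
      using X by (auto simp: multipointed_def)
    show "(p, j \<circ> f) \<in> \<Sigma>" if "continuous_map (simplex_space p) (mtop X) f" for p f
      using that unfolding \<Sigma>_def by blast
  qed (use \<Sigma>_S lightly_generated_image[OF X light j j_inj] S_def in blast)+
  have hH: "md_map ?L ?H h"
  proof (rule md_map_into_light_hull[OF _ _ _ h])
    show "delta_generated (mtop ?L)" by (simp add: mtop_globe delta_generated_globe_disk)
    show "mstates ?L \<subseteq> topspace (mtop ?L)" by (rule globe_states)
    show "mpaths ?L \<subseteq> paths_in (mtop ?L)" unfolding mtop_globe by (rule globe_paths_in)
    show "h ` topspace (mtop ?L) \<subseteq> S" unfolding mtop_globe topspace_globe_topology S_def by blast
    show "(p, h \<circ> f) \<in> \<Sigma>" if "continuous_map (simplex_space p) (mtop ?L) f" for p f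
      using that unfolding \<Sigma>_def mtop_globe by blast
  qed (use \<Sigma>_S light_cell in blast)+
  \<comment> \<open>The hull receives both legs and hence a map w0 from Y. Followed by the inclusion
    it fixes both legs, so by uniqueness it is the identity on points.\<close>
  obtain w0 where w0: "md_map Y ?H w0" "\<forall>b \<in> topspace (mtop ?L). w0 (h b) = h b"
    "\<forall>b \<in> topspace (mtop X). w0 (j b) = j b"
    using md_pushout_exists[OF po, of Inl ?H h j] H(1) hH jH hg
    by (auto simp: mtop_globe topspace_globe_topology)
  have "((\<lambda>b. b) \<circ> w0) b = b" if "b \<in> topspace (mtop Y)" for b
    by (rule md_pushout_unique[OF po, where emb = Inl, OF _ Y md_map_compose[OF w0(1) H(2)] md_map_ident[OF Y] _ _ that])
      (use w0 in auto)
  then have id: "md_map Y ?H (\<lambda>b. b)"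
    by (intro md_map_cong[OF Y w0(1)]) simp
  have YS: "b \<in> S" if "b \<in> topspace (mtop Y)" for b
    using light_hull_imp_topspace[OF Y id] \<Sigma>_S that by blast
  have light_Y: "lightly_generated Y"
    using light_hull_imp_lightly_generated[OF Y id] \<Sigma>_S by blast

  \<comment> \<open>On the generating simplices G restricts to F or to u, both of which are
    continuous in norm.\<close>
  have G_cont: "continuous_map (mtop Y) euclidean G"
  proof (rule light_hull_imp_continuous_map[OF Y id])
    show "\<sigma> s \<in> S" if "(p, \<sigma>) \<in> \<Sigma>" "s \<in> topspace (simplex_space p)" for p \<sigma> s
      using that by (rule \<Sigma>_S)
    fix p \<sigma> assume "(p, \<sigma>) \<in> \<Sigma>"
    then consider f where "continuous_map (simplex_space p) (mtop X) f" "\<sigma> = j \<circ> f"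
      | f where "continuous_map (simplex_space p) (globe_topology (disk n)) f" "\<sigma> = h \<circ> f"
      using \<Sigma>_cases by blast
    then show "continuous_map (simplex_space p) euclidean (G \<circ> \<sigma>)"
    proof cases
      case 1
      show ?thesis
        by (rule continuous_map_eq[OF continuous_map_compose[OF 1(1) F_cont]])
          (simp add: 1(2) Gj continuous_map_in_topspace[OF 1(1)])
    next
      case 2
      show ?thesis
        by (rule continuous_map_eq[OF continuous_map_compose[OF 2(1) u_cont]])
          (use continuous_map_in_topspace[OF 2(1)] in \<open>simp add: 2(2) Gh topspace_globe_topology\<close>)
    qed
  qed simp_all
  have Y_cases: "(\<exists>a \<in> topspace (mtop X). b = j a) \<or>
      (\<exists>z t. b = h (Inner z t) \<and> z \<in> topspace (disk n) \<and> radius n z < 1 \<and> 0 < t \<and> t < 1 \<and>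
         Inner z t \<in> globe_carrier (disk n))"
    if b: "b \<in> topspace (mtop Y)" for b
  proof -
    consider "b \<in> j ` topspace (mtop X)" | q where "q \<in> globe_carrier (disk n)" "b = h q"
      using YS[OF b] unfolding S_def by blast
    then show ?thesis
    proof cases
      case 2
      from 2(1) show ?thesis
      proof (cases rule: globe_carrier_cases)
        case 1
        then show ?thesis using 2 hg gX by blast
      next
        case (2 z t)
        then show ?thesis using \<open>b = h q\<close> \<open>q \<in> _\<close> by blast
      qed
    qed blast
  qed
  have G_inj: "inj_on G (topspace (mtop Y))"
  proof (rule inj_onI)
    fix b b' assume b: "b \<in> topspace (mtop Y)" "b' \<in> topspace (mtop Y)" and eq: "G b = G b'"
    have mixed: False if "a \<in> topspace (mtop X)" "z \<in> topspace (disk n)" "radius n z < 1" "0 < t" "t < 1"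
      "Inner z t \<in> globe_carrier (disk n)" "G (j a) = G (h (Inner z t))" for a z t
      using interior(1)[OF that(2-5)] fresh[OF that(1), of 0] Gj[OF that(1)] Gh[OF that(6)] that(7) by simp
    from Y_cases[OF b(1)] Y_cases[OF b(2)] show "b = b'"
    proof (elim disjE bexE exE conjE)
      fix a a' assume "a \<in> topspace (mtop X)" "b = j a" "a' \<in> topspace (mtop X)" "b' = j a'"
      then show ?thesis using eq Gj inj_onD[OF F_inj] by metis
    next
      fix a z t assume "a \<in> topspace (mtop X)" "b = j a" "b' = h (Inner z t)" "z \<in> topspace (disk n)"
        "radius n z < 1" "0 < t" "t < 1" "Inner z t \<in> globe_carrier (disk n)"
      then show ?thesis using mixed[of a z t] eq by simp
    next
      fix a z t assume "a \<in> topspace (mtop X)" "b' = j a" "b = h (Inner z t)" "z \<in> topspace (disk n)"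
        "radius n z < 1" "0 < t" "t < 1" "Inner z t \<in> globe_carrier (disk n)"
      then show ?thesis using mixed[of a z t] eq by simp
    next
      fix z t z' t' assume *: "b = h (Inner z t)" "z \<in> topspace (disk n)" "radius n z < 1" "0 < t" "t < 1"
        "Inner z t \<in> globe_carrier (disk n)" "b' = h (Inner z' t')" "z' \<in> topspace (disk n)"
        "radius n z' < 1" "0 < t'" "t' < 1" "Inner z' t' \<in> globe_carrier (disk n)"
      then have "u (Inner z t) = u (Inner z' t')" using eq Gh by simp
      then show ?thesis using interior(2)[OF *(2-5) *(8-11)] * by simp
    qed
  qed
  have G_support: "G b (Cell m k) = 0"
    if m: "m \<noteq> l" "\<forall>a \<in> topspace (mtop X). F a (Cell m k) = 0" and b: "b \<in> topspace (mtop Y)" for m k b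
    using Y_cases[OF b]
  proof (elim disjE bexE exE conjE)
    fix a assume "a \<in> topspace (mtop X)" "b = j a"
    then show ?thesis using m Gj by simp
  next
    fix z t assume *: "b = h (Inner z t)" "z \<in> topspace (disk n)" "0 < t" "t < 1"
      "Inner z t \<in> globe_carrier (disk n)"
    have "u (Inner z t) (Cell m k) = cell_vector n l z t (Cell m k :: ('b, 'i) coord)"
      unfolding u_def
      using cell_extension_convex(2)[OF Fg_cube *(2), of t "Cell m k" l] * m gX by simp
    then show ?thesis using m Gh[OF *(5)] * by (simp add: apply_cell_vector)
  qed
  have "cube_embedding Y G"
    using G_cont G_inj G_apply(2) by (simp add: cube_embedding_def valued_in_cube_def)
  then show ?thesis
    using Gj G_support light_Y by blast
qed

section \<open>Colimits of chains\<close>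

text \<open>The two tests are run with the stages as legs. In a chain, any two points of D come from
  a common stage, where the map is injective. That every point of D comes from a stage is part of
  the conclusion because vanishing of coordinates at limit stages is deduced from it.\<close>

lemma colimit_embedding:
  fixes F :: "'i \<Rightarrow> 'b \<Rightarrow> ('b, 'i) coord \<Rightarrow>\<^sub>C real"
  assumes colim: "md_colimit c P r I X f D k"
    and X: "\<And>i. i \<in> I \<Longrightarrow> multipointed c P (X i)" and D: "multipointed c P D"
    and total: "\<And>i i'. i \<in> I \<Longrightarrow> i' \<in> I \<Longrightarrow> (i, i') \<in> r \<or> (i', i) \<in> r"
    and f: "\<And>i i'. i \<in> I \<Longrightarrow> i' \<in> I \<Longrightarrow> (i, i') \<in> r \<Longrightarrow> md_map (X i) (X i') (f i i')"
    and F: "\<And>i. i \<in> I \<Longrightarrow> cube_embedding (X i) (F i)"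
    and light: "\<And>i. i \<in> I \<Longrightarrow> lightly_generated (X i)"
    and compat: "\<And>i i' a. i \<in> I \<Longrightarrow> i' \<in> I \<Longrightarrow> (i, i') \<in> r \<Longrightarrow> a \<in> topspace (mtop (X i)) \<Longrightarrow>
      F i' (f i i' a) = F i a"
  shows "\<exists>G. cube_embedding D G \<and> (\<forall>i \<in> I. \<forall>a \<in> topspace (mtop (X i)). G (k i a) = F i a) \<and>
    (\<forall>b \<in> topspace (mtop D). \<exists>i \<in> I. \<exists>a \<in> topspace (mtop (X i)). b = k i a) \<and>
    lightly_generated D"
proof -
  have k: "md_map (X i) D (k i)" if "i \<in> I" for i
    using colim that by (auto simp: md_colimit_def md_cocone_def)
  have kf: "k i' (f i i' a) = k i a"
    if "i \<in> I" "i' \<in> I" "(i, i') \<in> r" "a \<in> topspace (mtop (X i))" for i i' a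
    using colim that by (auto simp: md_colimit_def md_cocone_def)
  have F_cont: "continuous_map (mtop (X i)) euclidean (F i)"
    and F_inj: "inj_on (F i) (topspace (mtop (X i)))"
    and F_cube: "valued_in_cube (topspace (mtop (X i))) (F i)" if "i \<in> I" for i
    using F[OF that] by (auto simp: cube_embedding_def)
  have "\<exists>w. md_map D (md_full unit_interval) w \<and>
      (\<forall>i \<in> I. \<forall>a \<in> topspace (mtop (X i)). w (k i a) = (\<lambda>i a. F i a l) i a)" for l
  proof (rule md_colimit_exists[OF colim, where emb = Inr])
    show "multipointed c P (md_full unit_interval)"
      by (rule multipointed_md_full[OF space_in_unit_interval])
    show "md_cocone r I X f (md_full unit_interval) (\<lambda>i a. F i a l)"
      unfolding md_cocone_def
    proof (intro conjI ballI impI)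
      show "md_map (X i) (md_full unit_interval) (\<lambda>a. F i a l)" if "i \<in> I" for i
        using X[OF that] F_cont[OF that] F_cube[OF that]
        by (intro md_map_into_md_full continuous_map_unit_interval_coord) (auto simp: multipointed_def)
    qed (use compat in simp)
  qed simp
  then obtain w where w: "\<And>l. md_map D (md_full unit_interval) (w l)"
    "\<And>l i a. i \<in> I \<Longrightarrow> a \<in> topspace (mtop (X i)) \<Longrightarrow> w l (k i a) = F i a l"
    by metis
  define G where "G b = Bcontfun (\<lambda>l. w l b)" for b
  have G_apply: "G b l = w l b" "G b l \<in> {0..1}" if "b \<in> topspace (mtop D)" for b l
    using assemble_coordinates[of D w b l, OF w(1) that] by (simp_all add: G_def)
  have kD: "k i a \<in> topspace (mtop D)" if "i \<in> I" "a \<in> topspace (mtop (X i))" for i a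
    using md_map_topspace[OF k[OF that(1)] that(2)] .
  have Gk: "G (k i a) = F i a" if "i \<in> I" "a \<in> topspace (mtop (X i))" for i a
    by (rule bcontfun_eqI) (simp add: G_apply(1)[OF kD[OF that]] w(2)[OF that])
  have k_inj: "inj_on (k i) (topspace (mtop (X i)))" if "i \<in> I" for i
  proof (rule inj_onI)
    fix a b assume "a \<in> topspace (mtop (X i))" "b \<in> topspace (mtop (X i))" "k i a = k i b"
    then show "a = b" using Gk[OF that] inj_onD[OF F_inj[OF that]] by metis
  qed

  define S where "S = (\<Union>i\<in>I. k i ` topspace (mtop (X i)))"
  define \<Sigma> where "\<Sigma> = {(p, k i \<circ> \<sigma>) |p i \<sigma>. i \<in> I \<and> continuous_map (simplex_space p) (mtop (X i)) \<sigma>}"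
  have S: "S \<subseteq> topspace (mtop D)" using kD by (auto simp: S_def)
  have \<Sigma>_S: "\<sigma> s \<in> S" if mem: "(p, \<sigma>) \<in> \<Sigma>" and s: "s \<in> topspace (simplex_space p)" for p \<sigma> s
  proof -
    obtain i \<tau> where *: "i \<in> I" "continuous_map (simplex_space p) (mtop (X i)) \<tau>" "\<sigma> = k i \<circ> \<tau>"
      using mem unfolding \<Sigma>_def by blast
    then show ?thesis using continuous_map_in_topspace[OF *(2) s] by (auto simp: S_def)
  qed
  have \<Sigma>_cont: "continuous_map (simplex_space p) (mtop D) \<sigma>" if "(p, \<sigma>) \<in> \<Sigma>" for p \<sigma>
    using that continuous_map_compose[OF _ md_map_continuous[OF k]] unfolding \<Sigma>_def by blast
  let ?H = "light_hull D S \<Sigma>"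
  have H: "multipointed c P ?H" "md_map ?H D (\<lambda>b. b)"
    using multipointed_light_hull[of c P D S \<Sigma>] md_map_light_hull[of c P D S \<Sigma>] D S \<Sigma>_S \<Sigma>_cont
    by blast+
  have kH: "md_map (X i) ?H (k i)" if i: "i \<in> I" for i
  proof (rule md_map_into_light_hull[OF multipointed_delta_generated[OF X[OF i]] _ _ k[OF i]])
    show "mstates (X i) \<subseteq> topspace (mtop (X i))" "mpaths (X i) \<subseteq> paths_in (mtop (X i))"
      using X[OF i] by (auto simp: multipointed_def)
    show "k i ` topspace (mtop (X i)) \<subseteq> S" using i unfolding S_def by blast
    show "(p, k i \<circ> \<sigma>) \<in> \<Sigma>" if "continuous_map (simplex_space p) (mtop (X i)) \<sigma>" for p \<sigma>
      using that i unfolding \<Sigma>_def by blast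
  qed (use \<Sigma>_S lightly_generated_image[OF X[OF i] light[OF i] k[OF i] k_inj[OF i]] in blast)+
  have "md_cocone r I X f ?H k" using kH kf by (simp add: md_cocone_def)
  then obtain w0 where w0: "md_map D ?H w0" "\<forall>i \<in> I. \<forall>a \<in> topspace (mtop (X i)). w0 (k i a) = k i a"
    using md_colimit_exists[OF colim, of Inl ?H k] H(1) by auto
  have "((\<lambda>b. b) \<circ> w0) b = b" if "b \<in> topspace (mtop D)" for b
    by (rule md_colimit_unique[OF colim, where emb = Inl, OF _ D md_map_compose[OF w0(1) H(2)] md_map_ident[OF D] _ that])
      (use w0 in auto)
  then have id: "md_map D ?H (\<lambda>b. b)"
    by (intro md_map_cong[OF D w0(1)]) simp
  have DS: "\<exists>i \<in> I. \<exists>a \<in> topspace (mtop (X i)). b = k i a" if "b \<in> topspace (mtop D)" for b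
  proof -
    have "topspace (mtop D) \<subseteq> S" using light_hull_imp_topspace[OF D id] \<Sigma>_S by blast
    then show ?thesis using that unfolding S_def by blast
  qed
  have light_D: "lightly_generated D"
    using light_hull_imp_lightly_generated[OF D id] \<Sigma>_S by blast
  have G_cont: "continuous_map (mtop D) euclidean G"
  proof (rule light_hull_imp_continuous_map[OF D id])
    show "\<sigma> s \<in> S" if "(p, \<sigma>) \<in> \<Sigma>" "s \<in> topspace (simplex_space p)" for p \<sigma> s
      using that by (rule \<Sigma>_S)
    fix p \<sigma> assume "(p, \<sigma>) \<in> \<Sigma>"
    then obtain i \<tau> where *: "i \<in> I" "continuous_map (simplex_space p) (mtop (X i)) \<tau>" "\<sigma> = k i \<circ> \<tau>"
      unfolding \<Sigma>_def by blast
    show "continuous_map (simplex_space p) euclidean (G \<circ> \<sigma>)"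
      by (rule continuous_map_eq[OF continuous_map_compose[OF *(2) F_cont[OF *(1)]]])
        (simp add: *(3) Gk[OF *(1)] continuous_map_in_topspace[OF *(2)])
  qed simp_all
  have G_inj_le: "k i a = k i' a'"
    if "i \<in> I" "i' \<in> I" "(i, i') \<in> r" "a \<in> topspace (mtop (X i))" "a' \<in> topspace (mtop (X i'))"
      "F i a = F i' a'" for i i' a a'
  proof -
    have "F i' (f i i' a) = F i' a'" using compat that by simp
    then have "f i i' a = a'"
      using inj_onD[OF F_inj[OF that(2)]] md_map_topspace[OF f[OF that(1-3)] that(4)] that(5) by blast
    then show ?thesis using kf[OF that(1-4)] by simp
  qed
  have "inj_on G (topspace (mtop D))"
  proof (rule inj_onI)
    fix b b' assume "b \<in> topspace (mtop D)" "b' \<in> topspace (mtop D)" "G b = G b'"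
    then obtain i a i' a' where *: "i \<in> I" "a \<in> topspace (mtop (X i))" "b = k i a"
      "i' \<in> I" "a' \<in> topspace (mtop (X i'))" "b' = k i' a'" "F i a = F i' a'"
      using DS Gk by metis
    then show "b = b'"
      using total[OF *(1,4)] G_inj_le[of i i' a a'] G_inj_le[of i' i a' a] by auto
  qed
  then have "cube_embedding D G"
    using G_cont G_apply(2) by (simp add: cube_embedding_def valued_in_cube_def)
  then show ?thesis
    using Gk DS light_D by blast
qed

section \<open>Cellular objects\<close>

lemma cellular_embedding:
  fixes B :: "'b mdspace"
  assumes "cellular TYPE('i) c P B"
  shows "\<exists>G :: 'b \<Rightarrow> ('b, 'i) coord \<Rightarrow>\<^sub>C real. cube_embedding B G \<and> lightly_generated B"
proof -
  obtain r :: "'i rel" and X f k where tower: "cell_tower c P r X f"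
    and colim: "md_colimit c P r (Field r) X f B k" and B: "multipointed c P B"
    using assms by (auto simp: cellular_def)
  have wo: "Well_order r" and X: "\<And>i. i \<in> Field r \<Longrightarrow> multipointed c P (X i)"
    and f: "\<And>i j. (i, j) \<in> r \<Longrightarrow> md_map (X i) (X j) (f i j)"
    and f_id: "\<And>i a. i \<in> Field r \<Longrightarrow> a \<in> topspace (mtop (X i)) \<Longrightarrow> f i i a = a"
    and f_comp: "\<And>i j k a. (i, j) \<in> r \<Longrightarrow> (j, k) \<in> r \<Longrightarrow> a \<in> topspace (mtop (X i)) \<Longrightarrow>
      f j k (f i j a) = f i k a"
    and bottom: "\<And>i. i \<in> Field r \<Longrightarrow> underS r i = {} \<Longrightarrow> \<exists>S. X i = md_discrete S"
    and succ: "\<And>i j. immediate_succ r i j \<Longrightarrow> cell_attachment c P (X i) (X j) (f i j)"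
    and limit: "\<And>j. j \<in> Field r \<Longrightarrow> underS r j \<noteq> {} \<Longrightarrow> \<nexists>i. immediate_succ r i j \<Longrightarrow>
      md_colimit c P r (underS r j) X f (X j) (\<lambda>i. f i j)"
    using tower unfolding cell_tower_def by blast+
  have refl: "(i, i) \<in> r" if "i \<in> Field r" for i
    using wo that by (auto simp: order_on_defs refl_on_def)
  have trans: "(i, k) \<in> r" if "(i, j) \<in> r" "(j, k) \<in> r" for i j k
    using wo that by (auto simp: order_on_defs dest: transD)
  have antisym: "i = j" if "(i, j) \<in> r" "(j, i) \<in> r" for i j
    using wo that by (auto simp: order_on_defs dest: antisymD)
  have total: "(i, j) \<in> r \<or> (j, i) \<in> r" if "i \<in> Field r" "j \<in> Field r" for i j
    using wo that refl by (cases "i = j") (auto simp: order_on_defs total_on_def)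
  have under: "i \<in> Field r" "(i, j) \<in> r" "i \<noteq> j" if "i \<in> underS r j" for i j
    using that by (auto simp: underS_def Field_def)
  have wf: "wf (r - Id)" using wo by (simp add: well_order_on_def)

  \<comment> \<open>Among the cell coordinates, stage j may be nonzero only in families
    \<open>Cell m\<close> with m below or equal to j, so the family of every later cell is still
    free. Outside the field the condition is void, which makes the recursion total.\<close>
  define Q :: "('i \<Rightarrow> 'b \<Rightarrow> ('b, 'i) coord \<Rightarrow>\<^sub>C real) \<Rightarrow> 'i \<Rightarrow> ('b \<Rightarrow> ('b, 'i) coord \<Rightarrow>\<^sub>C real) \<Rightarrow> bool"
    where "Q F j G \<longleftrightarrow> (j \<in> Field r \<longrightarrow> cube_embedding (X j) G \<and> lightly_generated (X j) \<and>
      (\<forall>i \<in> underS r j. \<forall>a \<in> topspace (mtop (X i)). G (f i j a) = F i a) \<and>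
      (\<forall>a \<in> topspace (mtop (X j)). \<forall>m k. (m, j) \<notin> r \<longrightarrow> G a (Cell m k) = 0))" for F j G
  \<comment> \<open>Dependent choice along the well-order is essential: strict compatibility refers
    to the maps already chosen at earlier stages.\<close>
  have "\<exists>F. \<forall>j. Q F j (F j)"
  proof (rule dependent_wf_choice[OF wf])
    show "Q F j G = Q F' j G" if "\<And>i. (i, j) \<in> r - Id \<Longrightarrow> F i = F' i" for F F' j G
    proof -
      have "F i = F' i" if "i \<in> underS r j" for i
        using under[OF that] \<open>\<And>i. (i, j) \<in> r - Id \<Longrightarrow> F i = F' i\<close> by blast
      then show ?thesis by (simp add: Q_def)
    qed
  next
    fix j F assume IH: "\<And>i. (i, j) \<in> r - Id \<Longrightarrow> Q F i (F i)"
    show "\<exists>G. Q F j G"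
    proof (cases "j \<in> Field r")
      case False
      then show ?thesis by (simp add: Q_def)
    next
      case j: True
      have F: "cube_embedding (X i) (F i)" "lightly_generated (X i)"
        "\<And>i' a. i' \<in> underS r i \<Longrightarrow> a \<in> topspace (mtop (X i')) \<Longrightarrow> F i (f i' i a) = F i' a"
        "\<And>a m k. a \<in> topspace (mtop (X i)) \<Longrightarrow> (m, i) \<notin> r \<Longrightarrow> F i a (Cell m k) = 0"
        if "i \<in> underS r j" for i
        using IH[of i] under[OF that] by (auto simp: Q_def)
      have compat: "F i' (f i i' a) = F i a"
        if "i' \<in> underS r j" "(i, i') \<in> r" "a \<in> topspace (mtop (X i))" for i i' a
      proof (cases "i = i'")
        case True
        then show ?thesis using f_id that under(1) by metis
      next
        case False
        then show ?thesis using F(3)[OF that(1)] that by (auto simp: underS_def)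
      qed
      consider "underS r j = {}" | i where "immediate_succ r i j"
        | "underS r j \<noteq> {}" "\<nexists>i. immediate_succ r i j" by blast
      then show ?thesis
      proof cases
        case 1
        then obtain S where S: "X j = md_discrete S" using bottom j by blast
        have "inj (\<lambda>a. basis_vector (Point a) :: ('b, 'i) coord \<Rightarrow>\<^sub>C real)"
        proof (rule injI)
          fix a b assume "(basis_vector (Point a) :: ('b, 'i) coord \<Rightarrow>\<^sub>C real) = basis_vector (Point b)"
          from arg_cong[OF this, of "\<lambda>v. apply_bcontfun v (Point a)"] show "a = b"
            by (simp add: apply_basis_vector split: if_splits)
        qed
        then have "cube_embedding (X j) (\<lambda>a. basis_vector (Point a) :: ('b, 'i) coord \<Rightarrow>\<^sub>C real)"
          by (auto simp: cube_embedding_def S md_discrete_def valued_in_cube_def apply_basis_vector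
              intro: inj_on_subset)
        then show ?thesis
          using 1 by (intro exI[of _ "\<lambda>a. basis_vector (Point a)"])
            (auto simp: Q_def apply_basis_vector S lightly_generated_def md_discrete_def)
      next
        case (2 i)
        then have i: "i \<in> underS r j" and max: "\<And>i'. i' \<in> underS r j \<Longrightarrow> (i', i) \<in> r"
          by (auto simp: immediate_succ_def)
        \<comment> \<open>The new stage j itself labels the single cell attached between i and j.
          Since j is not below i, its family of coordinates still vanishes at stage i.\<close>
        have "(j, i) \<notin> r" using antisym under(2,3)[OF i] by blast
        then have fresh: "F i a (Cell j k) = 0" if "a \<in> topspace (mtop (X i))" for a k
          using F(4)[OF i that] by blast
        obtain G where G: "cube_embedding (X j) G" "\<forall>a \<in> topspace (mtop (X i)). G (f i j a) = F i a"
          "\<forall>m k. m \<noteq> j \<longrightarrow> (\<forall>a \<in> topspace (mtop (X i)). F i a (Cell m k) = 0) \<longrightarrow>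
             (\<forall>b \<in> topspace (mtop (X j)). G b (Cell m k) = 0)"
          "lightly_generated (X j)"
          using cell_attachment_embedding[OF succ[OF 2] X[OF under(1)[OF i]] X[OF j] F(1,2)[OF i] fresh]
          by blast
        have "G (f i' j a) = F i' a" if i': "i' \<in> underS r j" and a: "a \<in> topspace (mtop (X i'))" for i' a
        proof -
          have "f i' j a = f i j (f i' i a)"
            using f_comp[OF max[OF i'] under(2)[OF i] a] by simp
          moreover have "f i' i a \<in> topspace (mtop (X i))"
            using md_map_topspace[OF f[OF max[OF i']] a] .
          ultimately show ?thesis using G(2) compat[OF i max[OF i'] a] by simp
        qed
        moreover have "G b (Cell m k) = 0"
          if "b \<in> topspace (mtop (X j))" "(m, j) \<notin> r" for b m k
        proof -
          have "m \<noteq> j" using refl[OF j] that(2) by blast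
          moreover have "(m, i) \<notin> r" using trans[OF _ under(2)[OF i]] that(2) by blast
          ultimately show ?thesis using G(3) F(4)[OF i] that(1) by blast
        qed
        ultimately have "Q F j G" using G(1,4) by (simp add: Q_def)
        then show ?thesis by blast
      next
        case 3
        have "\<exists>G. cube_embedding (X j) G \<and>
            (\<forall>i \<in> underS r j. \<forall>a \<in> topspace (mtop (X i)). G (f i j a) = F i a) \<and>
            (\<forall>b \<in> topspace (mtop (X j)). \<exists>i \<in> underS r j. \<exists>a \<in> topspace (mtop (X i)). b = f i j a) \<and>
            lightly_generated (X j)"
          by (rule colimit_embedding[OF limit[OF j 3]])
            (simp_all add: X under(1) j total f F(1,2) compat)
        then obtain G where G: "cube_embedding (X j) G"
          "\<forall>i \<in> underS r j. \<forall>a \<in> topspace (mtop (X i)). G (f i j a) = F i a"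
          "\<forall>b \<in> topspace (mtop (X j)). \<exists>i \<in> underS r j. \<exists>a \<in> topspace (mtop (X i)). b = f i j a"
          "lightly_generated (X j)" by blast
        have "G b (Cell m k) = 0" if b: "b \<in> topspace (mtop (X j))" and m: "(m, j) \<notin> r" for b m k
        proof -
          obtain i a where i: "i \<in> underS r j" and a: "a \<in> topspace (mtop (X i))" "b = f i j a"
            using G(3) b by blast
          have "(m, i) \<notin> r" using trans[OF _ under(2)[OF i]] m by blast
          then show ?thesis using G(2) i a F(4)[OF i a(1)] by simp
        qed
        then have "Q F j G" using G by (simp add: Q_def)
        then show ?thesis by blast
      qed
    qed
  qed
  then obtain F where "\<And>j. Q F j (F j)" by blast
  then have F: "cube_embedding (X j) (F j)" "lightly_generated (X j)"
    "\<And>i a. i \<in> underS r j \<Longrightarrow> a \<in> topspace (mtop (X i)) \<Longrightarrow> F j (f i j a) = F i a"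
    if "j \<in> Field r" for j
    using that by (auto simp: Q_def)
  have compat: "F j (f i j a) = F i a" if "(i, j) \<in> r" "a \<in> topspace (mtop (X i))" for i j a
  proof (cases "i = j")
    case True
    then show ?thesis using f_id that FieldI1 by metis
  next
    case False
    then show ?thesis using F(3)[OF FieldI2[OF that(1)]] that by (auto simp: underS_def)
  qed
  have "\<exists>G. cube_embedding B G \<and>
      (\<forall>i \<in> Field r. \<forall>a \<in> topspace (mtop (X i)). G (k i a) = F i a) \<and>
      (\<forall>b \<in> topspace (mtop B). \<exists>i \<in> Field r. \<exists>a \<in> topspace (mtop (X i)). b = k i a) \<and>
      lightly_generated B"
    by (rule colimit_embedding[OF colim]) (simp_all add: X B total f F(1,2) compat)
  then show ?thesis by blast
qed

section \<open>Clocks and retracts\<close>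

text \<open>\<open>submetrizable\<close> asks for a metric on the point type of X, so the norm
  distance is pulled back along G. Injectivity makes it a metric, and the required injection becomes
  the identity.\<close>

lemma submetrizableI:
  fixes G :: "'a \<Rightarrow> 'v :: real_normed_vector"
  assumes "continuous_map X euclidean G" "inj_on G (topspace X)"
  shows "submetrizable X"
proof -
  interpret Metric_space "topspace X" "\<lambda>x y. dist (G x) (G y)"
    using assms(2) by unfold_locales (auto simp: dist_commute dist_triangle inj_on_eq_iff)
  have "continuous_map X mtopology (\<lambda>x. x)"
    unfolding continuous_map_to_metric
  proof (intro ballI allI impI)
    fix x and e :: real assume x: "x \<in> topspace X" and "e > 0"
    then obtain U where U: "openin X U" "x \<in> U" "\<forall>y \<in> U. dist (G x) (G y) < e"
      using assms(1) unfolding continuous_map_euclidean_eps by blast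
    have "y \<in> mball x e" if "y \<in> U" for y
      using x U(3) that openin_subset[OF U(1)] unfolding in_mball by blast
    then show "\<exists>U. openin X U \<and> x \<in> U \<and> (\<forall>y \<in> U. y \<in> mball x e)" using U(1,2) by blast
  qed
  then have "continuous_map X (mtopology_of Self) (\<lambda>x. x)" by (simp add: mtopology_of_def)
  then show ?thesis unfolding submetrizable_def by (intro exI[of _ Self] exI[of _ "\<lambda>x. x"]) simp
qed

section \<open>Functoriality of \<open>Sp\<close> and passage to retracts\<close>

lemma directed_space_Sp:
  assumes "multipointed c P A"
  shows "directed_space c (Sp A)"
  unfolding directed_space_def Sp_def
  using multipointed_space_in[OF assms] Sp_paths_in_paths_in[OF assms]
  by (auto intro: Sp_paths.intros)

lemma Sp_paths_image:
  assumes "md_map A B s" "x \<in> Sp_paths A"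
  shows "path_image_under s x \<in> Sp_paths B"
  using assms(2)
proof induction
  case (execution x)
  then show ?case using md_map_paths[OF assms(1)] by (blast intro: Sp_paths.execution)
next
  case (const a)
  then show ?case
    using md_map_topspace[OF assms(1)] by (simp add: path_image_under_const Sp_paths.const)
next
  case (reparam x \<phi>)
  then have "path_image_under s (reparam x \<phi>) = reparam (path_image_under s x) \<phi>"
    by (intro path_image_under_reparam) (auto simp: nondecreasing_maps_iff image_subset_iff)
  then show ?case using Sp_paths.reparam[OF reparam.IH reparam.hyps(2)] by simp
next
  case (comp x y)
  have "path_image_under s x 1 = path_image_under s y 0"
    using comp.hyps by (simp add: path_image_under_def)
  then show ?case
    unfolding path_image_under_normalized_comp by (rule Sp_paths.comp[OF comp.IH])
qed

text \<open>The path is pushed to B along s, freed of \<phi> there, and brought back along r.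
  Saturation is transferred in place of light generation, since r may collapse an interval of a
  light path.\<close>

lemma saturated_Sp_retract:
  assumes A: "multipointed c P A" and s: "md_map A B s" and r: "md_map B A r"
    and rs: "\<And>a. a \<in> topspace (mtop A) \<Longrightarrow> r (s a) = a"
    and sat: "saturated (Sp B)"
  shows "saturated (Sp A)"
  unfolding saturated_def
proof (intro ballI impI)
  fix x \<phi> assume "x \<in> paths_in (dtop (Sp A))" and \<phi>: "\<phi> \<in> Rep_plus" and "reparam x \<phi> \<in> dpaths (Sp A)"
  then have x: "x \<in> paths_in (mtop A)" and xr: "reparam x \<phi> \<in> Sp_paths A" by (auto simp: Sp_def)
  have "path_image_under s (reparam x \<phi>) = reparam (path_image_under s x) \<phi>"
    using \<phi> by (intro path_image_under_reparam) (auto simp: Rep_plus_iff)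
  then have "reparam (path_image_under s x) \<phi> \<in> dpaths (Sp B)"
    using Sp_paths_image[OF s xr] by (simp add: Sp_def)
  moreover have "path_image_under s x \<in> paths_in (dtop (Sp B))"
    using path_image_under_in_paths_in[OF x md_map_continuous[OF s]] by (simp add: Sp_def)
  ultimately have "path_image_under s x \<in> Sp_paths B"
    using sat \<phi> unfolding saturated_def Sp_def by auto
  then have "path_image_under r (path_image_under s x) \<in> Sp_paths A" by (rule Sp_paths_image[OF r])
  moreover have "path_image_under r (path_image_under s x) = x"
    unfolding path_image_under_comp by (rule path_image_under_id[OF x]) (simp add: rs)
  ultimately show "x \<in> dpaths (Sp A)" by (simp add: Sp_def)
qed

lemma timed_space_id:
  assumes "clock c C" "saturated C"
  shows "timed_space c C C id"
proof -
  have C: "directed_space c C" using assms(1) by (simp add: clock_def)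
  have "path_image_under id x = x" if "x \<in> dpaths C" for x
    using path_image_under_id[of x "dtop C" id] C that by (auto simp: directed_space_def)
  then have "regular_map C C id" by (simp add: regular_map_def directed_map_def)
  then show ?thesis using assms C by (simp add: timed_space_def)
qed

theorem theorem7p5:
  fixes A :: "'a mdspace" and P :: reparam_kind and c :: space_category
  assumes "q_cofibrant TYPE('b) TYPE('i) c P A"
  shows "clock c (Sp A) \<and> saturated (Sp A) \<and> timed_space c (Sp A) (Sp A) id"
proof -
  obtain B :: "'b mdspace" and s r where A: "multipointed c P A" and cell: "cellular TYPE('i) c P B"
    and s: "md_map A B s" and r: "md_map B A r" and rs: "\<And>a. a \<in> topspace (mtop A) \<Longrightarrow> r (s a) = a"
    using assms by (auto simp: q_cofibrant_def md_retract_def)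
  have B: "multipointed c P B" using cell by (auto simp: cellular_def)
  obtain G :: "'b \<Rightarrow> ('b, 'i) coord \<Rightarrow>\<^sub>C real" where G: "cube_embedding B G" and light: "lightly_generated B"
    using cellular_embedding[OF cell] by blast
  have "submetrizable (mtop A)"
  proof (rule submetrizableI)
    show "continuous_map (mtop A) euclidean (G \<circ> s)"
      by (rule continuous_map_compose[OF md_map_continuous[OF s]]) (use G in \<open>simp add: cube_embedding_def\<close>)
    show "inj_on (G \<circ> s) (topspace (mtop A))"
    proof (rule inj_onI)
      fix a b assume a: "a \<in> topspace (mtop A)" and b: "b \<in> topspace (mtop A)" and "(G \<circ> s) a = (G \<circ> s) b"
      then have "s a = s b"
        using G md_map_topspace[OF s] by (auto simp: cube_embedding_def dest: inj_onD)
      then show "a = b" using rs[OF a] rs[OF b] by metis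
    qed
  qed
  then have "clock c (Sp A)"
    using directed_space_Sp[OF A] by (simp add: clock_def Sp_def)
  moreover have "saturated (Sp A)"
    using saturated_Sp_retract[OF A s r rs saturated_Sp[OF B light]] .
  ultimately show ?thesis using timed_space_id by blast
qed

end
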